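(* With $(V,\ell)$, $B_{h_1,\ell}$ and $\psi$ as in the context, let $\Psi:B_{h_1,\ell}\to MC(V,\ell)$, $\Psi(v)=\psi(v)(1)$. Then $\Psi$ is smooth, and there exists an open subset $0\in U\subset B_{h_1,\ell}$ such that $\Psi:U\subset\ker(\ell_1|_{V_0})\to MC(V,\ell)\subset\mathbb{R}^n$ is an embedding.
   Context: $(V,\ell)$ is an $N$-strict $L_\infty$-algebra (graded symmetric degree-1 multilinear maps $\ell_k$, $\ell_0=0$, $L_\infty$ Jacobi identities, $\ell_k=0$ for $k\geq N$) with finite-dimensional components, $V_0=\mathbb{R}^n$, and $H^1(V,\ell)=\ker(\ell_1|_{V_1})/\operatorname{im}(\ell_1|_{V_0})=0$; $h_1:V_1\to V_0$, $h_2:V_2\to V_1$ are linear with $\ell_1h_1+h_2\ell_1=\mathrm{id}_{V_1}$. Norms fixed on $V_0,V_1$; $\|h_1\|,\|\ell_i\|$ ($\ell_i:V_0^{\times i}\to V_1$) operator norms; $\alpha_\ell=\sum_{i=1}^N\|\ell_i\|/i!$; $B_{h_1,\ell}=\{v\in\ker(\ell_1|_{V_0}):\|v\|<\frac1{12\|h_1\|\alpha_\ell}\}$. For $v\in B_{h_1,\ell}$: $v_0=0$, $v_1=v$, $v_{k+1}=-h_1\big(\sum_{i=2}^{k+1}\sum_{r_1+\cdots+r_i=k+1,\,r_j\geq1}\frac{(k+1)!}{r_1!\cdots r_i!}\frac1{i!}\ell_i(v_{r_1},\ldots,v_{r_i})\big)$, and $\psi(v)(t)=\sum_{k\geq0}\frac{v_k}{k!}t^k$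 for $t\in[0,2)$. $MC(V,\ell)$ is the zero set of $MC(v)=\sum_{k\geq1}\frac1{k!}\ell_k(v,\ldots,v)$. *)

theory Defs
  imports "HOL-Analysis.Analysis" "HOL-Combinatorics.Permutations"
begin

definition lin_on :: "'a::real_vector set \<Rightarrow> ('a \<Rightarrow> 'b::real_vector) \<Rightarrow> bool" where
  "lin_on S f \<longleftrightarrow> (\<forall>x\<in>S. \<forall>y\<in>S. \<forall>c. f (c *\<^sub>R x + y) = c *\<^sub>R f x + f y)"

definition fin_dim_subspace :: "'a::real_vector set \<Rightarrow> bool" where
  "fin_dim_subspace S \<longleftrightarrow> subspace S \<and> (\<exists>B. finite B \<and> span B = S)"

(* A Z-graded real vector space V = (+)_i V i, realised as an independent family of
   finite-dimensional subspaces of an ambient real normed vector space. *)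
definition graded_fd :: "(int \<Rightarrow> 'a::real_vector set) \<Rightarrow> bool" where
  "graded_fd V \<longleftrightarrow> (\<forall>i. fin_dim_subspace (V i)) \<and>
     (\<forall>I x. finite I \<and> (\<forall>i\<in>I. x i \<in> V i) \<and> sum x I = 0 \<longrightarrow> (\<forall>i\<in>I. x i = 0))"

definition total_space :: "(int \<Rightarrow> 'a::real_vector set) \<Rightarrow> 'a set" where
  "total_space V = span (\<Union>i. V i)"

definition homog :: "(int \<Rightarrow> 'a set) \<Rightarrow> int list \<Rightarrow> 'a list \<Rightarrow> bool" where
  "homog V ds xs \<longleftrightarrow> length ds = length xs \<and> (\<forall>j<length xs. xs ! j \<in> V (ds ! j))"

definition ksign :: "int \<Rightarrow> int \<Rightarrow> real" where
  "ksign a b = (if even (a * b) then 1 else -1)"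

(* Koszul sign of the rearrangement x_{\<sigma> 0}, ..., x_{\<sigma> (n-1)} of homogeneous elements of degrees ds *)
definition koszul :: "int list \<Rightarrow> (nat \<Rightarrow> nat) \<Rightarrow> real" where
  "koszul ds \<sigma> = (\<Prod>(a,b)\<in>{(a,b). a < b \<and> b < length ds \<and> \<sigma> b < \<sigma> a}.
                      ksign (ds ! \<sigma> a) (ds ! \<sigma> b))"

definition unshuffles :: "nat \<Rightarrow> nat \<Rightarrow> (nat \<Rightarrow> nat) set" where
  "unshuffles i n = {\<sigma>. \<sigma> permutes {..<n} \<and>
      (\<forall>a b. a < b \<and> b < i \<longrightarrow> \<sigma> a < \<sigma> b) \<and>
      (\<forall>a b. i \<le> a \<and> a < b \<and> b < n \<longrightarrow> \<sigma> a < \<sigma> b)}"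

(* N-strict L-infinity algebra (shifted / degree-1 convention): l k is the k-ary bracket *)
definition strict_Linf :: "(int \<Rightarrow> 'a::real_vector set) \<Rightarrow> (nat \<Rightarrow> 'a list \<Rightarrow> 'a) \<Rightarrow> nat \<Rightarrow> bool" where
  "strict_Linf V l N \<longleftrightarrow>
     graded_fd V \<and>
     \<comment> \<open>multilinear on V\<close>
     (\<forall>k xs j. length xs = k \<and> set xs \<subseteq> total_space V \<and> j < k \<longrightarrow>
         lin_on (total_space V) (\<lambda>y. l k (xs[j := y]))) \<and>
     \<comment> \<open>degree 1\<close>
     (\<forall>k ds xs. length xs = k \<and> homog V ds xs \<longrightarrow> l k xs \<in> V (sum_list ds + 1)) \<and>
     \<comment> \<open>graded symmetric\<close>
     (\<forall>k ds xs j. length xs = k \<and> homog V ds xs \<and> Suc j < k \<longrightarrow>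
         l k (xs[j := xs ! Suc j, Suc j := xs ! j]) = ksign (ds ! j) (ds ! Suc j) *\<^sub>R l k xs) \<and>
     \<comment> \<open>l_0 = 0\<close>
     l 0 [] = 0 \<and>
     \<comment> \<open>N-strict\<close>
     (\<forall>k ds xs. N \<le> k \<and> length xs = k \<and> homog V ds xs \<longrightarrow> l k xs = 0) \<and>
     \<comment> \<open>L-infinity Jacobi identities\<close>
     (\<forall>n ds xs. 1 \<le> n \<and> length xs = n \<and> homog V ds xs \<longrightarrow>
        (\<Sum>i\<in>{1..n}. \<Sum>\<sigma>\<in>unshuffles i n.
            koszul ds \<sigma> *\<^sub>R l (n - i + 1)
               (l i (map (\<lambda>a. xs ! \<sigma> a) [0..<i]) # map (\<lambda>a. xs ! \<sigma> a) [i..<n])) = 0)"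

definition ml_norm :: "(nat \<Rightarrow> 'a::real_normed_vector list \<Rightarrow> 'b::real_normed_vector) \<Rightarrow> nat \<Rightarrow> 'a set \<Rightarrow> real" where
  "ml_norm l i S = Sup {norm (l i xs) | xs. length xs = i \<and> set xs \<subseteq> S \<and> (\<forall>x\<in>set xs. norm x \<le> 1)}"

definition lin_norm :: "('a::real_normed_vector \<Rightarrow> 'b::real_normed_vector) \<Rightarrow> 'a set \<Rightarrow> real" where
  "lin_norm h S = Sup {norm (h x) | x. x \<in> S \<and> norm x \<le> 1}"

definition alpha_l :: "(nat \<Rightarrow> 'a::real_normed_vector list \<Rightarrow> 'a) \<Rightarrow> nat \<Rightarrow> (int \<Rightarrow> 'a set) \<Rightarrow> real" where
  "alpha_l l N V = (\<Sum>i=1..N. ml_norm l i (V 0) / fact i)"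

(* B_{h_1,l}; the radius 1/(12 ||h_1|| alpha) is read as +infinity when the denominator is 0 *)
definition B_set :: "(int \<Rightarrow> 'a::real_normed_vector set) \<Rightarrow> (nat \<Rightarrow> 'a list \<Rightarrow> 'a) \<Rightarrow> nat \<Rightarrow> ('a \<Rightarrow> 'a) \<Rightarrow> 'a set" where
  "B_set V l N h1 = {v \<in> V 0. l 1 [v] = 0 \<and>
        norm v * (12 * lin_norm h1 (V 1) * alpha_l l N V) < 1}"

definition compositions :: "nat \<Rightarrow> nat \<Rightarrow> nat list set" where
  "compositions i m = {rs. length rs = i \<and> (\<forall>r\<in>set rs. 1 \<le> r) \<and> sum_list rs = m}"

fun psi_list :: "(nat \<Rightarrow> 'a::real_vector list \<Rightarrow> 'a) \<Rightarrow> ('a \<Rightarrow> 'a) \<Rightarrow> 'a \<Rightarrow> nat \<Rightarrow> 'a list" where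
  "psi_list l h1 v 0 = [0]"
| "psi_list l h1 v (Suc k) =
     (let ws = psi_list l h1 v k in
      ws @ [if k = 0 then v else
              - h1 (\<Sum>i\<in>{2..k+1}. \<Sum>rs\<in>compositions i (k+1).
                      (fact (k+1) / (\<Prod>r\<leftarrow>rs. fact r) / fact i) *\<^sub>R l i (map (\<lambda>r. ws ! r) rs))])"

definition vseq :: "(nat \<Rightarrow> 'a::real_vector list \<Rightarrow> 'a) \<Rightarrow> ('a \<Rightarrow> 'a) \<Rightarrow> 'a \<Rightarrow> nat \<Rightarrow> 'a" where
  "vseq l h1 v k = psi_list l h1 v k ! k"

definition psi :: "(nat \<Rightarrow> 'a::real_normed_vector list \<Rightarrow> 'a) \<Rightarrow> ('a \<Rightarrow> 'a) \<Rightarrow> 'a \<Rightarrow> real \<Rightarrow> 'a" where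
  "psi l h1 v t = (\<Sum>k. (t ^ k / fact k) *\<^sub>R vseq l h1 v k)"

definition Psi :: "(nat \<Rightarrow> 'a::real_normed_vector list \<Rightarrow> 'a) \<Rightarrow> ('a \<Rightarrow> 'a) \<Rightarrow> 'a \<Rightarrow> 'a" where
  "Psi l h1 v = psi l h1 v 1"

definition MC_set :: "(int \<Rightarrow> 'a::real_vector set) \<Rightarrow> (nat \<Rightarrow> 'a list \<Rightarrow> 'a) \<Rightarrow> nat \<Rightarrow> 'a set" where
  "MC_set V l N = {x \<in> V 0. (\<Sum>k=1..N. (1 / fact k) *\<^sub>R l k (replicate k x)) = 0}"

(* f is C^\<infinity> on S (S relatively open in the finite-dimensional subspace K):
   D k x hs is the k-th derivative of f at x applied to the directions hs \<in> K^k. *)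
definition smooth_on :: "'a::real_normed_vector set \<Rightarrow> 'a set \<Rightarrow> ('a \<Rightarrow> 'b::real_normed_vector) \<Rightarrow> bool" where
  "smooth_on K S f \<longleftrightarrow> (\<exists>D :: nat \<Rightarrow> 'a \<Rightarrow> 'a list \<Rightarrow> 'b.
      (\<forall>x\<in>S. D 0 x [] = f x) \<and>
      (\<forall>k. \<forall>x\<in>S. \<forall>hs. length hs = k \<and> set hs \<subseteq> K \<longrightarrow>
          ((\<lambda>y. D k y hs) has_derivative (\<lambda>h. D (Suc k) x (h # hs))) (at x within S)))"

definition embedding_on :: "'a::real_normed_vector set \<Rightarrow> 'a set \<Rightarrow> ('a \<Rightarrow> 'b::real_normed_vector) \<Rightarrow> bool" where
  "embedding_on K U f \<longleftrightarrow> smooth_on K U f \<and>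
      (\<forall>x\<in>U. \<exists>f'. (f has_derivative f') (at x within U) \<and> inj_on f' K) \<and>
      (\<exists>g. homeomorphism U (f ` U) f g)"

end

(*
Write w_k = v_k / k! and H(x) = sum_(i >= 2) h1(l_i(x,...,x)) / i!. The recursion for w says that
x = Psi(v) solves x + H(x) = v; if l_1 is nonzero on V_0 then ||h1|| alpha >= 1, and the radius of B
makes the majorant series converge and H a 1/2-contraction near its values. So Psi is a homeomorphism
onto its image with inverse id + H, and U = B works. If l_1 = 0 on V_0, the Jacobi identities and
H^1 = 0 kill all brackets on V_0 and Psi = id.

For the Maurer-Cartan equation, the coefficients M_m of MC(sum_k t^k w_k) satisfy M_m = h2 l_1 M_m,
while the Bianchi identity expresses l_1 M_m through the M_j with j < m; so all of them vanish.

Smoothness: in coordinates, the functions obtained from Psi and the inverse Jacobian of id + H by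
sums and products form an algebra closed under directional derivatives. A derivative must be a
bounded linear map on the whole ambient normed space, so the coordinates of V_0 have to be extended
to it by a Hahn-Banach argument.
*)
theory Submission
  imports Defs
begin

section \<open>Coordinates on finite-dimensional subspaces\<close>

text \<open>The radius of B leaves room for two balls. With p = ||h1|| \<alpha>, data of norm below
  1/(12 p) give solutions of norm at most 1/(6 p), while H is a 1/2-contraction up to radius 1/(4
  p); the gap between the two is spent on the difference quotients that bound H'. Both estimates
  trade higher powers of a radius for lower ones, so the radii must be at most 1: this is the
  purpose of p \<ge> 1.

  The ambient normed space may be incomplete and infinite-dimensional. Limits and fixed points are
  therefore taken inside V_0, and the operators to be inverted are the identity plus a map into V_0.
  Psi itself is extended to an open set by the identity along the kernel of a bounded projection,
  which makes ordinary derivatives available. Differentiating through the inverse id + H avoids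
  differentiating the recursion term by term.

  Reading off coefficients of the Bianchi identity algebraically would call for Jacobi identities
  with mixed arguments. It is used instead at equal arguments only, along a real curve, and
  coefficients are compared by their order in t.\<close>

definition sublinear :: "('a::real_vector \<Rightarrow> real) \<Rightarrow> bool" where
  "sublinear p \<longleftrightarrow> (\<forall>x y. p (x + y) \<le> p x + p y) \<and> (\<forall>c x. 0 < c \<longrightarrow> p (c *\<^sub>R x) \<le> c * p x)"

lemma sublinear_zero:
  assumes "sublinear p" shows "p 0 = 0"
proof -
  have a: "p 0 \<le> 2 * p 0" "p 0 \<le> (1/2) * p 0"
    using assms unfolding sublinear_def
    by (metis add_0 mult_2, metis half_gt_zero scaleR_zero_right zero_less_one)
  then show ?thesis by linarith
qed

lemma sublinear_lower:
  assumes "sublinear p" shows "- p (- x) \<le> p x"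
proof -
  have "p (x + - x) \<le> p x + p (- x)" using assms unfolding sublinear_def by blast
  then show ?thesis using sublinear_zero[OF assms] by simp
qed

text \<open>The definition with the factor 1/c gives the opposite inequality, so only one inequality
  has to be checked for the infima constructed below.\<close>

lemma sublinear_scaleR:
  assumes "sublinear p" "0 \<le> c" shows "p (c *\<^sub>R x) = c * p x"
proof (cases "c = 0")
  case False
  then have c: "0 < c" using assms by simp
  have "p (inverse c *\<^sub>R (c *\<^sub>R x)) \<le> inverse c * p (c *\<^sub>R x)"
    using assms(1) c unfolding sublinear_def by (meson inverse_positive_iff_positive)
  then have "c * p x \<le> p (c *\<^sub>R x)" using c by (simp add: field_simps)
  moreover have "p (c *\<^sub>R x) \<le> c * p x" using assms(1) c unfolding sublinear_def by blast
  ultimately show ?thesis by simp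
qed (simp add: sublinear_zero[OF assms(1)])

text \<open>Moving by t y is charged t \<open>p y\<close>, and the infimum of the result over t
  \<ge> 0 stays finite because \<open>- p (- x)\<close> bounds every term from below. At
  \<open>- y\<close> the choice t = 1 leaves \<open>p 0 - p y\<close>.\<close>

lemma sublinear_improve:
  fixes p :: "'a::real_vector \<Rightarrow> real"
  assumes p: "sublinear p"
  obtains q where "sublinear q" "\<And>x. q x \<le> p x" "q (- y) \<le> - p y"
proof -
  define g where "g x t = p (x + t *\<^sub>R y) - t * p y" for x t
  define q where "q x = (INF t\<in>{0..}. g x t)" for x
  have padd: "p (x + z) \<le> p x + p z" for x z using p unfolding sublinear_def by blast
  have low: "- p (- x) \<le> g x t" if "0 \<le> t" for x t
  proof -
    have "p (t *\<^sub>R y) \<le> p (x + t *\<^sub>R y) + p (- x)" using padd[of "x + t *\<^sub>R y" "- x"] by simp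
    then show ?thesis unfolding g_def using sublinear_scaleR[OF p that, of y] by linarith
  qed
  have bdd: "bdd_below (g x ` {0..})" for x
    using low by (intro bdd_belowI[of _ "- p (- x)"]) auto
  have q_le: "q x \<le> g x t" if "0 \<le> t" for x t
    unfolding q_def using that bdd by (intro cINF_lower) auto
  have q_ge: "u \<le> q x" if "\<And>t. 0 \<le> t \<Longrightarrow> u \<le> g x t" for x u
    unfolding q_def using that by (intro cINF_greatest) auto
  have add: "q (x + z) \<le> q x + q z" for x z
  proof -
    have "q (x + z) - g x s \<le> q z" if s: "0 \<le> s" for s
    proof (rule q_ge)
      fix t :: real assume t: "0 \<le> t"
      have "q (x + z) \<le> g (x + z) (s + t)" using s t by (intro q_le) simp
      also have "\<dots> \<le> g x s + g z t"
        unfolding g_def using padd[of "x + s *\<^sub>R y" "z + t *\<^sub>R y"] by (simp add: algebra_simps)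
      finally show "q (x + z) - g x s \<le> g z t" by simp
    qed
    then have "q (x + z) - q z \<le> q x" by (intro q_ge) (force simp: algebra_simps)
    then show ?thesis by simp
  qed
  have "q (c *\<^sub>R x) \<le> c * q x" if c: "0 < c" for c x
  proof -
    have "q (c *\<^sub>R x) / c \<le> q x"
    proof (rule q_ge)
      fix t :: real assume t: "0 \<le> t"
      have "q (c *\<^sub>R x) \<le> g (c *\<^sub>R x) (c * t)" using c t by (intro q_le) simp
      also have "\<dots> = c * g x t"
        unfolding g_def using sublinear_scaleR[OF p, of c "x + t *\<^sub>R y"] c by (simp add: algebra_simps)
      finally show "q (c *\<^sub>R x) / c \<le> g x t" using c by (simp add: field_simps)
    qed
    then show ?thesis using c by (simp add: field_simps)
  qed
  with add have "sublinear q" unfolding sublinear_def by blast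
  moreover have "q x \<le> p x" for x using q_le[of 0 x] by (simp add: g_def)
  moreover have "q (- y) \<le> - p y"
    using q_le[of 1 "- y"] by (simp add: g_def sublinear_zero[OF p])
  ultimately show ?thesis using that by blast
qed

text \<open>Subadditivity is where the chain enters: a member good at x and a member good at z are
  both replaced by the smaller of the two. The common upper bound r supplies the lower bound
  \<open>- r (- x)\<close> that keeps the infimum finite.\<close>

lemma sublinear_chain_Inf:
  fixes C :: "('a::real_vector \<Rightarrow> real) set"
  assumes C: "\<And>p. p \<in> C \<Longrightarrow> sublinear p \<and> p \<le> r" and ne: "C \<noteq> {}"
    and chain: "\<And>p q. p \<in> C \<Longrightarrow> q \<in> C \<Longrightarrow> p \<le> q \<or> q \<le> p"
  obtains q where "sublinear q" "\<And>p. p \<in> C \<Longrightarrow> q \<le> p"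
proof -
  define q where "q x = (INF p\<in>C. p x)" for x
  have bdd: "bdd_below ((\<lambda>p. p x) ` C)" for x
  proof (rule bdd_belowI[of _ "- r (- x)"], clarify)
    fix p assume "p \<in> C"
    then have "- p (- x) \<le> p x" "p (- x) \<le> r (- x)"
      using C[of p] sublinear_lower[of p x] by (auto simp: le_fun_def)
    then show "- r (- x) \<le> p x" by simp
  qed
  have q_le: "q x \<le> p x" if "p \<in> C" for p x
    unfolding q_def using that bdd by (intro cINF_lower) auto
  have q_ge: "u \<le> q x" if "\<And>p. p \<in> C \<Longrightarrow> u \<le> p x" for x u
    unfolding q_def using that ne by (intro cINF_greatest) auto
  have "q (x + z) \<le> q x + q z" for x z
  proof -
    have "q (x + z) - p x \<le> q z" if p: "p \<in> C" for p
    proof (rule q_ge)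
      fix p' assume p': "p' \<in> C"
      obtain s where s: "s \<in> C" "s \<le> p" "s \<le> p'" using chain[OF p p'] p p' by blast
      have "q (x + z) \<le> s (x + z)" by (rule q_le[OF s(1)])
      also have "\<dots> \<le> s x + s z" using C[OF s(1)] unfolding sublinear_def by blast
      also have "\<dots> \<le> p x + p' z" using s by (intro add_mono) (auto simp: le_fun_def)
      finally show "q (x + z) - p x \<le> p' z" by simp
    qed
    then have "q (x + z) - q z \<le> q x" by (intro q_ge) (force simp: algebra_simps)
    then show ?thesis by simp
  qed
  moreover have "q (c *\<^sub>R x) \<le> c * q x" if c: "0 < c" for c x
  proof -
    have "q (c *\<^sub>R x) / c \<le> q x"
    proof (rule q_ge)
      fix p assume p: "p \<in> C"
      have "q (c *\<^sub>R x) \<le> c * p x" 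
        using q_le[OF p, of "c *\<^sub>R x"] sublinear_scaleR[of p c x] C[OF p] c by simp
      then show "q (c *\<^sub>R x) / c \<le> p x" using c by (simp add: field_simps)
    qed
    then show ?thesis using c by (simp add: field_simps)
  qed
  ultimately have "sublinear q" unfolding sublinear_def by blast
  then show ?thesis using that[of q] q_le by (simp add: le_fun_def)
qed

lemma minimal_sublinear:
  fixes r :: "'a::real_vector \<Rightarrow> real"
  assumes r: "sublinear r"
  obtains p where "sublinear p" "p \<le> r" "\<And>q. sublinear q \<Longrightarrow> q \<le> p \<Longrightarrow> q = p"
proof -
  define A where "A = {p. sublinear p \<and> p \<le> r}"
  \<comment> \<open>The order is reversed, since Zorn's lemma produces maximal elements; the empty
    chain is bounded by r itself.\<close>
  have "\<exists>m\<in>A. \<forall>a\<in>A. a \<le> m \<longrightarrow> a = m"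
  proof (rule predicate_Zorn[where P = "\<lambda>p q. q \<le> p"])
    show "partial_order_on A (relation_of (\<lambda>p q. q \<le> p) A)"
      by (rule partial_order_on_relation_ofI) auto
    fix C assume "C \<in> Chains (relation_of (\<lambda>p q. q \<le> p) A)"
    then have C: "C \<subseteq> A" "\<And>p q. p \<in> C \<Longrightarrow> q \<in> C \<Longrightarrow> p \<le> q \<or> q \<le> p"
      unfolding Chains_def relation_of_def by blast+
    show "\<exists>u\<in>A. \<forall>a\<in>C. u \<le> a"
    proof (cases "C = {}")
      case True
      then show ?thesis using r unfolding A_def by auto
    next
      case False
      then obtain p where p: "p \<in> C" by blast
      obtain q where q: "sublinear q" "\<And>p. p \<in> C \<Longrightarrow> q \<le> p"
        using sublinear_chain_Inf[of C r] C False unfolding A_def by blast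
      have "q \<le> r" using q(2)[OF p] p C(1) unfolding A_def by (auto intro: order_trans)
      then show ?thesis using q unfolding A_def by blast
    qed
  qed
  then obtain p where p: "p \<in> A" "\<And>a. a \<in> A \<Longrightarrow> a \<le> p \<Longrightarrow> a = p" by blast
  show ?thesis
    by (rule that[of p]) (use p order_trans in \<open>auto simp: A_def\<close>)
qed

text \<open>A minimal sublinear functional is odd (otherwise \<open>sublinear_improve\<close> lowers it), hence
  linear; this replaces the usual extension step of the Hahn--Banach theorem.\<close>

lemma minimal_sublinear_linear:
  fixes p :: "'a::real_vector \<Rightarrow> real"
  assumes p: "sublinear p" and min: "\<And>q. sublinear q \<Longrightarrow> q \<le> p \<Longrightarrow> q = p"
  shows "linear p"
proof -
  have odd: "p (- y) = - p y" for y
  proof -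
    obtain q where q: "sublinear q" "\<And>x. q x \<le> p x" "q (- y) \<le> - p y"
      using sublinear_improve[OF p, of y] by blast
    have "q = p" using min q by (simp add: le_fun_def)
    then show ?thesis using q(3) sublinear_lower[OF p, of "- y"] by simp
  qed
  have sub: "p (x + z) \<le> p x + p z" for x z using p unfolding sublinear_def by blast
  show ?thesis
  proof (rule linearI)
    fix x y
    show "p (x + y) = p x + p y" using sub[of x y] sub[of "x + y" "- y"] odd[of y] by simp
  next
    fix c x
    show "p (c *\<^sub>R x) = c *\<^sub>R p x"
    proof (cases "0 \<le> c")
      case False
      then have "p ((- c) *\<^sub>R x) = (- c) * p x" by (intro sublinear_scaleR[OF p]) simp
      then show ?thesis using odd[of "c *\<^sub>R x"] by simp
    qed (simp add: sublinear_scaleR[OF p])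
  qed
qed

text \<open>The norm is first lowered at x. A functional that is merely minimal below the norm could
  be 0; below r it satisfies \<open>p (- x) \<le> - norm x\<close>, hence is positive at x, and the
  bound by the norm makes it continuous.\<close>

lemma separating_functional:
  fixes x :: "'a::real_normed_vector"
  assumes "x \<noteq> 0"
  obtains f :: "'a \<Rightarrow> real" where "bounded_linear f" "f x = 1"
proof -
  have nrm: "sublinear (norm :: 'a \<Rightarrow> real)"
    unfolding sublinear_def by (auto intro: norm_triangle_ineq)
  obtain r where r: "sublinear r" "\<And>y. r y \<le> norm y" "r (- x) \<le> - norm x"
    using sublinear_improve[OF nrm, of x] by blast
  obtain p where p: "sublinear p" "p \<le> r" "\<And>q. sublinear q \<Longrightarrow> q \<le> p \<Longrightarrow> q = p"
    using minimal_sublinear[OF r(1)] by blast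
  have lin: "linear p" by (rule minimal_sublinear_linear[OF p(1,3)])
  have le: "p y \<le> norm y" for y using p(2) r(2) le_funD order_trans by metis
  have "\<bar>p y\<bar> \<le> norm y * 1" for y using le[of y] le[of "- y"] linear_neg[OF lin, of y] by simp
  then have bl: "bounded_linear p"
    using lin by (intro bounded_linear_intro[of p 1]) (auto simp: linear_add linear_scale)
  have "p (- x) \<le> - norm x" using le_funD[OF p(2), of "- x"] r(3) by linarith
  then have "p x > 0" using assms linear_neg[OF lin, of x] by (smt (verit) zero_less_norm_iff)
  then show ?thesis
    by (intro that[of "\<lambda>y. p y / p x"]) (auto intro: bounded_linear_divide[THEN bounded_linear_compose] bl)
qed

section \<open>Bounded coordinates and the projection onto a finite-dimensional subspace\<close>

locale fd_coords =
  fixes S :: "'a::real_normed_vector set" and E :: "'a set" and \<phi> :: "'a \<Rightarrow> 'a \<Rightarrow> real"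
  assumes S: "subspace S" and finE: "finite E" and E_sub: "E \<subseteq> S"
    and \<phi>_bl: "b \<in> E \<Longrightarrow> bounded_linear (\<phi> b)"
    and \<phi>_expand: "x \<in> S \<Longrightarrow> (\<Sum>b\<in>E. \<phi> b x *\<^sub>R b) = x"
begin

text \<open>Since the coordinates are bounded functionals of the whole ambient space, this is a
  bounded projection onto S; composing with it turns functions on S into functions that can be
  differentiated everywhere.\<close>

definition P :: "'a \<Rightarrow> 'a" where "P x = (\<Sum>b\<in>E. \<phi> b x *\<^sub>R b)"

lemma P_id: "x \<in> S \<Longrightarrow> P x = x"
  unfolding P_def by (rule \<phi>_expand)

lemma P_in: "P x \<in> S"
  unfolding P_def using S E_sub by (intro subspace_sum subspace_scale) auto

lemma P_bl: "bounded_linear P"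
  unfolding P_def [abs_def]
  by (intro bounded_linear_sum bounded_linear_scaleR_const \<phi>_bl)

lemma complete_S: "complete S"
  unfolding complete_def
proof (intro allI impI)
  fix f :: "nat \<Rightarrow> 'a" assume f: "(\<forall>n. f n \<in> S) \<and> Cauchy f"
  have "convergent (\<lambda>n. \<phi> b (f n))" if "b \<in> E" for b
    using bounded_linear.Cauchy[OF \<phi>_bl[OF that]] f Cauchy_convergent_iff by blast
  then have "(\<lambda>n. \<phi> b (f n)) \<longlonglongrightarrow> lim (\<lambda>n. \<phi> b (f n))" if "b \<in> E" for b
    using that convergent_LIMSEQ_iff by blast
  then have "(\<lambda>n. \<Sum>b\<in>E. \<phi> b (f n) *\<^sub>R b) \<longlonglongrightarrow> (\<Sum>b\<in>E. lim (\<lambda>n. \<phi> b (f n)) *\<^sub>R b)"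
    by (intro tendsto_sum tendsto_scaleR tendsto_const)
  then have "f \<longlonglongrightarrow> (\<Sum>b\<in>E. lim (\<lambda>n. \<phi> b (f n)) *\<^sub>R b)" using f \<phi>_expand by simp
  moreover have "(\<Sum>b\<in>E. lim (\<lambda>n. \<phi> b (f n)) *\<^sub>R b) \<in> S"
    using S E_sub by (intro subspace_sum subspace_scale) auto
  ultimately show "\<exists>l\<in>S. f \<longlonglongrightarrow> l" by blast
qed

lemma closed_S: "closed S"
  by (rule complete_imp_closed[OF complete_S])

text \<open>The ambient space may be incomplete, so absolute convergence is applied to the real
  coordinate series and carried back by the expansion.\<close>

lemma summable_S:
  assumes "\<And>k. w k \<in> S" and "summable (\<lambda>k. norm (w k))"
  shows "summable w"
proof -
  have "summable (\<lambda>k. \<phi> b (w k))" if b: "b \<in> E" for b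
  proof -
    obtain K where K: "\<And>x. norm (\<phi> b x) \<le> norm x * K"
      using bounded_linear.bounded[OF \<phi>_bl[OF b]] by blast
    show ?thesis
      by (rule summable_comparison_test'[OF summable_mult2[OF assms(2)] K])
  qed
  then have "summable (\<lambda>k. \<Sum>b\<in>E. \<phi> b (w k) *\<^sub>R b)"
    by (intro summable_sum bounded_linear.summable[OF bounded_linear_scaleR_left])
  then show ?thesis using assms(1) \<phi>_expand by simp
qed

end

text \<open>Induction on a spanning set. For a new vector b, a functional f with value 1 at
  \<open>b - P b\<close> yields \<theta> = f o (id - P), which vanishes on the old span and is 1 at
  b. It becomes the new coordinate, and each old coordinate is corrected by its value at b times
  \<theta>.\<close>

lemma fd_coords_exist:
  assumes "fin_dim_subspace S"
  obtains E \<phi> where "fd_coords S E \<phi>"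
proof -
  obtain B where B: "finite B" "span B = S" using assms unfolding fin_dim_subspace_def by blast
  have "\<exists>E \<phi>. fd_coords (span B) E \<phi>"
    using B(1)
  proof (induction B)
    case empty
    have "fd_coords (span {}) {} (\<lambda>_ _. 0)" by (rule fd_coords.intro) auto
    then show ?case by blast
  next
    case (insert b B)
    then obtain E \<phi> where "fd_coords (span B) E \<phi>" by blast
    then interpret C: fd_coords "span B" E \<phi> .
    show ?case
    proof (cases "b \<in> span B")
      case True
      then show ?thesis using C.fd_coords_axioms span_redundant by metis
    next
      case False
      then have "b - C.P b \<noteq> 0" using C.P_in[of b] by auto
      then obtain f :: "'a \<Rightarrow> real" where f: "bounded_linear f" "f (b - C.P b) = 1"
        by (rule separating_functional)
      interpret f: bounded_linear f by (rule f(1))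
      interpret P: bounded_linear C.P by (rule C.P_bl)
      define \<theta> where "\<theta> x = f (x - C.P x)" for x
      have \<theta>_bl: "bounded_linear \<theta>"
        unfolding \<theta>_def [abs_def]
        by (intro bounded_linear_compose[OF f(1)] bounded_linear_sub bounded_linear_ident C.P_bl)
      interpret \<theta>: bounded_linear \<theta> by (rule \<theta>_bl)
      define \<psi> where "\<psi> c = (if c = b then \<theta> else (\<lambda>x. \<phi> c x - \<phi> c b * \<theta> x))" for c
      have bE: "b \<notin> E" using False C.E_sub by blast
      have "fd_coords (span (insert b B)) (insert b E) \<psi>"
      proof (rule fd_coords.intro)
        show "subspace (span (insert b B))" by simp
        show "finite (insert b E)" using C.finE by simp
        show "insert b E \<subseteq> span (insert b B)"
          using C.E_sub span_mono[of B "insert b B"] by (auto intro: span_base)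
        show "bounded_linear (\<psi> c)" if "c \<in> insert b E" for c
          using that \<theta>_bl unfolding \<psi>_def
          by (auto intro!: bounded_linear_sub bounded_linear_const_mult C.\<phi>_bl)
      next
        fix x assume "x \<in> span (insert b B)"
        then obtain k where k: "x - k *\<^sub>R b \<in> span B" by (auto simp: span_breakdown_eq)
        define y where "y = x - k *\<^sub>R b"
        have y: "C.P y = y" "\<theta> y = 0" using k C.P_id unfolding y_def \<theta>_def by (auto simp: f.zero)
        have x: "x = y + k *\<^sub>R b" unfolding y_def by simp
        have "\<theta> b = 1" using f(2) by (simp add: \<theta>_def)
        then have \<theta>x: "\<theta> x = k" by (simp add: x \<theta>.add \<theta>.scaleR y)
        have "(\<Sum>c\<in>insert b E. \<psi> c x *\<^sub>R c) = k *\<^sub>R b + (\<Sum>c\<in>E. \<psi> c x *\<^sub>R c)"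
          using bE C.finE \<theta>x by (simp add: \<psi>_def)
        also have "(\<Sum>c\<in>E. \<psi> c x *\<^sub>R c) = (\<Sum>c\<in>E. \<phi> c x *\<^sub>R c - (k * \<phi> c b) *\<^sub>R c)"
          using bE \<theta>x by (intro sum.cong) (auto simp: \<psi>_def algebra_simps)
        also have "\<dots> = C.P x - k *\<^sub>R C.P b"
          by (simp add: sum_subtractf C.P_def scaleR_sum_right)
        also have "\<dots> = y" using y x by (simp add: P.add P.scaleR)
        finally show "(\<Sum>c\<in>insert b E. \<psi> c x *\<^sub>R c) = x" using x by simp
      qed
      then show ?thesis by blast
    qed
  qed
  then show ?thesis using that B(2) by auto
qed

section \<open>Multilinear maps on lists\<close>

definition mlin :: "'a::real_vector set \<Rightarrow> nat \<Rightarrow> ('a list \<Rightarrow> 'b::real_vector) \<Rightarrow> bool" where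
  "mlin S k f \<longleftrightarrow> (\<forall>xs j. length xs = k \<and> set xs \<subseteq> S \<and> j < k \<longrightarrow> lin_on S (\<lambda>y. f (xs[j := y])))"

definition mbound :: "'a::real_normed_vector set \<Rightarrow> nat \<Rightarrow> ('a list \<Rightarrow> 'b::real_normed_vector) \<Rightarrow> real \<Rightarrow> bool" where
  "mbound S k f c \<longleftrightarrow> (\<forall>xs. length xs = k \<and> set xs \<subseteq> S \<longrightarrow> norm (f xs) \<le> c * (\<Prod>x\<leftarrow>xs. norm x))"

lemma lin_on_zero: "lin_on S f \<Longrightarrow> 0 \<in> S \<Longrightarrow> f 0 = 0"
  unfolding lin_on_def by (metis add_cancel_right_right scaleR_one scaleR_zero_right)

lemma lin_on_add: "lin_on S f \<Longrightarrow> x \<in> S \<Longrightarrow> y \<in> S \<Longrightarrow> f (x + y) = f x + f y"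
  unfolding lin_on_def by (metis scaleR_one)

lemma lin_on_scaleR: "lin_on S f \<Longrightarrow> 0 \<in> S \<Longrightarrow> x \<in> S \<Longrightarrow> f (c *\<^sub>R x) = c *\<^sub>R f x"
  using lin_on_zero[of S f] unfolding lin_on_def by (metis add.right_neutral)

lemma lin_on_diff:
  assumes "lin_on S f" "subspace S" "x \<in> S" "y \<in> S" shows "f (x - y) = f x - f y"
proof -
  have "f (x - y + y) = f (x - y) + f y"
    using assms by (intro lin_on_add[of S f]) (auto intro: subspace_diff)
  then show ?thesis by (simp add: algebra_simps)
qed

lemma lin_on_minus:
  assumes "lin_on S f" "subspace S" "x \<in> S" shows "f (- x) = - f x"
  using lin_on_scaleR[OF assms(1) subspace_0[OF assms(2)] assms(3), of "-1"] by simp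

lemma lin_on_sum:
  assumes f: "lin_on S f" and S: "subspace S" and g: "\<And>j. j \<in> J \<Longrightarrow> g j \<in> S"
  shows "f (sum g J) = (\<Sum>j\<in>J. f (g j))"
  using g
proof (induction J rule: infinite_finite_induct)
  case (insert a J)
  then have "sum g J \<in> S" using S by (intro subspace_sum) auto
  with insert show ?case by (simp add: lin_on_add[OF f])
qed (simp_all add: lin_on_zero[OF f] subspace_0[OF S])

lemma lin_on_subset: "lin_on S f \<Longrightarrow> T \<subseteq> S \<Longrightarrow> lin_on T f"
  unfolding lin_on_def by blast

lemma lin_on_compose:
  "lin_on S f \<Longrightarrow> lin_on T g \<Longrightarrow> (\<And>x. x \<in> S \<Longrightarrow> f x \<in> T) \<Longrightarrow> lin_on S (\<lambda>x. g (f x))"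
  unfolding lin_on_def by simp

lemma mlinD:
  "mlin S k f \<Longrightarrow> length xs = k \<Longrightarrow> set xs \<subseteq> S \<Longrightarrow> j < k \<Longrightarrow> lin_on S (\<lambda>y. f (xs[j := y]))"
  unfolding mlin_def by simp

lemma mboundD:
  "mbound S k f c \<Longrightarrow> length xs = k \<Longrightarrow> set xs \<subseteq> S \<Longrightarrow> norm (f xs) \<le> c * (\<Prod>x\<leftarrow>xs. norm x)"
  unfolding mbound_def by simp

lemma mlin_subset:
  assumes "mlin S k f" "T \<subseteq> S" shows "mlin T k f"
  unfolding mlin_def
proof (intro allI impI)
  fix xs :: "'a list" and j
  assume "length xs = k \<and> set xs \<subseteq> T \<and> j < k"
  with assms show "lin_on T (\<lambda>y. f (xs[j := y]))"
    by (intro lin_on_subset[OF mlinD[OF assms(1)] assms(2)]) auto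
qed

lemma mlin_head:
  assumes "mlin S (Suc k) f" "length xs = k" "set xs \<subseteq> S" "0 \<in> S"
  shows "lin_on S (\<lambda>x. f (x # xs))"
proof -
  have "lin_on S (\<lambda>x. f ((0 # xs)[0 := x]))"
    using assms by (intro mlinD[of S "Suc k"]) auto
  then show ?thesis by simp
qed

lemma mlin_tail:
  assumes "mlin S (Suc k) f" "x \<in> S"
  shows "mlin S k (\<lambda>xs. f (x # xs))"
  unfolding mlin_def
proof (intro allI impI)
  fix xs :: "'a list" and j
  assume "length xs = k \<and> set xs \<subseteq> S \<and> j < k"
  then have "lin_on S (\<lambda>y. f ((x # xs)[Suc j := y]))"
    using assms by (intro mlinD[of S "Suc k"]) auto
  then show "lin_on S (\<lambda>y. f (x # xs[j := y]))" by simp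
qed

lemma mlin_compose:
  assumes "mlin S k f" "lin_on T g" "\<And>xs. length xs = k \<Longrightarrow> set xs \<subseteq> S \<Longrightarrow> f xs \<in> T"
  shows "mlin S k (\<lambda>xs. g (f xs))"
  unfolding mlin_def
proof (intro allI impI)
  fix xs :: "'a list" and j
  assume *: "length xs = k \<and> set xs \<subseteq> S \<and> j < k"
  then have "f (xs[j := y]) \<in> T" if "y \<in> S" for y
    using that set_update_subset_insert[of xs j y] by (intro assms(3)) auto
  with * show "lin_on S (\<lambda>y. g (f (xs[j := y])))"
    using assms(1,2) unfolding mlin_def by (intro lin_on_compose[of S _ T g]) auto
qed

lemma mlin_prod_list: "mlin (UNIV :: real set) k prod_list"
proof -
  have "prod_list (xs[j := y]) = prod_list (take j xs) * (y * prod_list (drop (Suc j) xs))"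
    if "j < length xs" for xs :: "real list" and j y
    using that by (simp add: upd_conv_take_nth_drop)
  then show ?thesis unfolding mlin_def lin_on_def by (auto simp: algebra_simps)
qed

lemma mbound_tail:
  assumes "mbound S (Suc k) f c" "x \<in> S"
  shows "mbound S k (\<lambda>xs. f (x # xs)) (c * norm x)"
  unfolding mbound_def
proof (intro allI impI)
  fix xs :: "'a list" assume "length xs = k \<and> set xs \<subseteq> S"
  then have "norm (f (x # xs)) \<le> c * (\<Prod>x\<leftarrow>x # xs. norm x)"
    using assms(2) by (intro mboundD[OF assms(1)]) auto
  then show "norm (f (x # xs)) \<le> c * norm x * (\<Prod>x\<leftarrow>xs. norm x)" by (simp add: mult.assoc)
qed

lemma mbound_compose:
  assumes "mbound S k f c" "\<And>y. y \<in> T \<Longrightarrow> norm (g y) \<le> d * norm y" "0 \<le> d"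
    "\<And>xs. length xs = k \<Longrightarrow> set xs \<subseteq> S \<Longrightarrow> f xs \<in> T"
  shows "mbound S k (\<lambda>xs. g (f xs)) (d * c)"
  unfolding mbound_def
proof (intro allI impI)
  fix xs :: "'a list" assume xs: "length xs = k \<and> set xs \<subseteq> S"
  have "norm (g (f xs)) \<le> d * norm (f xs)" using assms xs by blast
  also have "\<dots> \<le> d * (c * (\<Prod>x\<leftarrow>xs. norm x))"
    using assms xs unfolding mbound_def by (intro mult_left_mono) auto
  finally show "norm (g (f xs)) \<le> d * c * (\<Prod>x\<leftarrow>xs. norm x)" by simp
qed

lemma mbound_replicate:
  assumes "mbound S k f c" "x \<in> S"
  shows "norm (f (replicate k x)) \<le> c * norm x ^ k"
proof -
  have "length (replicate k x) = k \<and> set (replicate k x) \<subseteq> S" using assms(2) by auto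
  then have "norm (f (replicate k x)) \<le> c * (\<Prod>y\<leftarrow>replicate k x. norm y)"
    using assms(1) unfolding mbound_def by blast
  then show ?thesis by (simp add: prod_list_replicate)
qed

definition lists_over :: "nat \<Rightarrow> 'a set \<Rightarrow> 'a list set" where
  "lists_over k J = {rs. length rs = k \<and> set rs \<subseteq> J}"

lemma lists_over_0: "lists_over 0 J = {[]}"
  unfolding lists_over_def by auto

lemma finite_lists_over: "finite J \<Longrightarrow> finite (lists_over k J)"
  using finite_lists_length_eq[of J k] unfolding lists_over_def by (simp add: conj_commute)

lemma sum_lists_over_Suc:
  "(\<Sum>rs\<in>lists_over (Suc k) J. h rs) = (\<Sum>r\<in>J. \<Sum>rs\<in>lists_over k J. h (r # rs))"
proof -
  have "lists_over (Suc k) J = (\<lambda>(r, rs). r # rs) ` (J \<times> lists_over k J)"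
    unfolding lists_over_def by (force simp: length_Suc_conv image_iff)
  moreover have "inj_on (\<lambda>(r, rs). r # rs) (J \<times> lists_over k J)" by (auto simp: inj_on_def)
  ultimately show ?thesis
    by (simp add: sum.reindex sum.cartesian_product split_def)
qed

lemma mlin_expand:
  assumes "mlin S k f" "subspace S" "\<And>r. r \<in> J \<Longrightarrow> e r \<in> S"
  shows "f (replicate k (sum e J)) = (\<Sum>rs\<in>lists_over k J. f (map e rs))"
  using assms(1)
proof (induction k arbitrary: f)
  case 0
  then show ?case by (simp add: lists_over_0)
next
  case (Suc k)
  have s: "sum e J \<in> S" using assms by (intro subspace_sum) auto
  have rep: "length (replicate k (sum e J)) = k" "set (replicate k (sum e J)) \<subseteq> S" using s by auto
  have "f (replicate (Suc k) (sum e J)) = (\<Sum>r\<in>J. f (e r # replicate k (sum e J)))"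
    using lin_on_sum[OF mlin_head[OF Suc.prems rep subspace_0[OF assms(2)]] assms(2,3)] by simp
  also have "\<dots> = (\<Sum>r\<in>J. \<Sum>rs\<in>lists_over k J. f (e r # map e rs))"
    by (intro sum.cong refl Suc.IH mlin_tail[OF Suc.prems] assms(3))
  also have "\<dots> = (\<Sum>rs\<in>lists_over (Suc k) J. f (map e rs))"
    by (simp add: sum_lists_over_Suc)
  finally show ?case .
qed

lemma mlin_scale:
  assumes "mlin S k f" "subspace S" "\<And>r. r \<in> set rs \<Longrightarrow> e r \<in> S" "length rs = k"
  shows "f (map (\<lambda>r. c r *\<^sub>R e r) rs) = (\<Prod>r\<leftarrow>rs. c r) *\<^sub>R f (map e rs)"
  using assms(1,3,4)
proof (induction rs arbitrary: f k)
  case (Cons r rs)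
  then obtain k' where k: "k = Suc k'" "length rs = k'" by auto
  have "lin_on S (\<lambda>x. f (x # map (\<lambda>r. c r *\<^sub>R e r) rs))"
    using Cons.prems k assms(2) by (intro mlin_head[of S k']) (auto simp: subspace_scale subspace_0)
  then have "f (map (\<lambda>r. c r *\<^sub>R e r) (r # rs)) = c r *\<^sub>R f (e r # map (\<lambda>r. c r *\<^sub>R e r) rs)"
    using lin_on_scaleR[of S "\<lambda>x. f (x # map (\<lambda>r. c r *\<^sub>R e r) rs)" "e r" "c r"] Cons.prems subspace_0[OF assms(2)]
    by simp
  also have "f (e r # map (\<lambda>r. c r *\<^sub>R e r) rs) = (\<Prod>r\<leftarrow>rs. c r) *\<^sub>R f (e r # map e rs)"
    using Cons.prems k by (intro Cons.IH[of k'] mlin_tail) auto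
  finally show ?case by simp
qed simp

text \<open>The product of reals is itself multilinear, so a power of a sum expands over the same
  words as a bracket does; norm estimates can thus be compared word by word.\<close>

lemma sum_prod_lists_over:
  fixes a :: "'c \<Rightarrow> real"
  shows "(\<Sum>rs\<in>lists_over k J. \<Prod>r\<leftarrow>rs. a r) = (\<Sum>r\<in>J. a r) ^ k"
  using mlin_expand[OF mlin_prod_list, of J a k] by (simp add: prod_list_replicate)

lemma (in fd_coords) lin_on_bounded:
  fixes f :: "'a \<Rightarrow> 'b::real_normed_vector"
  assumes f: "lin_on S f"
  obtains C where "0 \<le> C" "\<And>x. x \<in> S \<Longrightarrow> norm (f x) \<le> C * norm x"
proof -
  define C where "C = (\<Sum>b\<in>E. onorm (\<phi> b) * norm (f b))"
  have "norm (f x) \<le> C * norm x" if "x \<in> S" for x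
  proof -
    have "f x = f (\<Sum>b\<in>E. \<phi> b x *\<^sub>R b)" using \<phi>_expand that by simp
    also have "\<dots> = (\<Sum>b\<in>E. f (\<phi> b x *\<^sub>R b))"
      using E_sub S by (intro lin_on_sum[OF f]) (auto simp: subspace_scale)
    also have "\<dots> = (\<Sum>b\<in>E. \<phi> b x *\<^sub>R f b)"
      using E_sub S by (intro sum.cong refl lin_on_scaleR[OF f]) (auto simp: subspace_0)
    also have "norm \<dots> \<le> (\<Sum>b\<in>E. norm (\<phi> b x *\<^sub>R f b))" by (rule norm_sum)
    also have "\<dots> \<le> (\<Sum>b\<in>E. onorm (\<phi> b) * norm (f b) * norm x)"
    proof (intro sum_mono)
      fix b assume "b \<in> E"
      then have "\<bar>\<phi> b x\<bar> \<le> onorm (\<phi> b) * norm x" using onorm[OF \<phi>_bl, of b x] by simp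
      then have "\<bar>\<phi> b x\<bar> * norm (f b) \<le> (onorm (\<phi> b) * norm x) * norm (f b)"
        by (rule mult_right_mono) simp
      then show "norm (\<phi> b x *\<^sub>R f b) \<le> onorm (\<phi> b) * norm (f b) * norm x" by (simp add: mult_ac)
    qed
    finally show ?thesis by (simp add: C_def sum_distrib_right)
  qed
  moreover have "0 \<le> C" unfolding C_def by (intro sum_nonneg mult_nonneg_nonneg onorm_pos_le \<phi>_bl) auto
  ultimately show ?thesis using that by blast
qed

text \<open>Induction on the arity, expanding the first argument in coordinates. Such a bound is
  what keeps the supremum in \<open>ml_norm\<close> finite.\<close>

lemma (in fd_coords) mlin_bounded:
  fixes f :: "'a list \<Rightarrow> 'b::real_normed_vector"
  assumes "mlin S k f"
  obtains C where "0 \<le> C" "mbound S k f C"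
proof -
  have "\<exists>C\<ge>0. mbound S k f C"
    using assms
  proof (induction k arbitrary: f)
    case 0
    then show ?case by (intro exI[of _ "norm (f [])"]) (auto simp: mbound_def)
  next
    case (Suc k)
    have "\<exists>C\<ge>0. mbound S k (\<lambda>xs. f (b # xs)) C" if "b \<in> E" for b
      using that E_sub by (intro Suc.IH mlin_tail[OF Suc.prems]) auto
    then obtain C where C: "\<And>b. b \<in> E \<Longrightarrow> 0 \<le> C b" "\<And>b. b \<in> E \<Longrightarrow> mbound S k (\<lambda>xs. f (b # xs)) (C b)"
      by metis
    define D where "D = (\<Sum>b\<in>E. onorm (\<phi> b) * C b)"
    have "norm (f (x # xs)) \<le> D * (norm x * (\<Prod>x\<leftarrow>xs. norm x))"
      if x: "x \<in> S" and xs: "length xs = k" "set xs \<subseteq> S" for x xs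
    proof -
      have lin: "lin_on S (\<lambda>x. f (x # xs))" using Suc.prems xs S by (intro mlin_head) (auto simp: subspace_0)
      have nn: "0 \<le> (\<Prod>x\<leftarrow>xs. norm x)" by (intro prod_list_nonneg) auto
      have "f (x # xs) = f ((\<Sum>b\<in>E. \<phi> b x *\<^sub>R b) # xs)" using \<phi>_expand x by simp
      also have "\<dots> = (\<Sum>b\<in>E. f (\<phi> b x *\<^sub>R b # xs))"
        using E_sub S by (intro lin_on_sum[OF lin]) (auto simp: subspace_scale)
      also have "\<dots> = (\<Sum>b\<in>E. \<phi> b x *\<^sub>R f (b # xs))"
        using E_sub S by (intro sum.cong refl lin_on_scaleR[OF lin]) (auto simp: subspace_0)
      also have "norm \<dots> \<le> (\<Sum>b\<in>E. norm (\<phi> b x *\<^sub>R f (b # xs)))" by (rule norm_sum)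
      also have "\<dots> \<le> (\<Sum>b\<in>E. (onorm (\<phi> b) * norm x) * (C b * (\<Prod>x\<leftarrow>xs. norm x)))"
      proof (intro sum_mono)
        fix b assume b: "b \<in> E"
        have "\<bar>\<phi> b x\<bar> \<le> onorm (\<phi> b) * norm x" using onorm[OF \<phi>_bl[OF b], of x] by simp
        moreover have "norm (f (b # xs)) \<le> C b * (\<Prod>x\<leftarrow>xs. norm x)"
          using C(2)[OF b] xs unfolding mbound_def by blast
        ultimately show "norm (\<phi> b x *\<^sub>R f (b # xs)) \<le> (onorm (\<phi> b) * norm x) * (C b * (\<Prod>x\<leftarrow>xs. norm x))"
          by (simp add: mult_mono')
      qed
      finally show ?thesis by (simp add: D_def sum_distrib_right sum_distrib_left mult_ac)
    qed
    then have "mbound S (Suc k) f D"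
      unfolding mbound_def by (auto simp: length_Suc_conv)
    moreover have "0 \<le> D" unfolding D_def using C(1) by (intro sum_nonneg mult_nonneg_nonneg onorm_pos_le \<phi>_bl) auto
    ultimately show ?case by blast
  qed
  then show ?thesis using that by blast
qed

text \<open>Telescoping: x is exchanged for y in one argument at a time, each exchange costing at
  most \<open>c * R ^ (k - 1) * norm (x - y)\<close>.\<close>

lemma mlin_replicate_diff:
  fixes f :: "'a::real_normed_vector list \<Rightarrow> 'b::real_normed_vector"
  assumes "mlin S k f" "mbound S k f c" "0 \<le> c" "subspace S" "x \<in> S" "y \<in> S" "norm x \<le> R" "norm y \<le> R"
  shows "norm (f (replicate k x) - f (replicate k y)) \<le> c * (real k * R ^ (k - 1)) * norm (x - y)"
  using assms(1-3)
proof (induction k arbitrary: f c)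
  case 0
  then show ?case by simp
next
  case (Suc k)
  have R: "0 \<le> R" using assms(7) norm_ge_zero order_trans by blast
  have rep: "length (replicate k y) = k" "set (replicate k y) \<subseteq> S" using assms by auto
  have "norm (f (x # replicate k x) - f (x # replicate k y)) \<le> (c * norm x) * (real k * R ^ (k - 1)) * norm (x - y)"
    using Suc.prems assms by (intro Suc.IH mlin_tail mbound_tail) auto
  also have "\<dots> \<le> (c * R) * (real k * R ^ (k - 1)) * norm (x - y)"
    using Suc.prems assms R by (intro mult_right_mono mult_left_mono) auto
  \<comment> \<open>At k = 0 the truncated exponent k - 1 does no harm, because the factor
    \<open>real k\<close> vanishes.\<close>
  also have "\<dots> = c * (real k * R ^ k) * norm (x - y)" by (cases k) auto
  finally have 1: "norm (f (x # replicate k x) - f (x # replicate k y)) \<le> c * (real k * R ^ k) * norm (x - y)" .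
  have "f (x # replicate k y) - f (y # replicate k y) = f ((x - y) # replicate k y)"
    using lin_on_diff[OF mlin_head[OF Suc.prems(1) rep subspace_0]] assms by simp
  also have "norm \<dots> \<le> c * norm (x - y) * norm y ^ k"
    using Suc.prems assms by (intro mbound_replicate[of S] mbound_tail) (auto simp: subspace_diff)
  also have "\<dots> \<le> c * norm (x - y) * R ^ k"
    using Suc.prems assms by (intro mult_left_mono power_mono) auto
  finally have 2: "norm (f (x # replicate k y) - f (y # replicate k y)) \<le> c * norm (x - y) * R ^ k" .
  have "norm (f (x # replicate k x) - f (y # replicate k y)) \<le> c * (real k * R ^ k) * norm (x - y) + c * norm (x - y) * R ^ k"
    using norm_triangle_mono[OF 1 2] by simp
  then show ?case by (simp add: algebra_simps)
qed

section \<open>Smoothness of inverse maps\<close>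

text \<open>The iterated directional derivatives are chosen by recursion, so smoothness only requires a
  class of functions that is closed under directional derivatives.\<close>

lemma smooth_on_of_closed_class:
  fixes F :: "('a::real_normed_vector \<Rightarrow> 'b::real_normed_vector) set"
  assumes closed: "\<And>f. f \<in> F \<Longrightarrow> \<exists>f'. (\<forall>x\<in>S. (f has_derivative f' x) (at x within S)) \<and>
      (\<forall>h\<in>K. (\<lambda>x. f' x h) \<in> F)"
    and g: "g \<in> F" and eq: "\<And>x. x \<in> S \<Longrightarrow> f x = g x"
  shows "smooth_on K S f"
proof -
  obtain dd where dd: "\<And>f x. f \<in> F \<Longrightarrow> x \<in> S \<Longrightarrow> (f has_derivative dd f x) (at x within S)"
    "\<And>f h. f \<in> F \<Longrightarrow> h \<in> K \<Longrightarrow> (\<lambda>x. dd f x h) \<in> F"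
    using closed by metis
  define D where "D = rec_list g (\<lambda>h hs r x. dd r x h)"
  have D_simps: "D [] = g" "\<And>h hs. D (h # hs) = (\<lambda>x. dd (D hs) x h)" unfolding D_def by simp_all
  have D_in: "D hs \<in> F" if "set hs \<subseteq> K" for hs
    using that by (induction hs) (auto simp: D_simps g dd(2))
  show ?thesis
    unfolding smooth_on_def
  proof (intro exI[of _ "\<lambda>_ y hs. D hs y"] conjI allI ballI impI)
    show "D [] x = f x" if "x \<in> S" for x using that eq D_simps by simp
    fix k x hs assume "x \<in> S" "length hs = k \<and> set hs \<subseteq> K"
    then show "((\<lambda>y. D hs y) has_derivative (\<lambda>h. D (h # hs) x)) (at x within S)"
      using dd(1)[OF D_in, of hs x] by (simp add: D_simps)
  qed
qed

text \<open>A product rule in which the second factor is only continuous: since f vanishes at a, the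
  increment of g meets a factor of first order. It serves for the resolvent identity, where the
  second factor is the very function whose differentiability is being proved.\<close>

lemma has_derivative_vanishing_mult:
  fixes f g :: "'a::real_normed_vector \<Rightarrow> real"
  assumes f: "(f has_derivative f') (at a)" and fa: "f a = 0" and g: "isCont g a"
  shows "((\<lambda>x. f x * g x) has_derivative (\<lambda>h. f' h * g a)) (at a)"
proof -
  have bl: "bounded_linear f'" using f by (rule has_derivative_bounded_linear)
  have "(\<lambda>x. norm (f x - f a - f' (x - a)) / norm (x - a)) \<midarrow>a\<rightarrow> 0"
    using f unfolding has_derivative_iff_norm by simp
  then have "(\<lambda>x. norm (f x - f' (x - a)) / norm (x - a) * \<bar>g x\<bar>) \<midarrow>a\<rightarrow> 0 * \<bar>g a\<bar>"
    using g fa by (intro tendsto_mult tendsto_rabs) (auto simp: isCont_def)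
  moreover have "(\<lambda>x. onorm f' * \<bar>g x - g a\<bar>) \<midarrow>a\<rightarrow> onorm f' * \<bar>g a - g a\<bar>"
    using g by (intro tendsto_intros) (auto simp: isCont_def)
  ultimately have lim: "(\<lambda>x. norm (f x - f' (x - a)) / norm (x - a) * \<bar>g x\<bar> + onorm f' * \<bar>g x - g a\<bar>) \<midarrow>a\<rightarrow> 0"
    using tendsto_add by fastforce
  have "(\<lambda>x. norm (f x * g x - f a * g a - f' (x - a) * g a) / norm (x - a)) \<midarrow>a\<rightarrow> 0"
  proof (rule Lim_null_comparison[OF _ lim], rule eventually_at_ball'[of 1, THEN eventually_mono], simp)
    fix x
    assume "x \<in> ball a 1 \<and> x \<noteq> a \<and> x \<in> UNIV"
    then have n: "0 < norm (x - a)" by simp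
    have "f x * g x - f' (x - a) * g a = (f x - f' (x - a)) * g x + f' (x - a) * (g x - g a)"
      by (simp add: algebra_simps)
    then have "norm (f x * g x - f' (x - a) * g a) \<le> norm (f x - f' (x - a)) * \<bar>g x\<bar> + \<bar>f' (x - a)\<bar> * \<bar>g x - g a\<bar>"
      by (metis abs_mult norm_triangle_ineq real_norm_def)
    also have "\<dots> \<le> norm (f x - f' (x - a)) * \<bar>g x\<bar> + onorm f' * norm (x - a) * \<bar>g x - g a\<bar>"
      using onorm[OF bl, of "x - a"] by (intro add_left_mono mult_right_mono) auto
    finally have "norm (f x * g x - f' (x - a) * g a) / norm (x - a) \<le>
      (norm (f x - f' (x - a)) * \<bar>g x\<bar> + onorm f' * norm (x - a) * \<bar>g x - g a\<bar>) / norm (x - a)"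
      by (rule divide_right_mono) simp
    also have "\<dots> = norm (f x - f' (x - a)) / norm (x - a) * \<bar>g x\<bar> + onorm f' * \<bar>g x - g a\<bar>"
      using n by (simp add: field_simps)
    finally show "norm (norm (f x * g x - f a * g a - f' (x - a) * g a) / norm (x - a))
      \<le> norm (f x - f' (x - a)) / norm (x - a) * \<bar>g x\<bar> + onorm f' * \<bar>g x - g a\<bar>"
      using fa by simp
  qed
  then show ?thesis
    unfolding has_derivative_iff_norm using bounded_linear_mult_const[OF bl] by simp
qed

section \<open>Polynomials in the coordinates\<close>

inductive_set polyfun :: "('a \<Rightarrow> 'a \<Rightarrow> real) \<Rightarrow> 'a set \<Rightarrow> ('a \<Rightarrow> real) set"
  for \<phi> :: "'a \<Rightarrow> 'a \<Rightarrow> real" and E :: "'a set" where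
  const: "(\<lambda>_. c) \<in> polyfun \<phi> E"
| coord: "b \<in> E \<Longrightarrow> \<phi> b \<in> polyfun \<phi> E"
| add: "p \<in> polyfun \<phi> E \<Longrightarrow> q \<in> polyfun \<phi> E \<Longrightarrow> (\<lambda>x. p x + q x) \<in> polyfun \<phi> E"
| mult: "p \<in> polyfun \<phi> E \<Longrightarrow> q \<in> polyfun \<phi> E \<Longrightarrow> (\<lambda>x. p x * q x) \<in> polyfun \<phi> E"

lemma polyfun_sum: "(\<And>i. i \<in> I \<Longrightarrow> p i \<in> polyfun \<phi> E) \<Longrightarrow> (\<lambda>x. \<Sum>i\<in>I. p i x) \<in> polyfun \<phi> E"
  by (induction I rule: infinite_finite_induct) (auto intro: polyfun.intros)

text \<open>Partial derivatives are only asserted to exist as polynomials again; repeated use then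
  differentiates H to any order without a formula for differentiated brackets.\<close>

lemma (in fd_coords) polyfun_derivative:
  assumes "p \<in> polyfun \<phi> E"
  shows "\<exists>p'. (\<forall>c\<in>E. p' c \<in> polyfun \<phi> E) \<and> (\<forall>x. (p has_derivative (\<lambda>h. \<Sum>c\<in>E. \<phi> c h * p' c x)) (at x))"
  using assms
proof induction
  case (const c)
  show ?case by (intro exI[of _ "\<lambda>_ _. 0"]) (auto intro: polyfun.intros)
next
  case (coord b)
  have "(\<Sum>c\<in>E. \<phi> c h * (if c = b then 1 else 0)) = \<phi> b h" for h
    using coord finE by (simp add: if_distrib sum.delta cong: if_cong)
  then show ?case
    using bounded_linear_imp_has_derivative[OF \<phi>_bl[OF coord]]
    by (intro exI[of _ "\<lambda>c _. if c = b then 1 else 0"]) (auto intro: polyfun.intros)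
next
  case (add p q)
  then obtain p' q' where *: "\<And>c. c \<in> E \<Longrightarrow> p' c \<in> polyfun \<phi> E" "\<And>c. c \<in> E \<Longrightarrow> q' c \<in> polyfun \<phi> E"
    "\<And>x. (p has_derivative (\<lambda>h. \<Sum>c\<in>E. \<phi> c h * p' c x)) (at x)"
    "\<And>x. (q has_derivative (\<lambda>h. \<Sum>c\<in>E. \<phi> c h * q' c x)) (at x)" by blast
  show ?case
    using has_derivative_add[OF *(3,4)]
    by (intro exI[of _ "\<lambda>c x. p' c x + q' c x"]) (auto intro!: polyfun.add * simp: sum.distrib distrib_left)
next
  case (mult p q)
  then obtain p' q' where *: "\<And>c. c \<in> E \<Longrightarrow> p' c \<in> polyfun \<phi> E" "\<And>c. c \<in> E \<Longrightarrow> q' c \<in> polyfun \<phi> E"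
    "\<And>x. (p has_derivative (\<lambda>h. \<Sum>c\<in>E. \<phi> c h * p' c x)) (at x)"
    "\<And>x. (q has_derivative (\<lambda>h. \<Sum>c\<in>E. \<phi> c h * q' c x)) (at x)" by blast
  have "((\<lambda>x. p x * q x) has_derivative (\<lambda>h. \<Sum>c\<in>E. \<phi> c h * (p x * q' c x + p' c x * q x))) (at x)" for x
    using has_derivative_mult[OF *(3,4)]
    by (rule has_derivative_eq_rhs) (simp add: sum_distrib_left sum_distrib_right distrib_left sum.distrib mult_ac)
  then show ?case
    using mult by (intro exI[of _ "\<lambda>c x. p x * q' c x + p' c x * q x"]) (auto intro!: polyfun.add polyfun.mult *)
qed

section \<open>Smoothness of a right inverse of the identity plus a polynomial contraction\<close>

locale smooth_inverse = fd_coords S E \<phi>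
  for S :: "'a::real_normed_vector set" and E \<phi> +
  fixes p :: "'a \<Rightarrow> 'a \<Rightarrow> real" and dp :: "'a \<Rightarrow> 'a \<Rightarrow> 'a \<Rightarrow> real" and \<Psi> :: "'a \<Rightarrow> 'a" and T :: "'a set"
  assumes dp_poly: "b \<in> E \<Longrightarrow> c \<in> E \<Longrightarrow> dp b c \<in> polyfun \<phi> E"
    and p_deriv: "b \<in> E \<Longrightarrow> (p b has_derivative (\<lambda>h. \<Sum>c\<in>E. \<phi> c h * dp b c x)) (at x)"
    and openT: "open T" and \<Psi>_cont: "continuous_on T \<Psi>"
    and \<Psi>_eq: "v \<in> T \<Longrightarrow> \<Psi> v + (\<Sum>b\<in>E. p b (\<Psi> v) *\<^sub>R b) = v"
    and contr: "v \<in> T \<Longrightarrow> z \<in> S \<Longrightarrow>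
      norm (\<Sum>b\<in>E. (\<Sum>c\<in>E. \<phi> c z * dp b c (\<Psi> v)) *\<^sub>R b) \<le> norm z / 2"
begin

text \<open>The derivative at \<open>\<Psi> v\<close> of the map with coordinates
  \<open>p b\<close>; in the application that map is H o P.\<close>

definition dH :: "'a \<Rightarrow> 'a \<Rightarrow> 'a" where
  "dH v h = (\<Sum>b\<in>E. (\<Sum>c\<in>E. \<phi> c h * dp b c (\<Psi> v)) *\<^sub>R b)"

lemma dH_bl: "bounded_linear (dH v)"
  unfolding dH_def [abs_def]
  by (intro bounded_linear_sum bounded_linear_scaleR_const bounded_linear_mult_const \<phi>_bl)

lemma dH_in: "dH v h \<in> S"
  unfolding dH_def using S E_sub by (intro subspace_sum subspace_scale) auto

text \<open>The contraction bound and completeness are available on S only. Writing g = h + s turns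
  the equation into s = - dH (h + s), a fixed point problem on S even when h lies outside it. Two
  solutions differ by a value of dH, hence by an element of S, and the same bound shows that they
  agree.\<close>

lemma dH_solve:
  assumes v: "v \<in> T"
  shows "\<exists>!g. g + dH v g = h"
proof -
  interpret dH: bounded_linear "dH v" by (rule dH_bl)
  have c: "norm (dH v z) \<le> norm z / 2" if "z \<in> S" for z using contr[OF v that] by (simp add: dH_def)
  have "\<exists>!s\<in>S. - dH v (h + s) = s"
  proof (rule Banach_fix[of S "1/2"])
    show "complete S" by (rule complete_S)
    show "S \<noteq> {}" using S subspace_0 by blast
    show "(\<lambda>s. - dH v (h + s)) ` S \<subseteq> S" using dH_in S by (auto simp: subspace_neg)
    show "dist (- dH v (h + x)) (- dH v (h + y)) \<le> 1 / 2 * dist x y" if "x \<in> S" "y \<in> S" for x y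
      using c[of "y - x"] that S by (simp add: dist_norm dH.add dH.diff subspace_diff norm_minus_commute)
  qed auto
  then obtain s where s: "- dH v (h + s) = s" by blast
  have 1: "(h + s) + dH v (h + s) = h" using s by (metis add.right_inverse add.right_neutral add.assoc)
  have 2: "g = g'" if "g + dH v g = h" "g' + dH v g' = h" for g g'
  proof -
    have "g - g' = dH v (g' - g)" using that by (simp add: dH.diff algebra_simps)
    moreover then have "norm (g - g') \<le> norm (g - g') / 2"
      using c[of "g' - g"] dH_in[of v "g' - g"] S by (metis minus_diff_eq norm_minus_commute subspace_neg)
    ultimately show ?thesis by simp
  qed
  show ?thesis using 1 2 by blast
qed

definition Q :: "'a \<Rightarrow> 'a \<Rightarrow> 'a" where "Q v h = (THE g. g + dH v g = h)"

lemma Q_eq: "v \<in> T \<Longrightarrow> Q v h + dH v (Q v h) = h"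
  unfolding Q_def by (rule theI'[OF dH_solve])

lemma Q_unique: "v \<in> T \<Longrightarrow> g + dH v g = h \<Longrightarrow> Q v h = g"
  using dH_solve Q_eq by blast

text \<open>For h outside S the factor 1/2 applies only to the correction s in
  \<open>Q v h = h + s\<close>, which is why the bound contains \<open>dH v h\<close>.\<close>

lemma Q_norm:
  assumes v: "v \<in> T" shows "norm (Q v h) \<le> norm h + 2 * norm (dH v h)"
proof -
  interpret dH: bounded_linear "dH v" by (rule dH_bl)
  define s where "s = - dH v (Q v h)"
  have sS: "s \<in> S" unfolding s_def using dH_in S by (simp add: subspace_neg)
  have Qs: "Q v h = h + s" using Q_eq[OF v, of h] by (simp add: s_def algebra_simps)
  have "s = - dH v h - dH v s" using Qs by (metis s_def dH.add minus_add_distrib add_uminus_conv_diff)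
  then have "norm s \<le> norm (dH v h) + norm (dH v s)"
    by (metis norm_minus_cancel norm_triangle_ineq4)
  moreover have "norm (dH v s) \<le> norm s / 2" using contr[OF v sS] by (simp add: dH_def)
  ultimately have "norm s \<le> 2 * norm (dH v h)" by simp
  then show ?thesis using Qs norm_triangle_ineq[of h s] by simp
qed

lemma Q_bl:
  assumes v: "v \<in> T" shows "bounded_linear (Q v)"
proof -
  interpret dH: bounded_linear "dH v" by (rule dH_bl)
  obtain K where K: "\<And>h. norm (dH v h) \<le> norm h * K" using dH.bounded by blast
  show ?thesis
  proof (rule bounded_linear_intro[of _ "1 + 2 * K"])
    fix x y show "Q v (x + y) = Q v x + Q v y"
      using Q_eq[OF v, of x] Q_eq[OF v, of y] by (intro Q_unique[OF v]) (metis dH.add add.assoc add.left_commute)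
  next
    fix c x show "Q v (c *\<^sub>R x) = c *\<^sub>R Q v x"
      using Q_eq[OF v, of x] by (intro Q_unique[OF v]) (metis dH.scaleR scaleR_add_right)
  next
    fix x show "norm (Q v x) \<le> norm x * (1 + 2 * K)"
      using Q_norm[OF v, of x] K[of x] by (simp add: algebra_simps)
  qed
qed

lemma inj_Q: "v \<in> T \<Longrightarrow> inj (Q v)"
  using Q_eq by (metis injI)

text \<open>A continuous right inverse of a differentiable map is differentiable wherever the
  derivative of that map is invertible; \<open>Q v\<close> is the inverse of id + dH.\<close>

lemma \<Psi>_deriv:
  assumes v: "v \<in> T"
  shows "(\<Psi> has_derivative Q v) (at v)"
proof (rule has_derivative_inverse_basic[where f = "\<lambda>x. x + (\<Sum>b\<in>E. p b x *\<^sub>R b)" and f' = "\<lambda>h. h + dH v h" and T = T])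
  show "((\<lambda>x. x + (\<Sum>b\<in>E. p b x *\<^sub>R b)) has_derivative (\<lambda>h. h + dH v h)) (at (\<Psi> v))"
    unfolding dH_def
    by (intro has_derivative_add has_derivative_ident has_derivative_sum
        has_derivative_scaleR_left p_deriv)
  show "bounded_linear (Q v)" by (rule Q_bl[OF v])
  show "Q v \<circ> (\<lambda>h. h + dH v h) = id" using Q_unique[OF v] by auto
  show "continuous (at v) \<Psi>" using \<Psi>_cont openT v by (simp add: continuous_on_eq_continuous_at)
qed (use openT v \<Psi>_eq in auto)

text \<open>\<open>Q v h\<close> is among the generators because it is the derivative of \<Psi>, and
  its own derivative is again built from Q and polynomials in \<Psi>; this closes the algebra after
  one extension.\<close>

inductive_set FC :: "('a \<Rightarrow> real) set" where
  const: "(\<lambda>_. c) \<in> FC"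
| psi: "b \<in> E \<Longrightarrow> (\<lambda>v. \<phi> b (\<Psi> v)) \<in> FC"
| Q: "b \<in> E \<Longrightarrow> (\<lambda>v. \<phi> b (Q v h)) \<in> FC"
| add: "f \<in> FC \<Longrightarrow> g \<in> FC \<Longrightarrow> (\<lambda>x. f x + g x) \<in> FC"
| mult: "f \<in> FC \<Longrightarrow> g \<in> FC \<Longrightarrow> (\<lambda>x. f x * g x) \<in> FC"

lemma FC_sum: "(\<And>i. i \<in> I \<Longrightarrow> f i \<in> FC) \<Longrightarrow> (\<lambda>x. \<Sum>i\<in>I. f i x) \<in> FC"
  by (induction I rule: infinite_finite_induct) (auto intro: FC.intros)

lemma FC_minus: "f \<in> FC \<Longrightarrow> (\<lambda>x. - f x) \<in> FC"
  using FC.mult[OF FC.const[of "-1"], of f] by simp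

lemma polyfun_FC: "q \<in> polyfun \<phi> E \<Longrightarrow> (\<lambda>v. q (\<Psi> v)) \<in> FC"
  by (induction rule: polyfun.induct) (auto intro: FC.intros)

lemma \<phi>\<Psi>_deriv: "b \<in> E \<Longrightarrow> v \<in> T \<Longrightarrow> ((\<lambda>v. \<phi> b (\<Psi> v)) has_derivative (\<lambda>h. \<phi> b (Q v h))) (at v)"
  using bounded_linear.has_derivative[OF \<phi>_bl \<Psi>_deriv] by blast

lemma dp_deriv:
  assumes "b \<in> E" "c \<in> E"
  shows "\<exists>D. (\<forall>v\<in>T. ((\<lambda>v. dp b c (\<Psi> v)) has_derivative D v) (at v)) \<and> (\<forall>h. (\<lambda>v. D v h) \<in> FC)"
proof -
  obtain q where q: "\<And>d. d \<in> E \<Longrightarrow> q d \<in> polyfun \<phi> E"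
    "\<And>x. (dp b c has_derivative (\<lambda>h. \<Sum>d\<in>E. \<phi> d h * q d x)) (at x)"
    using polyfun_derivative[OF dp_poly[OF assms]] by blast
  show ?thesis
  proof (intro exI[of _ "\<lambda>v h. \<Sum>d\<in>E. \<phi> d (Q v h) * q d (\<Psi> v)"] conjI ballI allI)
    fix v assume v: "v \<in> T"
    show "((\<lambda>v. dp b c (\<Psi> v)) has_derivative (\<lambda>h. \<Sum>d\<in>E. \<phi> d (Q v h) * q d (\<Psi> v))) (at v)"
      using has_derivative_compose[OF \<Psi>_deriv[OF v] q(2)] by simp
  next
    fix h show "(\<lambda>v. \<Sum>d\<in>E. \<phi> d (Q v h) * q d (\<Psi> v)) \<in> FC"
      by (intro FC_sum FC.mult FC.Q polyfun_FC q(1))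
  qed
qed

lemma dp_cont: "b \<in> E \<Longrightarrow> c \<in> E \<Longrightarrow> v \<in> T \<Longrightarrow> isCont (\<lambda>v. dp b c (\<Psi> v)) v"
  using dp_deriv has_derivative_continuous by blast

lemma dH_cont: "v \<in> T \<Longrightarrow> isCont (\<lambda>v. dH v h) v"
  unfolding dH_def by (intro continuous_intros dp_cont) auto

text \<open>The resolvent identity \<open>Q\<^sub>u - Q\<^sub>v = Q\<^sub>v (H'\<^sub>v - H'\<^sub>u) Q\<^sub>u\<close>, in coordinates.\<close>

lemma Q_resolvent:
  assumes "u \<in> T" "v \<in> T"
  shows "Q u h = Q v h - (\<Sum>b\<in>E. (\<Sum>c\<in>E. (dp b c (\<Psi> u) - dp b c (\<Psi> v)) * \<phi> c (Q u h)) *\<^sub>R Q v b)"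
proof -
  interpret Q: bounded_linear "Q v" by (rule Q_bl[OF assms(2)])
  let ?r = "\<Sum>b\<in>E. (\<Sum>c\<in>E. (dp b c (\<Psi> u) - dp b c (\<Psi> v)) * \<phi> c (Q u h)) *\<^sub>R b"
  have r: "?r = dH u (Q u h) - dH v (Q u h)"
    by (simp add: dH_def sum_subtractf[symmetric] scaleR_diff_left[symmetric] algebra_simps)
  have "Q u h + dH v (Q u h) = h - ?r" using Q_eq[OF assms(1), of h] r by (simp add: algebra_simps)
  then have "Q u h = Q v (h - ?r)" using Q_unique[OF assms(2)] by metis
  also have "\<dots> = Q v h - (\<Sum>b\<in>E. (\<Sum>c\<in>E. (dp b c (\<Psi> u) - dp b c (\<Psi> v)) * \<phi> c (Q u h)) *\<^sub>R Q v b)"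
    by (simp add: Q.diff Q.sum Q.scaleR)
  finally show ?thesis .
qed

text \<open>In the resolvent identity the coefficients
  \<open>dp b d (\<Psi> u) - dp b d (\<Psi> v)\<close> tend to 0, and they multiply coordinates of
  \<open>Q u h\<close> that stay bounded near v.\<close>

lemma \<phi>Q_cont:
  assumes c: "c \<in> E" and v: "v \<in> T"
  shows "isCont (\<lambda>u. \<phi> c (Q u h)) v"
proof -
  have evT: "\<forall>\<^sub>F u in at v. u \<in> T" using openT v by (simp add: eventually_at_in_open')
  \<comment> \<open>The bound of \<open>Q_norm\<close>, with \<open>dH u h\<close> compared to
    \<open>dH v h\<close> up to a tolerance of 1.\<close>
  define M where "M = norm h + 2 * (norm (dH v h) + 1)"
  have "\<forall>\<^sub>F u in at v. dist (dH u h) (dH v h) < 1"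
    using dH_cont[OF v, of h] unfolding isCont_def by (rule tendstoD) simp
  then have bnd: "\<forall>\<^sub>F u in at v. norm (Q u h) \<le> M"
    using evT
  proof eventually_elim
    case (elim u)
    then show ?case
      using Q_norm[of u h] norm_triangle_ineq2[of "dH u h" "dH v h"] by (simp add: M_def dist_norm)
  qed
  have z: "((\<lambda>u. (dp b d (\<Psi> u) - dp b d (\<Psi> v)) * \<phi> d (Q u h)) \<longlongrightarrow> 0) (at v)" if bd: "b \<in> E" "d \<in> E" for b d
  proof -
    have "((\<lambda>u. dp b d (\<Psi> u) - dp b d (\<Psi> v)) \<longlongrightarrow> 0) (at v)"
      using dp_cont[OF bd v] by (simp add: isCont_def LIM_zero_iff)
    moreover have "\<forall>\<^sub>F u in at v. norm (\<phi> d (Q u h)) \<le> onorm (\<phi> d) * M"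
      using bnd
    proof eventually_elim
      case (elim u)
      have "norm (\<phi> d (Q u h)) \<le> onorm (\<phi> d) * norm (Q u h)" by (rule onorm[OF \<phi>_bl[OF bd(2)]])
      also have "\<dots> \<le> onorm (\<phi> d) * M" using elim onorm_pos_le[OF \<phi>_bl[OF bd(2)]] by (rule mult_left_mono)
      finally show ?case .
    qed
    ultimately show ?thesis
      by (intro lim_null_mult_right_bounded) auto
  qed
  have "((\<lambda>u. Q v h - (\<Sum>b\<in>E. (\<Sum>d\<in>E. (dp b d (\<Psi> u) - dp b d (\<Psi> v)) * \<phi> d (Q u h)) *\<^sub>R Q v b)) \<longlongrightarrow>
      Q v h - (\<Sum>b\<in>E. (\<Sum>d\<in>E. 0) *\<^sub>R Q v b)) (at v)"
    by (intro tendsto_intros z)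
  then have "((\<lambda>u. Q v h - (\<Sum>b\<in>E. (\<Sum>d\<in>E. (dp b d (\<Psi> u) - dp b d (\<Psi> v)) * \<phi> d (Q u h)) *\<^sub>R Q v b)) \<longlongrightarrow> Q v h) (at v)"
    by simp
  moreover have "\<forall>\<^sub>F u in at v. Q v h - (\<Sum>b\<in>E. (\<Sum>d\<in>E. (dp b d (\<Psi> u) - dp b d (\<Psi> v)) * \<phi> d (Q u h)) *\<^sub>R Q v b) = Q u h"
    using evT by eventually_elim (rule Q_resolvent[OF _ v, symmetric])
  ultimately have "((\<lambda>u. Q u h) \<longlongrightarrow> Q v h) (at v)"
    by (rule Lim_transform_eventually)
  then show ?thesis
    unfolding isCont_def by (intro bounded_linear.tendsto[OF \<phi>_bl[OF c]])
qed

text \<open>The coordinate form of dQ = - Q (dH') Q, obtained by differentiating the resolvent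
  identity at u = v. Each summand has a factor vanishing at v, so continuity of \<open>Q u h\<close>
  is enough; evaluating the other factor at v leaves an element of \<open>FC\<close>.\<close>

lemma \<phi>Q_deriv:
  assumes b: "b \<in> E"
  shows "\<exists>D. (\<forall>v\<in>T. ((\<lambda>v. \<phi> b (Q v h)) has_derivative D v) (at v)) \<and> (\<forall>k. (\<lambda>v. D v k) \<in> FC)"
proof -
  have "\<forall>a\<in>E. \<forall>c\<in>E. \<exists>D. (\<forall>v\<in>T. ((\<lambda>v. dp a c (\<Psi> v)) has_derivative D v) (at v)) \<and> (\<forall>h. (\<lambda>v. D v h) \<in> FC)"
    using dp_deriv by blast
  then obtain D where D: "\<And>a c v. a \<in> E \<Longrightarrow> c \<in> E \<Longrightarrow> v \<in> T \<Longrightarrow> ((\<lambda>v. dp a c (\<Psi> v)) has_derivative D a c v) (at v)"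
    "\<And>a c k. a \<in> E \<Longrightarrow> c \<in> E \<Longrightarrow> (\<lambda>v. D a c v k) \<in> FC"
    by metis
  define D' where "D' v k = - (\<Sum>a\<in>E. (\<Sum>c\<in>E. D a c v k * \<phi> c (Q v h)) * \<phi> b (Q v a))" for v k
  have "((\<lambda>v. \<phi> b (Q v h)) has_derivative D' v) (at v)" if v: "v \<in> T" for v
  proof -
    have eq: "\<phi> b (Q u h) = \<phi> b (Q v h) - (\<Sum>a\<in>E. (\<Sum>c\<in>E. (dp a c (\<Psi> u) - dp a c (\<Psi> v)) * \<phi> c (Q u h)) * \<phi> b (Q v a))"
      if "u \<in> T" for u
    proof -
      interpret \<phi>: bounded_linear "\<phi> b" by (rule \<phi>_bl[OF b])
      show ?thesis by (subst Q_resolvent[OF that v]) (simp add: \<phi>.diff \<phi>.sum \<phi>.scaleR)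
    qed
    have "((\<lambda>u. (dp a c (\<Psi> u) - dp a c (\<Psi> v)) * \<phi> c (Q u h)) has_derivative (\<lambda>k. D a c v k * \<phi> c (Q v h))) (at v)"
      if "a \<in> E" "c \<in> E" for a c
      using has_derivative_diff[OF D(1)[OF that v] has_derivative_const]
      by (intro has_derivative_vanishing_mult \<phi>Q_cont that v) auto
    then have "((\<lambda>u. \<phi> b (Q v h) - (\<Sum>a\<in>E. (\<Sum>c\<in>E. (dp a c (\<Psi> u) - dp a c (\<Psi> v)) * \<phi> c (Q u h)) * \<phi> b (Q v a)))
      has_derivative (\<lambda>k. 0 - (\<Sum>a\<in>E. (\<Sum>c\<in>E. D a c v k * \<phi> c (Q v h)) * \<phi> b (Q v a)))) (at v)"
      by (intro has_derivative_diff has_derivative_const has_derivative_sum has_derivative_mult_left)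
    then have "((\<lambda>v. \<phi> b (Q v h)) has_derivative (\<lambda>k. 0 - (\<Sum>a\<in>E. (\<Sum>c\<in>E. D a c v k * \<phi> c (Q v h)) * \<phi> b (Q v a)))) (at v)"
      by (rule has_derivative_transform_within_open[OF _ openT v]) (use eq in simp)
    then show ?thesis by (simp add: D'_def [abs_def])
  qed
  moreover have "(\<lambda>v. D' v k) \<in> FC" for k
    unfolding D'_def by (intro FC_minus FC_sum FC.mult FC.Q D(2) b)
  ultimately show ?thesis by blast
qed

lemma FC_deriv:
  assumes "f \<in> FC"
  shows "\<exists>f'. (\<forall>v\<in>T. (f has_derivative f' v) (at v)) \<and> (\<forall>h. (\<lambda>v. f' v h) \<in> FC)"
  using assms
proof induction
  case (const c)
  show ?case by (intro exI[of _ "\<lambda>_ _. 0"]) (auto intro: FC.intros)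
next
  case (psi b)
  then show ?case by (intro exI[of _ "\<lambda>v h. \<phi> b (Q v h)"]) (auto intro: FC.intros \<phi>\<Psi>_deriv)
next
  case (Q b h)
  then show ?case by (rule \<phi>Q_deriv)
next
  case (add f g)
  then obtain f' g' where *: "\<And>v. v \<in> T \<Longrightarrow> (f has_derivative f' v) (at v)" "\<And>v. v \<in> T \<Longrightarrow> (g has_derivative g' v) (at v)"
    "\<And>h. (\<lambda>v. f' v h) \<in> FC" "\<And>h. (\<lambda>v. g' v h) \<in> FC" by blast
  show ?case
    by (intro exI[of _ "\<lambda>v h. f' v h + g' v h"]) (auto intro: FC.add * has_derivative_add)
next
  case (mult f g)
  then obtain f' g' where *: "\<And>v. v \<in> T \<Longrightarrow> (f has_derivative f' v) (at v)" "\<And>v. v \<in> T \<Longrightarrow> (g has_derivative g' v) (at v)"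
    "\<And>h. (\<lambda>v. f' v h) \<in> FC" "\<And>h. (\<lambda>v. g' v h) \<in> FC" by blast
  show ?case
    using mult by (intro exI[of _ "\<lambda>v h. f v * g' v h + f' v h * g v"]) (auto intro!: FC.add FC.mult * has_derivative_mult)
qed

text \<open>On B the values of \<Psi> lie in S, so there \<Psi> coincides with the combination of
  its coordinates, and \<open>FC\<close>-combinations of the vectors in E form the class closed
  under derivatives.\<close>

lemma smooth_\<Psi>:
  assumes B: "B \<subseteq> T" and \<Psi>_in: "\<And>v. v \<in> B \<Longrightarrow> \<Psi> v \<in> S" and eq: "\<And>v. v \<in> B \<Longrightarrow> f v = \<Psi> v"
  shows "smooth_on K B f"
proof (rule smooth_on_of_closed_class[where F = "{\<lambda>v. \<Sum>b\<in>E. g b v *\<^sub>R b | g. \<forall>b\<in>E. g b \<in> FC}"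
      and g = "\<lambda>v. \<Sum>b\<in>E. \<phi> b (\<Psi> v) *\<^sub>R b"])
  fix F assume "F \<in> {\<lambda>v. \<Sum>b\<in>E. g b v *\<^sub>R b | g. \<forall>b\<in>E. g b \<in> FC}"
  then obtain g where F: "F = (\<lambda>v. \<Sum>b\<in>E. g b v *\<^sub>R b)" and g: "\<forall>b\<in>E. g b \<in> FC" by blast
  have "\<forall>b\<in>E. \<exists>f'. (\<forall>v\<in>T. (g b has_derivative f' v) (at v)) \<and> (\<forall>h. (\<lambda>v. f' v h) \<in> FC)"
    using g FC_deriv by blast
  then obtain g' where g': "\<And>b v. b \<in> E \<Longrightarrow> v \<in> T \<Longrightarrow> (g b has_derivative g' b v) (at v)"
    "\<And>b h. b \<in> E \<Longrightarrow> (\<lambda>v. g' b v h) \<in> FC" by metis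
  have "(F has_derivative (\<lambda>h. \<Sum>b\<in>E. g' b v h *\<^sub>R b)) (at v within B)" if "v \<in> B" for v
    unfolding F using that B
    by (intro has_derivative_at_withinI[OF has_derivative_sum] has_derivative_scaleR_left g') auto
  moreover have "(\<lambda>v. \<Sum>b\<in>E. g' b v h *\<^sub>R b) \<in> {\<lambda>v. \<Sum>b\<in>E. g b v *\<^sub>R b | g. \<forall>b\<in>E. g b \<in> FC}" for h
    by (intro CollectI exI[of _ "\<lambda>b v. g' b v h"] conjI refl ballI g'(2))
  ultimately show "\<exists>f'. (\<forall>v\<in>B. (F has_derivative f' v) (at v within B)) \<and>
      (\<forall>h\<in>K. (\<lambda>v. f' v h) \<in> {\<lambda>v. \<Sum>b\<in>E. g b v *\<^sub>R b | g. \<forall>b\<in>E. g b \<in> FC})"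
    by (intro exI[of _ "\<lambda>v h. \<Sum>b\<in>E. g' b v h *\<^sub>R b"]) blast
next
  show "(\<lambda>v. \<Sum>b\<in>E. \<phi> b (\<Psi> v) *\<^sub>R b) \<in> {\<lambda>v. \<Sum>b\<in>E. g b v *\<^sub>R b | g. \<forall>b\<in>E. g b \<in> FC}"
    by (intro CollectI exI[of _ "\<lambda>b v. \<phi> b (\<Psi> v)"] conjI refl ballI FC.psi)
  show "f v = (\<Sum>b\<in>E. \<phi> b (\<Psi> v) *\<^sub>R b)" if "v \<in> B" for v
    using that \<phi>_expand[OF \<Psi>_in] eq by simp
qed

end

section \<open>Sums over compositions and unshuffles\<close>

lemma finite_compositions: "finite (compositions i m)"
proof (rule finite_subset)
  show "compositions i m \<subseteq> {rs. set rs \<subseteq> {..m} \<and> length rs = i}"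
    unfolding compositions_def using member_le_sum_list by fastforce
qed (simp add: finite_lists_length_eq)

text \<open>The other parts contribute at least 1 to the total. This is why the recursion refers to
  earlier terms only.\<close>

lemma compositions_entry_less:
  assumes rs: "rs \<in> compositions i m" and i: "2 \<le> i" and r: "r \<in> set rs"
  shows "r < m"
proof -
  have ge: "length qs \<le> sum_list qs" if "\<forall>q\<in>set qs. 1 \<le> q" for qs :: "nat list"
    using that by (induction qs) auto
  obtain xs ys where s: "rs = xs @ r # ys" using r split_list by metis
  have "length xs \<le> sum_list xs" "length ys \<le> sum_list ys" "length xs + length ys \<ge> 1" "sum_list rs = m"
    using rs i s ge unfolding compositions_def by auto
  then show ?thesis using s by simp
qed

lemma compositions_1: "1 \<le> m \<Longrightarrow> compositions 1 m = {[m]}"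
  unfolding compositions_def by (auto simp: length_Suc_conv)

lemma compositions_empty:
  assumes "m < i" shows "compositions i m = {}"
proof -
  have ge: "length qs \<le> sum_list qs" if "\<forall>q\<in>set qs. 1 \<le> q" for qs :: "nat list"
    using that by (induction qs) auto
  show ?thesis using assms ge unfolding compositions_def by fastforce
qed

lemma compositions_eq_lists_over:
  "m \<le> n \<Longrightarrow> compositions i m = {rs \<in> lists_over i {1..n}. sum_list rs = m}"
  unfolding compositions_def lists_over_def using member_le_sum_list by fastforce

lemma sum_compositions_eq:
  "(\<Sum>m\<le>n. \<Sum>rs\<in>compositions i m. g rs) = (\<Sum>rs\<in>{rs \<in> lists_over i {1..n}. sum_list rs \<le> n}. g rs)"
proof -
  have "{rs \<in> lists_over i {1..n}. sum_list rs \<le> n} = (\<Union>m\<in>{..n}. compositions i m)"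
    using compositions_eq_lists_over[of _ n i] by auto
  moreover have "compositions i m \<inter> compositions i m' = {}" if "m \<noteq> m'" for m m'
    using that by (auto simp: compositions_def)
  ultimately show ?thesis by (simp add: sum.UNION_disjoint finite_compositions)
qed

lemma sum_list_le_mult:
  fixes rs :: "nat list"
  assumes "\<forall>r\<in>set rs. r \<le> c" shows "sum_list rs \<le> length rs * c"
  using assms by (induction rs) auto

text \<open>The difference consists of the words over {1..n} with total above n. None of them has
  all entries at most n div i, since such a word has total at most n; hence their norms are
  controlled by the full power minus the power of the shorter partial sum.\<close>

lemma cauchy_product_tail:
  fixes f :: "'a::real_normed_vector list \<Rightarrow> 'b::real_normed_vector"
  assumes f: "mlin S i f" "mbound S i f c" and c: "0 \<le> c" and S: "subspace S" and w: "\<And>r. w r \<in> S" and i: "1 \<le> i"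
  shows "norm (f (replicate i (\<Sum>r\<in>{1..n}. w r)) - (\<Sum>m\<le>n. \<Sum>rs\<in>compositions i m. f (map w rs)))
    \<le> c * ((\<Sum>r\<in>{1..n}. norm (w r)) ^ i - (\<Sum>r\<in>{1..n div i}. norm (w r)) ^ i)"
proof -
  define L where "L = lists_over i {1..n}"
  define G where "G = {rs \<in> L. sum_list rs \<le> n}"
  define a where "a rs = (\<Prod>r\<leftarrow>rs. norm (w r))" for rs :: "nat list"
  have a_nn: "0 \<le> a rs" for rs unfolding a_def by (intro prod_list_nonneg) auto
  have finL: "finite L" unfolding L_def by (rule finite_lists_over) simp
  have GL: "G \<subseteq> L" unfolding G_def by blast
  have finG: "finite G" using finL GL finite_subset by blast
  have "f (replicate i (\<Sum>r\<in>{1..n}. w r)) - (\<Sum>m\<le>n. \<Sum>rs\<in>compositions i m. f (map w rs))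
      = (\<Sum>rs\<in>L. f (map w rs)) - (\<Sum>rs\<in>G. f (map w rs))"
    unfolding sum_compositions_eq G_def L_def by (simp add: mlin_expand[OF f(1) S] w)
  also have "\<dots> = (\<Sum>rs\<in>L - G. f (map w rs))" by (simp add: sum_diff[OF finL GL])
  also have "norm \<dots> \<le> (\<Sum>rs\<in>L - G. c * a rs)"
  proof (rule sum_norm_le)
    fix rs assume "rs \<in> L - G"
    then have "length rs = i" unfolding L_def lists_over_def by auto
    then have "norm (f (map w rs)) \<le> c * (\<Prod>x\<leftarrow>map w rs. norm x)"
      using w by (intro mboundD[OF f(2)]) auto
    then show "norm (f (map w rs)) \<le> c * a rs" by (simp add: a_def o_def)
  qed
  also have "\<dots> = c * (sum a L - sum a G)" by (simp add: sum_distrib_left[symmetric] sum_diff[OF finL GL])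
  also have "\<dots> \<le> c * ((\<Sum>r\<in>{1..n}. norm (w r)) ^ i - (\<Sum>r\<in>{1..n div i}. norm (w r)) ^ i)"
  proof (intro mult_left_mono diff_mono c)
    show "sum a L \<le> (\<Sum>r\<in>{1..n}. norm (w r)) ^ i"
      unfolding a_def L_def by (simp add: sum_prod_lists_over)
    have "lists_over i {1..n div i} \<subseteq> G"
    proof
      fix rs assume rs: "rs \<in> lists_over i {1..n div i}"
      then have "\<forall>r\<in>set rs. r \<le> n div i" "length rs = i" unfolding lists_over_def by auto
      then have "sum_list rs \<le> i * (n div i)" using sum_list_le_mult by blast
      also have "\<dots> \<le> n" by simp
      finally have "sum_list rs \<le> n" .
      moreover have "{1..n div i} \<subseteq> {1..n}" using div_le_dividend[of n i] by auto
      ultimately show "rs \<in> G" using rs unfolding G_def L_def lists_over_def by blast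
    qed
    then have "sum a (lists_over i {1..n div i}) \<le> sum a G"
      using a_nn by (intro sum_mono2 finG) auto
    then show "(\<Sum>r\<in>{1..n div i}. norm (w r)) ^ i \<le> sum a G"
      unfolding a_def by (simp add: sum_prod_lists_over)
  qed
  finally show ?thesis .
qed

text \<open>Two differences tend to 0: the map at the partial sum against the map at x, by the
  telescoping estimate, and against the partial Cauchy product, where n and n div i both grow and
  the two powers share the limit \<open>R ^ i\<close>.\<close>

lemma cauchy_product_sums:
  fixes f :: "'a::real_normed_vector list \<Rightarrow> 'b::real_normed_vector"
  assumes f: "mlin S i f" "mbound S i f c" and c: "0 \<le> c" and S: "subspace S"
    and w: "\<And>r. w r \<in> S" and w0: "w 0 = 0" and i: "1 \<le> i"
    and sm: "summable (\<lambda>r. norm (w r))" and x: "w sums x" "x \<in> S"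
  shows "(\<lambda>m. \<Sum>rs\<in>compositions i m. f (map w rs)) sums f (replicate i x)"
proof -
  define s where "s n = (\<Sum>r\<in>{1..n}. w r)" for n
  define A where "A n = (\<Sum>r\<in>{1..n}. norm (w r))" for n
  define R where "R = (\<Sum>r. norm (w r))"
  \<comment> \<open>Compositions have parts at least 1 whereas series start at index 0;
    \<open>w 0 = 0\<close> reconciles the two.\<close>
  have shift: "(\<Sum>r\<in>{1..n}. g r) = (\<Sum>r\<le>n. g r)" if "g 0 = 0" for g :: "nat \<Rightarrow> 'c::comm_monoid_add" and n
    using that by (intro sum.mono_neutral_left) (auto simp: Suc_le_eq)
  have s_lim: "s \<longlonglongrightarrow> x"
    using x(1) shift[of w, OF w0] unfolding sums_def_le s_def [abs_def] by simp
  have A_lim: "A \<longlonglongrightarrow> R"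
    using summable_sums[OF sm] shift[of "\<lambda>r. norm (w r)"] w0 unfolding sums_def_le A_def [abs_def] R_def by simp
  have A_le: "A n \<le> R" for n
    unfolding A_def R_def by (intro sum_le_suminf sm) auto
  have sR: "norm (s n) \<le> R" for n
    using A_le[of n] norm_sum[of w "{1..n}"] unfolding s_def A_def by linarith
  have xR: "norm x \<le> R"
    using sR by (intro LIMSEQ_le_const2[OF tendsto_norm[OF s_lim]]) auto
  have sS: "s n \<in> S" for n unfolding s_def using S w by (intro subspace_sum) auto
  have "(\<lambda>n. f (replicate i (s n)) - f (replicate i x)) \<longlonglongrightarrow> 0"
  proof (rule Lim_null_comparison)
    show "\<forall>\<^sub>F n in sequentially. norm (f (replicate i (s n)) - f (replicate i x)) \<le> c * (real i * R ^ (i - 1)) * norm (s n - x)"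
      by (intro always_eventually allI mlin_replicate_diff[OF f c S sS x(2) sR xR])
    have "(\<lambda>n. c * (real i * R ^ (i - 1)) * norm (s n - x)) \<longlonglongrightarrow> c * (real i * R ^ (i - 1)) * norm (x - x)"
      by (intro tendsto_intros s_lim)
    then show "(\<lambda>n. c * (real i * R ^ (i - 1)) * norm (s n - x)) \<longlonglongrightarrow> 0" by simp
  qed
  moreover have "(\<lambda>n. f (replicate i (s n)) - (\<Sum>m\<le>n. \<Sum>rs\<in>compositions i m. f (map w rs))) \<longlonglongrightarrow> 0"
  proof (rule Lim_null_comparison)
    show "\<forall>\<^sub>F n in sequentially. norm (f (replicate i (s n)) - (\<Sum>m\<le>n. \<Sum>rs\<in>compositions i m. f (map w rs)))
        \<le> c * (A n ^ i - A (n div i) ^ i)"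
      unfolding s_def A_def by (intro always_eventually allI cauchy_product_tail[OF f c S w i])
    have "filterlim (\<lambda>n. n div i) sequentially sequentially"
      using i by (intro filterlim_at_top_div_const_nat) auto
    then have "(\<lambda>n. A (n div i)) \<longlonglongrightarrow> R" by (rule filterlim_compose[OF A_lim])
    then have "(\<lambda>n. c * (A n ^ i - A (n div i) ^ i)) \<longlonglongrightarrow> c * (R ^ i - R ^ i)"
      by (intro tendsto_intros A_lim)
    then show "(\<lambda>n. c * (A n ^ i - A (n div i) ^ i)) \<longlonglongrightarrow> 0" by simp
  qed
  ultimately have "(\<lambda>n. (f (replicate i (s n)) - f (replicate i x))
      - (f (replicate i (s n)) - (\<Sum>m\<le>n. \<Sum>rs\<in>compositions i m. f (map w rs)))) \<longlonglongrightarrow> 0 - 0"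
    by (rule tendsto_diff)
  then have "(\<lambda>n. (\<Sum>m\<le>n. \<Sum>rs\<in>compositions i m. f (map w rs)) - f (replicate i x)) \<longlonglongrightarrow> 0" by simp
  then show ?thesis unfolding sums_def_le by (simp add: LIM_zero_iff)
qed

text \<open>Cauchy's majorant argument on partial sums. Every term up to index n + 1 comes from
  products of terms of index at most n, so if s is the sum up to n, the next one is at most a 1 +
  sum of b i s^i, and R is a value that this map does not exceed.\<close>

lemma majorant_bound:
  fixes a :: "nat \<Rightarrow> real"
  assumes a: "\<And>r. 0 \<le> a r" and b: "\<And>i. 0 \<le> b i" and R: "a 1 + (\<Sum>i\<in>{2..N}. b i * R ^ i) \<le> R"
    and rec: "\<And>m. 2 \<le> m \<Longrightarrow> a m \<le> (\<Sum>i\<in>{2..N}. b i * (\<Sum>rs\<in>compositions i m. \<Prod>r\<leftarrow>rs. a r))"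
    and Rnn: "0 \<le> R"
  shows "(\<Sum>r\<in>{1..n}. a r) \<le> R"
proof (induction n)
  case 0
  then show ?case using Rnn by simp
next
  case (Suc n)
  define s where "s = (\<Sum>r\<in>{1..n}. a r)"
  have s: "0 \<le> s" "s \<le> R" using Suc a unfolding s_def by (auto intro: sum_nonneg)
  have part: "(\<Sum>m\<in>{2..Suc n}. \<Sum>rs\<in>compositions i m. \<Prod>r\<leftarrow>rs. a r) \<le> s ^ i" if i: "2 \<le> i" for i
  proof -
    have "(\<Sum>m\<in>{2..Suc n}. \<Sum>rs\<in>compositions i m. \<Prod>r\<leftarrow>rs. a r)
        = (\<Sum>rs\<in>(\<Union>m\<in>{2..Suc n}. compositions i m). \<Prod>r\<leftarrow>rs. a r)"
      by (subst sum.UNION_disjoint) (auto simp: finite_compositions, auto simp: compositions_def)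
    also have "\<dots> \<le> (\<Sum>rs\<in>lists_over i {1..n}. \<Prod>r\<leftarrow>rs. a r)"
    proof (rule sum_mono2)
      show "finite (lists_over i {1..n})" by (rule finite_lists_over) simp
      show "(\<Union>m\<in>{2..Suc n}. compositions i m) \<subseteq> lists_over i {1..n}"
      proof
        fix rs assume "rs \<in> (\<Union>m\<in>{2..Suc n}. compositions i m)"
        then obtain m where m: "m \<le> Suc n" "rs \<in> compositions i m" by auto
        have "r \<in> {1..n}" if "r \<in> set rs" for r
          using compositions_entry_less[OF m(2) i that] m that unfolding compositions_def by auto
        then show "rs \<in> lists_over i {1..n}" using m unfolding lists_over_def compositions_def by auto
      qed
      show "0 \<le> (\<Prod>r\<leftarrow>rs. a r)" for rs using a by (intro prod_list_nonneg) auto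
    qed
    also have "\<dots> = s ^ i" by (simp add: sum_prod_lists_over s_def)
    finally show ?thesis .
  qed
  have "(\<Sum>r\<in>{1..Suc n}. a r) = a 1 + (\<Sum>m\<in>{2..Suc n}. a m)"
    by (subst sum.atLeast_Suc_atMost) (auto simp: numeral_2_eq_2)
  also have "\<dots> \<le> a 1 + (\<Sum>m\<in>{2..Suc n}. \<Sum>i\<in>{2..N}. b i * (\<Sum>rs\<in>compositions i m. \<Prod>r\<leftarrow>rs. a r))"
    using rec by (intro add_left_mono sum_mono) auto
  also have "\<dots> = a 1 + (\<Sum>i\<in>{2..N}. b i * (\<Sum>m\<in>{2..Suc n}. \<Sum>rs\<in>compositions i m. \<Prod>r\<leftarrow>rs. a r))"
    by (subst sum.swap) (simp add: sum_distrib_left del: sum.cl_ivl_Suc)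
  also have "\<dots> \<le> a 1 + (\<Sum>i\<in>{2..N}. b i * R ^ i)"
  proof (intro add_left_mono sum_mono mult_left_mono b)
    fix i assume "i \<in> {2..N}"
    then show "(\<Sum>m\<in>{2..Suc n}. \<Sum>rs\<in>compositions i m. \<Prod>r\<leftarrow>rs. a r) \<le> R ^ i"
      using part[of i] power_mono[OF s(2,1), of i] by simp
  qed
  finally show ?case using R by simp
qed

section \<open>Counting unshuffles\<close>

lemma unshuffles_lists:
  assumes "\<sigma> \<in> unshuffles i n" "i \<le> n"
  shows "map \<sigma> [0..<i] = sorted_list_of_set (\<sigma> ` {..<i})"
    and "map \<sigma> [i..<n] = sorted_list_of_set ({..<n} - \<sigma> ` {..<i})"
proof -
  have p: "\<sigma> permutes {..<n}" and inc: "\<And>a b. a < b \<Longrightarrow> b < i \<Longrightarrow> \<sigma> a < \<sigma> b"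
      "\<And>a b. i \<le> a \<Longrightarrow> a < b \<Longrightarrow> b < n \<Longrightarrow> \<sigma> a < \<sigma> b"
    using assms(1) unfolding unshuffles_def by auto
  have "set [0..<i] = {..<i}" by auto
  then show "map \<sigma> [0..<i] = sorted_list_of_set (\<sigma> ` {..<i})"
    using inc(1) by (intro strict_sorted_equal[OF strict_sorted_list_of_set]) (auto simp: sorted_wrt_iff_nth_less)
  have "\<sigma> ` {i..<n} = \<sigma> ` ({..<n} - {..<i})" by (rule arg_cong[of _ _ "image \<sigma>"]) auto
  also have "\<dots> = \<sigma> ` {..<n} - \<sigma> ` {..<i}" by (rule image_set_diff[OF permutes_inj[OF p]])
  also have "\<dots> = {..<n} - \<sigma> ` {..<i}" by (simp add: permutes_image[OF p])
  finally show "map \<sigma> [i..<n] = sorted_list_of_set ({..<n} - \<sigma> ` {..<i})"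
    using inc(2) by (intro strict_sorted_equal[OF strict_sorted_list_of_set]) (auto simp: sorted_wrt_iff_nth_less)
qed

text \<open>Both blocks are increasing, so the image of the first block determines the unshuffle;
  conversely, concatenating the sorted lists of an i-subset and its complement gives one.\<close>

lemma card_unshuffles:
  assumes "i \<le> n" shows "card (unshuffles i n) = n choose i"
proof -
  have "bij_betw (\<lambda>\<sigma>. \<sigma> ` {..<i}) (unshuffles i n) {A. A \<subseteq> {..<n} \<and> card A = i}"
    unfolding bij_betw_def
  proof (intro conjI set_eqI iffI)
    show "inj_on (\<lambda>\<sigma>. \<sigma> ` {..<i}) (unshuffles i n)"
    proof (rule inj_onI)
      fix \<sigma> \<tau> assume s: "\<sigma> \<in> unshuffles i n" and t: "\<tau> \<in> unshuffles i n" and e: "\<sigma> ` {..<i} = \<tau> ` {..<i}"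
      have "map \<sigma> [0..<i] = map \<tau> [0..<i]" "map \<sigma> [i..<n] = map \<tau> [i..<n]"
        using unshuffles_lists[OF s assms] unshuffles_lists[OF t assms] e by auto
      then have "\<sigma> k = \<tau> k" if "k < n" for k using that by (cases "k < i") auto
      moreover have "\<sigma> k = \<tau> k" if "\<not> k < n" for k
        using s t that unfolding unshuffles_def permutes_def by auto
      ultimately show "\<sigma> = \<tau>" by blast
    qed
  next
    fix A assume "A \<in> (\<lambda>\<sigma>. \<sigma> ` {..<i}) ` unshuffles i n"
    then obtain \<sigma> where s: "\<sigma> permutes {..<n}" "A = \<sigma> ` {..<i}" unfolding unshuffles_def by auto
    have "A \<subseteq> \<sigma> ` {..<n}" using s assms by auto
    moreover have "card A = i" using s(2) inj_on_subset[OF permutes_inj[OF s(1)], of "{..<i}"] by (simp add: card_image)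
    ultimately show "A \<in> {A. A \<subseteq> {..<n} \<and> card A = i}" using permutes_image[OF s(1)] by auto
  next
    fix A assume "A \<in> {A. A \<subseteq> {..<n} \<and> card A = i}"
    then have A: "A \<subseteq> {..<n}" "card A = i" "finite A" using finite_subset by auto
    define L where "L = sorted_list_of_set A @ sorted_list_of_set ({..<n} - A)"
    define \<sigma> where "\<sigma> k = (if k < n then L ! k else k)" for k
    have len: "length L = n" "length (sorted_list_of_set A) = i" "length (sorted_list_of_set ({..<n} - A)) = n - i"
      using A assms by (auto simp: L_def card_Diff_subset)
    have set_L: "set L = {..<n}" and dist: "distinct L" using A by (auto simp: L_def)
    have "\<sigma> ` {..<n} = (!) L ` {..<n}" by (intro image_cong) (auto simp: \<sigma>_def)
    also have "\<dots> = set L" using len by (metis atLeast0LessThan image_set list.set_map map_nth set_upt)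
    finally have im: "\<sigma> ` {..<n} = {..<n}" using set_L by simp
    then have "bij_betw \<sigma> {..<n} {..<n}"
      by (simp add: bij_betw_def eq_card_imp_inj_on)
    then have p: "\<sigma> permutes {..<n}" by (rule bij_imp_permutes) (simp add: \<sigma>_def)
    have lo: "\<sigma> k = sorted_list_of_set A ! k" if "k < i" for k
      using that assms len by (simp add: \<sigma>_def L_def nth_append)
    have hi: "\<sigma> k = sorted_list_of_set ({..<n} - A) ! (k - i)" if "i \<le> k" "k < n" for k
      using that assms len by (simp add: \<sigma>_def L_def nth_append)
    have "\<sigma> \<in> unshuffles i n"
      unfolding unshuffles_def
    proof (intro CollectI conjI p allI impI)
      fix a b assume "a < b \<and> b < i"
      then show "\<sigma> a < \<sigma> b"
        using lo[of a] lo[of b] len sorted_wrt_nth_less[OF strict_sorted_list_of_set[of A], of a b] by simp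
    next
      fix a b assume "i \<le> a \<and> a < b \<and> b < n"
      moreover from this have "a - i < b - i" "b - i < n - i" by auto
      ultimately show "\<sigma> a < \<sigma> b"
        using hi[of a] hi[of b] len
          sorted_wrt_nth_less[OF strict_sorted_list_of_set[of "{..<n} - A"], of "a - i" "b - i"] by simp
    qed
    moreover have "\<sigma> ` {..<i} = A"
    proof -
      have "\<sigma> ` {..<i} = (!) (sorted_list_of_set A) ` {..<i}" by (intro image_cong) (auto simp: lo)
      also have "\<dots> = set (sorted_list_of_set A)"
        using len(2) by (metis atLeast0LessThan image_set list.set_map map_nth set_upt)
      finally show ?thesis using A by simp
    qed
    ultimately show "A \<in> (\<lambda>\<sigma>. \<sigma> ` {..<i}) ` unshuffles i n" by blast
  qed
  then have "card (unshuffles i n) = card {A. A \<subseteq> {..<n} \<and> card A = i}" by (rule bij_betw_same_card)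
  then show ?thesis by (simp add: n_subsets)
qed

lemma koszul_even:
  assumes "\<sigma> \<in> unshuffles i n" shows "koszul (replicate n 0) \<sigma> = 1"
proof -
  have "\<sigma> a < n" if "a < n" for a
    using assms that permutes_in_image[of \<sigma> "{..<n}" a] unfolding unshuffles_def by auto
  then show ?thesis unfolding koszul_def by (intro prod.neutral) (auto simp: ksign_def)
qed

section \<open>The Maurer-Cartan equation for the formal series\<close>

lemma length_psi_list: "length (psi_list l h1 v k) = Suc k"
  by (induction k) (auto simp: Let_def)

lemma psi_list_nth:
  assumes "j \<le> k" shows "psi_list l h1 v k ! j = vseq l h1 v j"
  using assms
proof (induction k)
  case (Suc k)
  then show ?case
    by (cases "j = Suc k") (auto simp: vseq_def Let_def nth_append length_psi_list)
qed (simp add: vseq_def)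

lemma vseq_0: "vseq l h1 v 0 = 0" and vseq_1: "vseq l h1 v 1 = v"
  by (simp_all add: vseq_def)

text \<open>All parts are smaller than m, so every lookup stays within the stored list of earlier
  terms, which can then be replaced by the sequence itself.\<close>

lemma vseq_rec:
  assumes "2 \<le> m"
  shows "vseq l h1 v m = - h1 (\<Sum>i\<in>{2..m}. \<Sum>rs\<in>compositions i m.
    (fact m / (\<Prod>r\<leftarrow>rs. fact r) / fact i) *\<^sub>R l i (map (vseq l h1 v) rs))"
proof -
  obtain k where k: "m = Suc k" "k \<noteq> 0" using assms by (cases m) auto
  have "vseq l h1 v m = - h1 (\<Sum>i\<in>{2..m}. \<Sum>rs\<in>compositions i m.
      (fact m / (\<Prod>r\<leftarrow>rs. fact r) / fact i) *\<^sub>R l i (map (\<lambda>r. psi_list l h1 v k ! r) rs))"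
    unfolding k(1) vseq_def using k(2)
    by (simp add: Let_def nth_append length_psi_list del: sum.cl_ivl_Suc fact_Suc)
  also have "(\<Sum>i\<in>{2..m}. \<Sum>rs\<in>compositions i m.
      (fact m / (\<Prod>r\<leftarrow>rs. fact r) / fact i) *\<^sub>R l i (map (\<lambda>r. psi_list l h1 v k ! r) rs))
    = (\<Sum>i\<in>{2..m}. \<Sum>rs\<in>compositions i m.
      (fact m / (\<Prod>r\<leftarrow>rs. fact r) / fact i) *\<^sub>R l i (map (vseq l h1 v) rs))"
  proof (intro sum.cong refl)
    fix i rs assume "i \<in> {2..m}" "rs \<in> compositions i m"
    then have "map (\<lambda>r. psi_list l h1 v k ! r) rs = map (vseq l h1 v) rs"
      using compositions_entry_less[of rs i m] k by (auto simp: less_Suc_eq_le psi_list_nth)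
    then show "(fact m / (\<Prod>r\<leftarrow>rs. fact r) / fact i) *\<^sub>R l i (map (\<lambda>r. psi_list l h1 v k ! r) rs)
      = (fact m / (\<Prod>r\<leftarrow>rs. fact r) / fact i) *\<^sub>R l i (map (vseq l h1 v) rs)" by (simp only:)
  qed
  finally show ?thesis .
qed

section \<open>Brackets on degrees 0 and 1: diagonal Jacobi and Bianchi identities\<close>

locale Linf_setting =
  fixes V :: "int \<Rightarrow> 'a::real_normed_vector set"
    and l :: "nat \<Rightarrow> 'a list \<Rightarrow> 'a"
    and N :: nat
    and h1 h2 :: "'a \<Rightarrow> 'a"
  assumes Linf: "strict_Linf V l N"
    and H1: "\<forall>x\<in>V 1. l 1 [x] = 0 \<longrightarrow> (\<exists>y\<in>V 0. l 1 [y] = x)"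
    and h1_lin: "lin_on (V 1) h1" and h1_map: "h1 ` V 1 \<subseteq> V 0"
    and h2_lin: "lin_on (V 2) h2" and h2_map: "h2 ` V 2 \<subseteq> V 1"
    and homotopy: "\<forall>x\<in>V 1. l 1 [h1 x] + h2 (l 1 [x]) = x"
begin

lemma fin_dim_V: "fin_dim_subspace (V i)"
  using Linf unfolding strict_Linf_def graded_fd_def by blast

lemma subspace_V: "subspace (V i)"
  using fin_dim_V unfolding fin_dim_subspace_def by blast

lemma V_total: "V i \<subseteq> total_space V"
  unfolding total_space_def by (metis UN_upper UNIV_I span_superset subset_trans)

lemma l_mlin_total: "mlin (total_space V) k (l k)"
  using Linf unfolding strict_Linf_def mlin_def by blast

lemma l_mlin: "mlin (V 0) k (l k)"
  by (rule mlin_subset[OF l_mlin_total V_total])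

lemma l_degree: "length xs = k \<Longrightarrow> homog V ds xs \<Longrightarrow> l k xs \<in> V (sum_list ds + 1)"
  using Linf unfolding strict_Linf_def by blast

lemma l_strict: "N \<le> k \<Longrightarrow> length xs = k \<Longrightarrow> homog V ds xs \<Longrightarrow> l k xs = 0"
  using Linf unfolding strict_Linf_def by blast

lemma l_jacobi:
  "1 \<le> n \<Longrightarrow> length xs = n \<Longrightarrow> homog V ds xs \<Longrightarrow>
   (\<Sum>i\<in>{1..n}. \<Sum>\<sigma>\<in>unshuffles i n. koszul ds \<sigma> *\<^sub>R l (n - i + 1)
      (l i (map (\<lambda>a. xs ! \<sigma> a) [0..<i]) # map (\<lambda>a. xs ! \<sigma> a) [i..<n])) = 0"
  using Linf unfolding strict_Linf_def by blast

lemma homog_0: "length xs = k \<Longrightarrow> set xs \<subseteq> V 0 \<Longrightarrow> homog V (replicate k 0) xs"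
  unfolding homog_def by (simp add: subset_iff)

lemma homog_1: "length xs = k \<Longrightarrow> set xs \<subseteq> V 0 \<Longrightarrow> z \<in> V 1 \<Longrightarrow> homog V (1 # replicate k 0) (z # xs)"
  unfolding homog_def by (auto simp: nth_Cons' subset_iff)

lemma l_V0: "length xs = k \<Longrightarrow> set xs \<subseteq> V 0 \<Longrightarrow> l k xs \<in> V 1"
  using l_degree[OF _ homog_0, of xs k k] by (simp add: sum_list_replicate)

lemma l_V1: "length xs = k \<Longrightarrow> set xs \<subseteq> V 0 \<Longrightarrow> z \<in> V 1 \<Longrightarrow> l (Suc k) (z # xs) \<in> V 2"
  using l_degree[of "z # xs" "Suc k" "1 # replicate k 0"] homog_1[of xs k z] by (simp add: sum_list_replicate)

lemma l_zero0: "N \<le> k \<Longrightarrow> length xs = k \<Longrightarrow> set xs \<subseteq> V 0 \<Longrightarrow> l k xs = 0"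
  using l_strict[OF _ _ homog_0] by blast

lemma l_zero1: "N \<le> Suc k \<Longrightarrow> length xs = k \<Longrightarrow> set xs \<subseteq> V 0 \<Longrightarrow> z \<in> V 1 \<Longrightarrow> l (Suc k) (z # xs) = 0"
  using l_strict[OF _ _ homog_1] by simp

lemma l1_lin: "lin_on (V i) (\<lambda>x. l 1 [x])"
  using mlin_head[OF mlin_subset[OF l_mlin_total[of "Suc 0"] V_total[of i]], of "[]"] subspace_0[OF subspace_V]
  by simp

lemma l1_V0: "x \<in> V 0 \<Longrightarrow> l 1 [x] \<in> V 1"
  using l_V0[of "[x]" 1] by simp

lemma l1_V1: "x \<in> V 1 \<Longrightarrow> l 1 [x] \<in> V 2"
  using l_V1[of "[]" 0 x] by simp

lemma l_head_lin:
  assumes "length xs = k" "set xs \<subseteq> V 0"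
  shows "lin_on (V 1) (\<lambda>z. l (Suc k) (z # xs))"
proof -
  have "set xs \<subseteq> total_space V" using assms V_total by blast
  moreover have "0 \<in> total_space V" by (simp add: total_space_def span_zero)
  ultimately have "lin_on (total_space V) (\<lambda>z. l (Suc k) (z # xs))"
    using assms by (intro mlin_head[OF l_mlin_total]) auto
  then show ?thesis by (rule lin_on_subset) (rule V_total)
qed

text \<open>With equal arguments of degree 0 there are no signs, and all unshuffles of one type
  contribute the same term; only their number remains.\<close>

lemma jacobi_diagonal:
  assumes x: "x \<in> V 0" and n: "1 \<le> n"
  shows "(\<Sum>i\<in>{1..n}. real (n choose i) *\<^sub>R l (n - i + 1) (l i (replicate i x) # replicate (n - i) x)) = 0"
proof -
  have h: "homog V (replicate n 0) (replicate n x)" using x by (intro homog_0) auto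
  have "(\<Sum>i\<in>{1..n}. real (n choose i) *\<^sub>R l (n - i + 1) (l i (replicate i x) # replicate (n - i) x))
    = (\<Sum>i\<in>{1..n}. \<Sum>\<sigma>\<in>unshuffles i n. koszul (replicate n 0) \<sigma> *\<^sub>R l (n - i + 1)
      (l i (map (\<lambda>a. replicate n x ! \<sigma> a) [0..<i]) # map (\<lambda>a. replicate n x ! \<sigma> a) [i..<n]))"
  proof (rule sum.cong[OF refl])
    fix i assume i: "i \<in> {1..n}"
    have "koszul (replicate n 0) \<sigma> *\<^sub>R l (n - i + 1)
        (l i (map (\<lambda>a. replicate n x ! \<sigma> a) [0..<i]) # map (\<lambda>a. replicate n x ! \<sigma> a) [i..<n])
      = l (n - i + 1) (l i (replicate i x) # replicate (n - i) x)" if \<sigma>: "\<sigma> \<in> unshuffles i n" for \<sigma>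
    proof -
      have "\<sigma> a < n" if "a < n" for a
        using \<sigma> that permutes_in_image[of \<sigma> "{..<n}" a] unfolding unshuffles_def by auto
      then have "map (\<lambda>a. replicate n x ! \<sigma> a) [0..<i] = replicate i x"
        "map (\<lambda>a. replicate n x ! \<sigma> a) [i..<n] = replicate (n - i) x"
        using i by (auto intro!: nth_equalityI)
      then show ?thesis by (simp add: koszul_even[OF \<sigma>])
    qed
    then have "(\<Sum>\<sigma>\<in>unshuffles i n. koszul (replicate n 0) \<sigma> *\<^sub>R l (n - i + 1)
        (l i (map (\<lambda>a. replicate n x ! \<sigma> a) [0..<i]) # map (\<lambda>a. replicate n x ! \<sigma> a) [i..<n]))
      = (\<Sum>\<sigma>\<in>unshuffles i n. l (n - i + 1) (l i (replicate i x) # replicate (n - i) x))"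
      by (rule sum.cong[OF refl])
    also have "\<dots> = real (n choose i) *\<^sub>R l (n - i + 1) (l i (replicate i x) # replicate (n - i) x)"
      using i by (simp add: sum_constant_scaleR card_unshuffles)
    finally show "real (n choose i) *\<^sub>R l (n - i + 1) (l i (replicate i x) # replicate (n - i) x)
      = (\<Sum>\<sigma>\<in>unshuffles i n. koszul (replicate n 0) \<sigma> *\<^sub>R l (n - i + 1)
      (l i (map (\<lambda>a. replicate n x ! \<sigma> a) [0..<i]) # map (\<lambda>a. replicate n x ! \<sigma> a) [i..<n]))" by simp
  qed
  also have "\<dots> = 0" using l_jacobi[OF n _ h] by simp
  finally show ?thesis .
qed

lemma l1_l1: "x \<in> V 0 \<Longrightarrow> l 1 [l 1 [x]] = 0"
  using jacobi_diagonal[of x 1] by simp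

definition MC :: "'a \<Rightarrow> 'a" where
  "MC x = (\<Sum>k=1..N. (1 / fact k) *\<^sub>R l k (replicate k x))"

lemma MC_V1: "x \<in> V 0 \<Longrightarrow> MC x \<in> V 1"
  unfolding MC_def by (intro subspace_sum subspace_scale subspace_V l_V0) auto

text \<open>Dividing the n-th diagonal Jacobi identity by n! turns the binomial into 1/(i! k!) with
  i + k = n; summing over n reassembles MC x in the first slot.\<close>

lemma bianchi:
  assumes x: "x \<in> V 0"
  shows "(\<Sum>k\<le>N. (1 / fact k) *\<^sub>R l (Suc k) (MC x # replicate k x)) = 0"
proof -
  define J where "J i k = (1 / (fact i * fact k)) *\<^sub>R l (Suc k) (l i (replicate i x) # replicate k x)" for i k
  have rep: "length (replicate k x) = k" "set (replicate k x) \<subseteq> V 0" for k using x by auto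
  have lin: "lin_on (V 1) (\<lambda>z. l (Suc k) (z # replicate k x))" for k by (rule l_head_lin[OF rep])
  have lV1: "l i (replicate i x) \<in> V 1" for i by (rule l_V0[OF rep])
  have J0: "J i k = 0" if "N < i \<or> N < k" for i k
  proof (cases "N < i")
    case True
    then have "l i (replicate i x) = 0" by (intro l_zero0[OF _ rep]) auto
    then show ?thesis using lin_on_zero[OF lin subspace_0[OF subspace_V]] by (simp add: J_def)
  next
    case False
    then show ?thesis using that l_zero1[OF _ rep lV1] by (simp add: J_def)
  qed
  have diag: "(\<Sum>i\<in>{1..n}. J i (n - i)) = 0" if n: "1 \<le> n" for n
  proof -
    have "(\<Sum>i\<in>{1..n}. J i (n - i)) = (1 / fact n) *\<^sub>R (\<Sum>i\<in>{1..n}. real (n choose i) *\<^sub>R l (n - i + 1) (l i (replicate i x) # replicate (n - i) x))"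
      unfolding scaleR_sum_right J_def by (intro sum.cong refl) (simp add: binomial_fact)
    then show ?thesis using jacobi_diagonal[OF x n] by simp
  qed
  have "(\<Sum>k\<le>N. (1 / fact k) *\<^sub>R l (Suc k) (MC x # replicate k x)) = (\<Sum>k\<le>N. \<Sum>i\<in>{1..N}. J i k)"
  proof (intro sum.cong refl)
    fix k
    have "l (Suc k) (MC x # replicate k x) = (\<Sum>i\<in>{1..N}. l (Suc k) ((1 / fact i) *\<^sub>R l i (replicate i x) # replicate k x))"
      unfolding MC_def using subspace_V lV1 by (intro lin_on_sum[OF lin]) (auto simp: subspace_scale)
    also have "\<dots> = (\<Sum>i\<in>{1..N}. (1 / fact i) *\<^sub>R l (Suc k) (l i (replicate i x) # replicate k x))"
      by (intro sum.cong refl lin_on_scaleR[OF lin] subspace_0[OF subspace_V] lV1)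
    finally show "(1 / fact k) *\<^sub>R l (Suc k) (MC x # replicate k x) = (\<Sum>i\<in>{1..N}. J i k)"
      by (simp add: J_def scaleR_sum_right mult.commute)
  qed
  also have "\<dots> = (\<Sum>(k, i)\<in>{..N} \<times> {1..N}. J i k)" by (simp add: sum.cartesian_product)
  \<comment> \<open>The square of indices is enlarged to a triangle, which is a union of complete
    diagonals i + k = n; the added terms vanish by strictness.\<close>
  also have "\<dots> = (\<Sum>(k, i)\<in>{(k, i). 1 \<le> i \<and> i + k \<le> 2 * N}. J i k)"
  proof (rule sum.mono_neutral_left)
    show "finite {(k, i). 1 \<le> i \<and> i + k \<le> 2 * N}"
      by (rule finite_subset[of _ "{..2*N} \<times> {..2*N}"]) auto
  qed (auto, metis J0 not_le, metis J0 not_le)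
  also have "\<dots> = (\<Sum>(n, i)\<in>Sigma {1..2*N} (\<lambda>n. {1..n}). J i (n - i))"
    by (rule sum.reindex_bij_witness[of _ "\<lambda>(n, i). (n - i, i)" "\<lambda>(k, i). (i + k, i)"]) auto
  also have "\<dots> = (\<Sum>n\<in>{1..2*N}. \<Sum>i\<in>{1..n}. J i (n - i))" by (simp add: sum.Sigma)
  also have "\<dots> = 0" by (intro sum.neutral ballI diag) auto
  finally show ?thesis .
qed

text \<open>Isolating k = 0 expresses l_1 (MC x) through brackets that contain MC x once and x at
  least once, which accounts for both norm factors; the other copies of x are bounded by X.\<close>

lemma bianchi_bound:
  assumes X: "0 \<le> X"
  obtains C where "0 \<le> C" "\<And>x. x \<in> V 0 \<Longrightarrow> norm x \<le> X \<Longrightarrow> norm (l 1 [MC x]) \<le> C * norm x * norm (MC x)"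
proof -
  obtain B0 B1 where B: "finite B0" "span B0 = V 0" "finite B1" "span B1 = V 1"
    using fin_dim_V unfolding fin_dim_subspace_def by metis
  \<comment> \<open>Arguments from V 0 and V 1 occur in the same bracket, while
    \<open>mbound\<close> uses one subspace for all slots.\<close>
  define W where "W = span (B0 \<union> B1)"
  have W: "V 0 \<subseteq> W" "V 1 \<subseteq> W" "W \<subseteq> total_space V"
  proof -
    show "V 0 \<subseteq> W" "V 1 \<subseteq> W" unfolding W_def B(2,4)[symmetric] by (auto intro: span_mono[THEN subsetD])
    have "B0 \<union> B1 \<subseteq> total_space V" using B V_total span_superset by blast
    then show "W \<subseteq> total_space V" unfolding W_def total_space_def by (simp add: span_minimal)
  qed
  have "fin_dim_subspace W" unfolding fin_dim_subspace_def W_def using B by (metis finite_Un subspace_span)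
  then obtain E \<phi> where "fd_coords W E \<phi>" by (rule fd_coords_exist)
  then interpret fd_coords W E \<phi> .
  have "\<forall>k. \<exists>c\<ge>0. mbound W (Suc k) (l (Suc k)) c"
    using mlin_bounded[OF mlin_subset[OF l_mlin_total W(3)]] by metis
  then obtain c where c: "\<And>k. 0 \<le> c k" "\<And>k. mbound W (Suc k) (l (Suc k)) (c k)" by metis
  define C where "C = (\<Sum>k\<in>{1..N}. c k * X ^ (k - 1))"
  have "norm (l 1 [MC x]) \<le> C * norm x * norm (MC x)" if x: "x \<in> V 0" and xX: "norm x \<le> X" for x
  proof -
    have "l 1 [MC x] + (\<Sum>k\<in>{1..N}. (1 / fact k) *\<^sub>R l (Suc k) (MC x # replicate k x)) = 0"
      using bianchi[OF x] by (simp add: atMost_atLeast0 sum.atLeast_Suc_atMost)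
    then have "norm (l 1 [MC x]) = norm (\<Sum>k\<in>{1..N}. (1 / fact k) *\<^sub>R l (Suc k) (MC x # replicate k x))"
      by (metis add_eq_0_iff2 norm_minus_cancel)
    also have "\<dots> \<le> (\<Sum>k\<in>{1..N}. c k * X ^ (k - 1) * norm x * norm (MC x))"
    proof (rule sum_norm_le)
      fix k assume k: "k \<in> {1..N}"
      have "norm ((1 / fact k) *\<^sub>R l (Suc k) (MC x # replicate k x)) \<le> 1 * norm (l (Suc k) (MC x # replicate k x))"
        unfolding norm_scaleR by (intro mult_right_mono) (auto simp: field_simps fact_ge_1)
      also have "norm (l (Suc k) (MC x # replicate k x)) \<le> c k * (\<Prod>y\<leftarrow>MC x # replicate k x. norm y)"
        using W x MC_V1[OF x] by (intro mboundD[OF c(2)]) auto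
      also have "(\<Prod>y\<leftarrow>MC x # replicate k x. norm y) = norm x ^ (k - 1) * (norm x * norm (MC x))"
        using k power_Suc[of "norm x" "k - 1"] by (simp add: prod_list_replicate mult_ac)
      also have "c k * (norm x ^ (k - 1) * (norm x * norm (MC x))) \<le> c k * (X ^ (k - 1) * (norm x * norm (MC x)))"
        using c(1) xX by (intro mult_left_mono mult_right_mono power_mono) auto
      finally show "norm ((1 / fact k) *\<^sub>R l (Suc k) (MC x # replicate k x)) \<le> c k * X ^ (k - 1) * norm x * norm (MC x)"
        by (simp add: mult_ac)
    qed
    finally show ?thesis by (simp add: C_def sum_distrib_right)
  qed
  moreover have "0 \<le> C" unfolding C_def using c(1) X by (intro sum_nonneg) auto
  ultimately show ?thesis using that by blast
qed

section \<open>Taylor coefficients of the series and of its Maurer-Cartan expression\<close>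

definition w :: "'a \<Rightarrow> nat \<Rightarrow> 'a" where "w v k = (1 / fact k) *\<^sub>R vseq l h1 v k"

text \<open>The coefficient of t^m in the part of MC of order at least 2, evaluated at the sum of
  t^k w_k; \<open>Mc\<close> below is the same coefficient of all of MC.\<close>

definition F :: "'a \<Rightarrow> nat \<Rightarrow> 'a" where
  "F v m = (\<Sum>i\<in>{2..N}. (1 / fact i) *\<^sub>R (\<Sum>rs\<in>compositions i m. l i (map (w v) rs)))"

lemma w_0: "w v 0 = 0" and w_1: "w v 1 = v"
  using vseq_1[of l h1 v] by (simp_all add: w_def vseq_0)

lemma vseq_V0:
  assumes "v \<in> V 0" shows "vseq l h1 v k \<in> V 0"
proof (induction k rule: less_induct)
  case (less k)
  consider "k = 0" | "k = 1" | "2 \<le> k" by linarith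
  then show ?case
  proof cases
    case 3
    have "(\<Sum>i\<in>{2..k}. \<Sum>rs\<in>compositions i k. (fact k / (\<Prod>r\<leftarrow>rs. fact r) / fact i) *\<^sub>R l i (map (vseq l h1 v) rs)) \<in> V 1"
    proof (intro subspace_sum subspace_scale subspace_V l_V0)
      fix i rs assume "i \<in> {2..k}" "rs \<in> compositions i k"
      then show "length (map (vseq l h1 v) rs) = i" "set (map (vseq l h1 v) rs) \<subseteq> V 0"
        using compositions_entry_less[of rs i k] less by (auto simp: compositions_def)
    qed
    then show ?thesis unfolding vseq_rec[OF 3] using h1_map subspace_neg[OF subspace_V] by blast
  qed (use vseq_0[of l h1 v] vseq_1[of l h1 v] assms subspace_0[OF subspace_V] in auto)
qed

lemma w_V0: "v \<in> V 0 \<Longrightarrow> w v k \<in> V 0"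
  unfolding w_def by (intro subspace_scale[OF subspace_V] vseq_V0)

lemma l_w_V1: "v \<in> V 0 \<Longrightarrow> rs \<in> compositions i m \<Longrightarrow> l i (map (w v) rs) \<in> V 1"
  using w_V0 by (intro l_V0) (auto simp: compositions_def)

lemma F_V1: "v \<in> V 0 \<Longrightarrow> F v m \<in> V 1"
  unfolding F_def by (intro subspace_sum subspace_scale subspace_V l_w_V1)

text \<open>Multilinearity absorbs the factorials of the parts. The ranges i \<le> m and i \<le> N
  give the same sum: there are no compositions with i > m, and the brackets with i > N vanish on V
  0.\<close>

lemma w_rec:
  assumes v: "v \<in> V 0" and m: "2 \<le> m" shows "w v m = - h1 (F v m)"
proof -
  have summand: "(fact m / (\<Prod>r\<leftarrow>rs. fact r) / fact i) *\<^sub>R l i (map (vseq l h1 v) rs)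
      = fact m *\<^sub>R ((1 / fact i) *\<^sub>R l i (map (w v) rs))" if "rs \<in> compositions i m" for i rs
  proof -
    have "map (vseq l h1 v) rs = map (\<lambda>r. fact r *\<^sub>R w v r) rs" by (simp add: w_def)
    also have "l i \<dots> = (\<Prod>r\<leftarrow>rs. fact r) *\<^sub>R l i (map (w v) rs)"
      using that w_V0[OF v] by (intro mlin_scale[OF l_mlin subspace_V]) (auto simp: compositions_def)
    finally have "l i (map (vseq l h1 v) rs) = (\<Prod>r\<leftarrow>rs. fact r) *\<^sub>R l i (map (w v) rs)" .
    moreover have "(\<Prod>r\<leftarrow>rs. fact r :: real) \<noteq> 0" by (auto simp: prod_list_zero_iff)
    ultimately show ?thesis by simp
  qed
  have "(\<Sum>i\<in>{2..m}. \<Sum>rs\<in>compositions i m. (1 / fact i) *\<^sub>R l i (map (w v) rs))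
      = (\<Sum>i\<in>{2..max m N}. \<Sum>rs\<in>compositions i m. (1 / fact i) *\<^sub>R l i (map (w v) rs))"
    by (intro sum.mono_neutral_left) (auto simp: compositions_empty)
  also have "\<dots> = (\<Sum>i\<in>{2..N}. \<Sum>rs\<in>compositions i m. (1 / fact i) *\<^sub>R l i (map (w v) rs))"
  proof (intro sum.mono_neutral_right)
    show "\<forall>i\<in>{2..max m N} - {2..N}. (\<Sum>rs\<in>compositions i m. (1 / fact i) *\<^sub>R l i (map (w v) rs)) = 0"
    proof (intro ballI sum.neutral)
      fix i rs assume "i \<in> {2..max m N} - {2..N}" "rs \<in> compositions i m"
      then have "l i (map (w v) rs) = 0"
        using w_V0[OF v] by (intro l_zero0) (auto simp: compositions_def)
      then show "(1 / fact i) *\<^sub>R l i (map (w v) rs) = 0" by simp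
    qed
  qed auto
  finally have "(\<Sum>i\<in>{2..m}. \<Sum>rs\<in>compositions i m. (1 / fact i) *\<^sub>R l i (map (w v) rs)) = F v m"
    by (simp add: F_def scaleR_sum_right)
  moreover have "(\<Sum>i\<in>{2..m}. \<Sum>rs\<in>compositions i m. (fact m / (\<Prod>r\<leftarrow>rs. fact r) / fact i) *\<^sub>R l i (map (vseq l h1 v) rs))
      = (\<Sum>i\<in>{2..m}. \<Sum>rs\<in>compositions i m. fact m *\<^sub>R ((1 / fact i) *\<^sub>R l i (map (w v) rs)))"
    by (intro sum.cong refl summand)
  ultimately have "(\<Sum>i\<in>{2..m}. \<Sum>rs\<in>compositions i m. (fact m / (\<Prod>r\<leftarrow>rs. fact r) / fact i) *\<^sub>R l i (map (vseq l h1 v) rs)) = fact m *\<^sub>R F v m"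
    by (simp only: scaleR_sum_right[symmetric])
  then have "vseq l h1 v m = - h1 (fact m *\<^sub>R F v m)" using vseq_rec[OF m, of l h1 v] by (simp only:)
  also have "\<dots> = - (fact m *\<^sub>R h1 (F v m))"
    using lin_on_scaleR[OF h1_lin subspace_0[OF subspace_V] F_V1[OF v]] by simp
  finally show ?thesis by (simp add: w_def)
qed

definition Mc :: "'a \<Rightarrow> nat \<Rightarrow> 'a" where
  "Mc v m = (\<Sum>i\<in>{1..N}. (1 / fact i) *\<^sub>R (\<Sum>rs\<in>compositions i m. l i (map (w v) rs)))"

lemma Mc_eq:
  assumes v: "v \<in> V 0" shows "Mc v m = l 1 [w v m] + F v m"
proof -
  have "(\<Sum>rs\<in>compositions 1 m. l 1 (map (w v) rs)) = l 1 [w v m]"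
  proof (cases "m = 0")
    case True
    then have "compositions 1 m = {}" by (simp add: compositions_empty)
    then show ?thesis
      using True lin_on_zero[OF l1_lin subspace_0[OF subspace_V]] by (simp add: w_0 del: One_nat_def)
  next
    case False
    then show ?thesis using compositions_1[of m] by simp
  qed
  \<comment> \<open>For N = 0 the sum defining \<open>Mc\<close> is empty, and the linear term has
    to vanish too; strictness provides this.\<close>
  moreover have "l 1 [w v m] = 0" if "N = 0"
    using that w_V0[OF v] by (intro l_zero0) auto
  ultimately show ?thesis
    unfolding Mc_def F_def by (cases "N = 0") (auto simp: sum.atLeast_Suc_atMost numeral_2_eq_2)
qed

lemma F_below_2: "m < 2 \<Longrightarrow> F v m = 0"
  unfolding F_def by (intro sum.neutral) (auto simp: compositions_empty)

text \<open>Inserting w_m = - h1 F_m into the homotopy relation gives l_1 w_m + F_m = h2 l_1 F_m;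
  since l_1 l_1 = 0, F_m may be replaced by M_m under l_1.\<close>

lemma Mc_fix:
  assumes v: "v \<in> V 0" and m: "2 \<le> m" shows "h2 (l 1 [Mc v m]) = Mc v m"
proof -
  note F = F_V1[OF v, of m]
  have h1F: "h1 (F v m) \<in> V 0" using F h1_map by blast
  have "l 1 [w v m] = - l 1 [h1 (F v m)]"
    unfolding w_rec[OF v m] by (rule lin_on_minus[OF l1_lin subspace_V h1F])
  also have "\<dots> = h2 (l 1 [F v m]) - F v m" using homotopy F by (simp add: algebra_simps eq_diff_eq)
  finally have 1: "Mc v m = h2 (l 1 [F v m])" by (simp add: Mc_eq[OF v])
  have "l 1 [Mc v m] = l 1 [l 1 [w v m]] + l 1 [F v m]"
    unfolding Mc_eq[OF v] by (rule lin_on_add[OF l1_lin l1_V0[OF w_V0[OF v]] F])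
  then have "l 1 [Mc v m] = l 1 [F v m]" using l1_l1[OF w_V0[OF v]] by simp
  then show ?thesis using 1 by simp
qed

lemma Mc_V1: "v \<in> V 0 \<Longrightarrow> Mc v m \<in> V 1"
  unfolding Mc_def by (intro subspace_sum subspace_scale subspace_V l_w_V1)

text \<open>Words over {1..m} with total j \<le> m are exactly the compositions of j, so no
  coefficient up to order m notices the truncation. All other words carry a power of t of at least m
  + 1, which is dominated by \<open>t ^ Suc m\<close> on the unit interval.\<close>

lemma MC_poly:
  assumes v: "v \<in> V 0"
  shows "\<exists>D\<ge>0. \<forall>t\<in>{0..1}. norm (MC (\<Sum>r\<in>{1..m}. t ^ r *\<^sub>R w v r) - (\<Sum>j\<le>m. t ^ j *\<^sub>R Mc v j)) \<le> D * t ^ Suc m"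
proof -
  define L where "L i = lists_over i {1..m}" for i
  define D where "D = (\<Sum>i\<in>{1..N}. \<Sum>rs\<in>L i. norm (l i (map (w v) rs)))"
  have finL: "finite (L i)" for i unfolding L_def by (rule finite_lists_over) simp
  have "norm (MC (\<Sum>r\<in>{1..m}. t ^ r *\<^sub>R w v r) - (\<Sum>j\<le>m. t ^ j *\<^sub>R Mc v j)) \<le> D * t ^ Suc m" if t: "t \<in> {0..1}" for t
  proof -
    define g where "g i rs = t ^ sum_list rs *\<^sub>R l i (map (w v) rs)" for i and rs :: "nat list"
    have pw: "(\<Prod>r\<leftarrow>rs. t ^ r) = t ^ sum_list rs" for rs :: "nat list"
      by (induction rs) (auto simp: power_add)
    have expand: "l i (replicate i (\<Sum>r\<in>{1..m}. t ^ r *\<^sub>R w v r)) = (\<Sum>rs\<in>L i. g i rs)" for i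
    proof -
      have "l i (replicate i (\<Sum>r\<in>{1..m}. t ^ r *\<^sub>R w v r)) = (\<Sum>rs\<in>L i. l i (map (\<lambda>r. t ^ r *\<^sub>R w v r) rs))"
        unfolding L_def by (intro mlin_expand[OF l_mlin subspace_V] subspace_scale[OF subspace_V] w_V0[OF v])
      also have "\<dots> = (\<Sum>rs\<in>L i. g i rs)"
      proof (rule sum.cong[OF refl])
        fix rs assume "rs \<in> L i"
        then have "l i (map (\<lambda>r. t ^ r *\<^sub>R w v r) rs) = (\<Prod>r\<leftarrow>rs. t ^ r) *\<^sub>R l i (map (w v) rs)"
          by (intro mlin_scale[OF l_mlin subspace_V] w_V0[OF v]) (auto simp: L_def lists_over_def)
        then show "l i (map (\<lambda>r. t ^ r *\<^sub>R w v r) rs) = g i rs" by (simp add: g_def pw)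
      qed
      finally show ?thesis .
    qed
    have low: "(\<Sum>rs\<in>{rs \<in> L i. sum_list rs \<le> m}. g i rs) = (\<Sum>j\<le>m. t ^ j *\<^sub>R (\<Sum>rs\<in>compositions i j. l i (map (w v) rs)))" for i
      unfolding L_def sum_compositions_eq[symmetric] scaleR_sum_right
      by (intro sum.cong refl) (auto simp: g_def compositions_def)
    have split: "(\<Sum>rs\<in>L i. g i rs) = (\<Sum>rs\<in>{rs \<in> L i. sum_list rs \<le> m}. g i rs) + (\<Sum>rs\<in>{rs \<in> L i. \<not> sum_list rs \<le> m}. g i rs)" for i
      using sum.Int_Diff[OF finL, of "g i" i "{rs. sum_list rs \<le> m}"] by (simp add: Int_def set_diff_eq)
    have "(\<Sum>j\<le>m. t ^ j *\<^sub>R Mc v j) = (\<Sum>i\<in>{1..N}. (1 / fact i) *\<^sub>R (\<Sum>rs\<in>{rs \<in> L i. sum_list rs \<le> m}. g i rs))"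
      unfolding low Mc_def scaleR_sum_right by (subst sum.swap) (simp add: mult.commute)
    then have "MC (\<Sum>r\<in>{1..m}. t ^ r *\<^sub>R w v r) - (\<Sum>j\<le>m. t ^ j *\<^sub>R Mc v j)
        = (\<Sum>i\<in>{1..N}. (1 / fact i) *\<^sub>R (\<Sum>rs\<in>{rs \<in> L i. \<not> sum_list rs \<le> m}. g i rs))"
      unfolding MC_def expand split by (simp add: scaleR_add_right sum.distrib)
    also have "norm \<dots> \<le> (\<Sum>i\<in>{1..N}. \<Sum>rs\<in>L i. norm (l i (map (w v) rs)) * t ^ Suc m)"
    proof (rule sum_norm_le)
      fix i
      have "norm ((1 / fact i) *\<^sub>R (\<Sum>rs\<in>{rs \<in> L i. \<not> sum_list rs \<le> m}. g i rs))
          \<le> 1 * norm (\<Sum>rs\<in>{rs \<in> L i. \<not> sum_list rs \<le> m}. g i rs)"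
        unfolding norm_scaleR by (intro mult_right_mono) (auto simp: field_simps fact_ge_1)
      also have "\<dots> \<le> (\<Sum>rs\<in>{rs \<in> L i. \<not> sum_list rs \<le> m}. norm (l i (map (w v) rs)) * t ^ Suc m)"
        unfolding mult_1
      proof (rule sum_norm_le)
        fix rs assume "rs \<in> {rs \<in> L i. \<not> sum_list rs \<le> m}"
        then have "t ^ sum_list rs \<le> t ^ Suc m" using t by (intro power_decreasing) auto
        then show "norm (g i rs) \<le> norm (l i (map (w v) rs)) * t ^ Suc m"
          using t mult_right_mono[of "t ^ sum_list rs" "t ^ Suc m" "norm (l i (map (w v) rs))"]
          by (simp add: g_def mult.commute del: power_Suc)
      qed
      also have "\<dots> \<le> (\<Sum>rs\<in>L i. norm (l i (map (w v) rs)) * t ^ Suc m)"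
        using t by (intro sum_mono2 finL) auto
      finally show "norm ((1 / fact i) *\<^sub>R (\<Sum>rs\<in>{rs \<in> L i. \<not> sum_list rs \<le> m}. g i rs))
          \<le> (\<Sum>rs\<in>L i. norm (l i (map (w v) rs)) * t ^ Suc m)" .
    qed
    finally show ?thesis by (simp add: D_def sum_distrib_right)
  qed
  moreover have "0 \<le> D" unfolding D_def by (intro sum_nonneg) auto
  ultimately show ?thesis by blast
qed

text \<open>Along the polynomial path \<open>x(t) = \<Sum>\<^sub>r t\<^sup>r w\<^sub>r\<close> the Bianchi identity bounds \<open>\<ell>\<^sub>1(MC(x(t)))\<close> by
  \<open>O(t) \<parallel>MC(x(t))\<parallel>\<close>, so the lowest nonvanishing coefficient of \<open>MC(x(t))\<close>, which is fixed by
  \<open>h\<^sub>2 \<ell>\<^sub>1\<close>, must vanish as well. No smallness of \<open>h\<^sub>2\<close> is needed.\<close>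

lemma Mc_zero:
  assumes v: "v \<in> V 0" and v1: "l 1 [v] = 0"
  shows "Mc v m = 0"
proof (induction m rule: less_induct)
  case (less m)
  consider "m = 0" | "m = 1" | "2 \<le> m" by linarith
  then show ?case
  proof cases
    case 1
    then show ?thesis
      using lin_on_zero[OF l1_lin subspace_0[OF subspace_V]] by (simp add: Mc_eq[OF v] F_below_2 w_0)
  next
    case 2
    then show ?thesis using v1 w_1[of v] by (simp add: Mc_eq[OF v] F_below_2)
  next
    case 3
    obtain E \<phi> where "fd_coords (V 2) E \<phi>" using fd_coords_exist[OF fin_dim_V] .
    then interpret C2: fd_coords "V 2" E \<phi> .
    obtain c2 where c2: "0 \<le> c2" "\<And>y. y \<in> V 2 \<Longrightarrow> norm (h2 y) \<le> c2 * norm y"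
      using C2.lin_on_bounded[OF h2_lin] by blast
    obtain E' \<phi>' where "fd_coords (V 1) E' \<phi>'" using fd_coords_exist[OF fin_dim_V] .
    then interpret C1: fd_coords "V 1" E' \<phi>' .
    obtain c1 where c1: "0 \<le> c1" "\<And>y. y \<in> V 1 \<Longrightarrow> norm (l 1 [y]) \<le> c1 * norm y"
      using C1.lin_on_bounded[OF l1_lin] by blast
    define x where "x t = (\<Sum>r\<in>{1..m}. t ^ r *\<^sub>R w v r)" for t :: real
    define X where "X = (\<Sum>r\<in>{1..m}. norm (w v r))"
    have X: "0 \<le> X" unfolding X_def by (intro sum_nonneg) auto
    obtain C where C: "0 \<le> C" "\<And>x. x \<in> V 0 \<Longrightarrow> norm x \<le> X \<Longrightarrow> norm (l 1 [MC x]) \<le> C * norm x * norm (MC x)"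
      using bianchi_bound[OF X] by blast
    obtain D where D: "0 \<le> D" "\<And>t. t \<in> {0..1} \<Longrightarrow> norm (MC (x t) - (\<Sum>j\<le>m. t ^ j *\<^sub>R Mc v j)) \<le> D * t ^ Suc m"
      using MC_poly[OF v, of m] unfolding x_def by blast
    have low: "(\<Sum>j\<le>m. t ^ j *\<^sub>R Mc v j) = t ^ m *\<^sub>R Mc v m" for t :: real
      using less by (simp add: lessThan_Suc_atMost[symmetric])
    \<comment> \<open>The first summand comes from the Bianchi bound with norm (x t) \<le> t X, the
      second from the remainder of order m + 1; after division by t^m both are of order t.\<close>
    define K where "K = c2 * C * X * (norm (Mc v m) + D) + c2 * c1 * D"
    have K: "norm (Mc v m) \<le> K * t" if t: "0 < t" "t \<le> 1" for t
    proof -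
      have xV: "x t \<in> V 0" unfolding x_def by (intro subspace_sum subspace_scale subspace_V w_V0[OF v])
      have "norm (x t) \<le> (\<Sum>r\<in>{1..m}. t * norm (w v r))"
        unfolding x_def
      proof (rule sum_norm_le)
        fix r assume "r \<in> {1..m}"
        then have "t ^ r \<le> t ^ 1" using t by (intro power_decreasing) auto
        then show "norm (t ^ r *\<^sub>R w v r) \<le> t * norm (w v r)" using t by (simp add: mult_right_mono)
      qed
      then have xt: "norm (x t) \<le> t * X" by (simp add: X_def sum_distrib_left)
      then have "norm (x t) \<le> X" using t X mult_left_le_one_le[of X t] by linarith
      note b = C(2)[OF xV this]
      let ?M = "Mc v m"
      have d: "norm (MC (x t) - t ^ m *\<^sub>R ?M) \<le> D * t ^ Suc m" using D(2)[of t] t by (simp add: low)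
      have n: "norm (MC (x t)) \<le> t ^ m * (norm ?M + D)"
      proof -
        have "norm (MC (x t)) \<le> norm (MC (x t) - t ^ m *\<^sub>R ?M) + norm (t ^ m *\<^sub>R ?M)"
          using norm_triangle_ineq[of "MC (x t) - t ^ m *\<^sub>R ?M" "t ^ m *\<^sub>R ?M"] by simp
        also have "\<dots> \<le> D * t ^ m + t ^ m * norm ?M"
        proof (rule add_mono)
          have "D * t ^ Suc m \<le> D * t ^ m" using D(1) t by (intro mult_left_mono power_decreasing) auto
          then show "norm (MC (x t) - t ^ m *\<^sub>R ?M) \<le> D * t ^ m" using d by linarith
        qed (use t in simp)
        finally show ?thesis by (simp add: algebra_simps)
      qed
      have sub: "MC (x t) - t ^ m *\<^sub>R ?M \<in> V 1" "t ^ m *\<^sub>R ?M \<in> V 1"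
        by (auto intro!: subspace_diff subspace_scale subspace_V MC_V1 Mc_V1 xV v)
      have "h2 (l 1 [t ^ m *\<^sub>R ?M]) = h2 (l 1 [MC (x t)]) - h2 (l 1 [MC (x t) - t ^ m *\<^sub>R ?M])"
        using sub MC_V1[OF xV]
        by (simp add: lin_on_diff[OF l1_lin subspace_V, of _ 1] lin_on_diff[OF h2_lin subspace_V] l1_V1 del: One_nat_def)
      moreover have "h2 (l 1 [t ^ m *\<^sub>R ?M]) = t ^ m *\<^sub>R ?M"
        using lin_on_scaleR[OF l1_lin subspace_0[OF subspace_V] Mc_V1[OF v], of "t ^ m" m]
          lin_on_scaleR[OF h2_lin subspace_0[OF subspace_V] l1_V1[OF Mc_V1[OF v]], of "t ^ m" m] Mc_fix[OF v 3] by simp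
      ultimately have "norm (t ^ m *\<^sub>R ?M) \<le> norm (h2 (l 1 [MC (x t)])) + norm (h2 (l 1 [MC (x t) - t ^ m *\<^sub>R ?M]))"
        by (metis norm_triangle_ineq4)
      also have "\<dots> \<le> c2 * (C * (t * X) * (t ^ m * (norm ?M + D))) + c2 * (c1 * (D * t ^ Suc m))"
      proof (rule add_mono)
        have "norm (h2 (l 1 [MC (x t)])) \<le> c2 * norm (l 1 [MC (x t)])" by (intro c2 l1_V1 MC_V1 xV)
        also have "\<dots> \<le> c2 * (C * (t * X) * (t ^ m * (norm ?M + D)))"
          using b C(1) xt n t X D(1) c2(1)
          by (intro mult_left_mono order_trans[OF b] mult_mono) auto
        finally show "norm (h2 (l 1 [MC (x t)])) \<le> c2 * (C * (t * X) * (t ^ m * (norm ?M + D)))" .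
        have "norm (h2 (l 1 [MC (x t) - t ^ m *\<^sub>R ?M])) \<le> c2 * norm (l 1 [MC (x t) - t ^ m *\<^sub>R ?M])"
          by (intro c2 l1_V1 sub)
        also have "\<dots> \<le> c2 * (c1 * norm (MC (x t) - t ^ m *\<^sub>R ?M))"
          by (intro mult_left_mono c1 c2 sub)
        also have "\<dots> \<le> c2 * (c1 * (D * t ^ Suc m))"
          by (intro mult_left_mono c1 c2 d)
        finally show "norm (h2 (l 1 [MC (x t) - t ^ m *\<^sub>R ?M])) \<le> c2 * (c1 * (D * t ^ Suc m))" .
      qed
      also have "\<dots> = t ^ m * (K * t)" by (simp add: K_def algebra_simps)
      finally show ?thesis using t by simp
    qed
    \<comment> \<open>The norm of \<open>Mc v m\<close> does not depend on t, so letting t = 1/(n +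
      1) tend to 0 finishes.\<close>
    have "(\<lambda>n. K * inverse (real (Suc n))) \<longlonglongrightarrow> K * 0"
      by (intro tendsto_intros LIMSEQ_inverse_real_of_nat)
    moreover have "norm (Mc v m) \<le> K * inverse (real (Suc n))" for n
      by (rule K) (auto simp: field_simps)
    ultimately have "norm (Mc v m) \<le> K * 0" by (intro LIMSEQ_le_const) auto
    then show ?thesis by simp
  qed
qed

end

section \<open>Convergence and contraction estimates\<close>

context fd_coords
begin

text \<open>\<open>Sup\<close> is informative only for a set bounded above, so boundedness from
  finite dimension comes first; homogeneity then passes from the unit ball to all of S.\<close>

lemma lin_norm_bound:
  fixes f :: "'a \<Rightarrow> 'b::real_normed_vector"
  assumes f: "lin_on S f"
  shows "0 \<le> lin_norm f S" and "x \<in> S \<Longrightarrow> norm (f x) \<le> lin_norm f S * norm x"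
proof -
  let ?A = "{norm (f x) | x. x \<in> S \<and> norm x \<le> 1}"
  obtain C where C: "0 \<le> C" "\<And>x. x \<in> S \<Longrightarrow> norm (f x) \<le> C * norm x" using lin_on_bounded[OF f] by blast
  have bdd: "bdd_above ?A"
  proof (rule bdd_aboveI[of _ C])
    fix r assume "r \<in> ?A"
    then obtain x where x: "r = norm (f x)" "x \<in> S" "norm x \<le> 1" by blast
    then show "r \<le> C" using C(2)[OF x(2)] mult_left_le[OF x(3) C(1)] by linarith
  qed
  have up: "norm (f x) \<le> lin_norm f S" if "x \<in> S" "norm x \<le> 1" for x
    unfolding lin_norm_def using that by (intro cSup_upper bdd) blast
  show "0 \<le> lin_norm f S" using up[of 0] subspace_0[OF S] norm_ge_zero order_trans by (metis norm_zero zero_le_one)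
  assume x: "x \<in> S"
  \<comment> \<open>For x = 0 the convention \<open>inverse 0 = 0\<close> keeps the scaled vector in
    the unit ball.\<close>
  have "norm (f (inverse (norm x) *\<^sub>R x)) \<le> lin_norm f S"
    using x S by (intro up subspace_scale) (auto simp: field_simps)
  moreover have "norm (f x) = norm (f (inverse (norm x) *\<^sub>R x)) * norm x"
  proof (cases "x = 0")
    case True
    then show ?thesis using lin_on_zero[OF f subspace_0[OF S]] by simp
  next
    case False
    then show ?thesis using lin_on_scaleR[OF f subspace_0[OF S] x, of "inverse (norm x)"] by simp
  qed
  ultimately show "norm (f x) \<le> lin_norm f S * norm x" by (simp add: mult_right_mono)
qed

lemma ml_norm_bound:
  fixes l :: "nat \<Rightarrow> 'a list \<Rightarrow> 'b::real_normed_vector"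
  assumes l: "mlin S k (l k)"
  shows "0 \<le> ml_norm l k S" and "mbound S k (l k) (ml_norm l k S)"
proof -
  let ?A = "{norm (l k xs) | xs. length xs = k \<and> set xs \<subseteq> S \<and> (\<forall>x\<in>set xs. norm x \<le> 1)}"
  obtain C where C: "0 \<le> C" "mbound S k (l k) C" using mlin_bounded[OF l] by blast
  have prod_le: "(\<Prod>x\<leftarrow>xs. norm x) \<le> 1" if "\<forall>x\<in>set xs. norm x \<le> 1" for xs :: "'a list"
    using that by (induction xs) (auto intro!: mult_le_one prod_list_nonneg)
  have bdd: "bdd_above ?A"
  proof (rule bdd_aboveI[of _ C])
    fix r assume "r \<in> ?A"
    then obtain xs where x: "r = norm (l k xs)" "length xs = k" "set xs \<subseteq> S" "\<forall>x\<in>set xs. norm x \<le> 1" by blast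
    then show "r \<le> C" using mboundD[OF C(2) x(2,3)] mult_left_le[OF prod_le[OF x(4)] C(1)] by linarith
  qed
  have up: "norm (l k xs) \<le> ml_norm l k S" if "length xs = k" "set xs \<subseteq> S" "\<forall>x\<in>set xs. norm x \<le> 1" for xs
    unfolding ml_norm_def using that by (intro cSup_upper bdd) blast
  have "norm (l k (replicate k 0)) \<le> ml_norm l k S" using subspace_0[OF S] by (intro up) auto
  then show "0 \<le> ml_norm l k S" using norm_ge_zero order_trans by blast
  show "mbound S k (l k) (ml_norm l k S)"
    unfolding mbound_def
  proof (intro allI impI)
    fix xs assume xs: "length xs = k \<and> set xs \<subseteq> S"
    define e where "e x = inverse (norm x) *\<^sub>R x" for x :: 'a
    have e: "norm x *\<^sub>R e x = x" for x by (cases "x = 0") (auto simp: e_def)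
    have "l k xs = l k (map (\<lambda>x. norm x *\<^sub>R e x) xs)" by (simp add: e)
    also have "\<dots> = (\<Prod>x\<leftarrow>xs. norm x) *\<^sub>R l k (map e xs)"
      using xs S unfolding e_def by (intro mlin_scale[OF l S] subspace_scale) auto
    finally have eq: "l k xs = (\<Prod>x\<leftarrow>xs. norm x) *\<^sub>R l k (map e xs)" .
    have nn: "0 \<le> (\<Prod>x\<leftarrow>xs. norm x)" by (intro prod_list_nonneg) auto
    have "norm (l k xs) = (\<Prod>x\<leftarrow>xs. norm x) * norm (l k (map e xs))"
      using nn by (simp add: eq)
    moreover have "norm (l k (map e xs)) \<le> ml_norm l k S"
      using xs S by (intro up) (auto simp: e_def subset_iff subspace_scale field_simps)
    ultimately show "norm (l k xs) \<le> ml_norm l k S * (\<Prod>x\<leftarrow>xs. norm x)"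
      using mult_left_mono[OF _ nn] by (metis mult.commute)
  qed
qed

text \<open>Expanding the first argument of f at \<open>P x\<close> in coordinates reduces the arity
  by one; the tails are evaluated at elements of E and remain multilinear.\<close>

lemma mlin_polyfun:
  fixes f :: "'a list \<Rightarrow> real"
  assumes "mlin S k f"
  shows "(\<lambda>x. f (replicate k (P x))) \<in> polyfun \<phi> E"
  using assms
proof (induction k arbitrary: f)
  case 0
  then show ?case by (simp add: polyfun.const)
next
  case (Suc k)
  have "f (replicate (Suc k) (P x)) = (\<Sum>b\<in>E. \<phi> b x * f (b # replicate k (P x)))" for x
  proof -
    define xs where "xs = replicate k (P x)"
    have xs: "length xs = k" "set xs \<subseteq> S" using P_in by (auto simp: xs_def)
    note lin = mlin_head[OF Suc.prems xs subspace_0[OF S]]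
    have "f (P x # xs) = (\<Sum>b\<in>E. f (\<phi> b x *\<^sub>R b # xs))"
      unfolding P_def using E_sub S by (intro lin_on_sum[OF lin S]) (auto simp: subspace_scale)
    also have "\<dots> = (\<Sum>b\<in>E. \<phi> b x * f (b # xs))"
      using lin_on_scaleR[OF lin subspace_0[OF S]] E_sub by (intro sum.cong refl) auto
    finally show ?thesis by (simp add: xs_def)
  qed
  moreover have "(\<lambda>x. \<Sum>b\<in>E. \<phi> b x * f (b # replicate k (P x))) \<in> polyfun \<phi> E"
    using E_sub by (intro polyfun_sum polyfun.mult polyfun.coord Suc.IH mlin_tail[OF Suc.prems]) auto
  ultimately show ?case by simp
qed

end

text \<open>Difference quotients along the single ray x + t z with small t suffice. This matters for
  H, whose Lipschitz estimate holds only inside a ball of V_0.\<close>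

lemma derivative_norm_le:
  fixes f :: "'a::real_normed_vector \<Rightarrow> 'b::real_normed_vector"
  assumes f: "(f has_derivative f') (at x)" and d: "0 < d"
    and K: "\<And>t. 0 < t \<Longrightarrow> t < d \<Longrightarrow> norm (f (x + t *\<^sub>R z) - f x) \<le> K * t"
  shows "norm (f' z) \<le> K"
proof (rule field_le_epsilon)
  fix e :: real assume e: "0 < e"
  define e' where "e' = e / (norm z + 1)"
  have z1: "0 < norm z + 1" by (simp add: add_nonneg_pos)
  have e': "0 < e'" "e' * norm z \<le> e" using e z1 by (auto simp: e'_def field_simps)
  obtain r where r: "0 < r" "\<And>y. norm (y - x) < r \<Longrightarrow> norm (f y - f x - f' (y - x)) \<le> e' * norm (y - x)"
    using f e'(1) unfolding has_derivative_at_alt by blast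
  \<comment> \<open>Small enough for both the hypothesis and the remainder estimate; the added 1
    allows z = 0.\<close>
  define t where "t = min (d / 2) (r / 2 / (norm z + 1))"
  have t: "0 < t" "t < d" using d r z1 by (auto simp: t_def)
  have "t * norm z \<le> (r / 2 / (norm z + 1)) * (norm z + 1)"
    using t r z1 by (intro mult_mono) (auto simp: t_def)
  also have "\<dots> = r / 2" using z1 by (intro nonzero_divide_eq_eq[THEN iffD1, symmetric]) auto
  finally have tz: "t * norm z < r" using r by simp
  have "norm (f (x + t *\<^sub>R z) - f x - f' (t *\<^sub>R z)) \<le> e' * (t * norm z)"
    using r(2)[of "x + t *\<^sub>R z"] tz t by simp
  moreover have "f' (t *\<^sub>R z) = t *\<^sub>R f' z"
    using linear_scale[OF has_derivative_linear[OF f]] .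
  ultimately have "norm (t *\<^sub>R f' z) \<le> K * t + e' * (t * norm z)"
    using K[OF t] norm_triangle_sub[of "t *\<^sub>R f' z" "f (x + t *\<^sub>R z) - f x"] by (simp add: norm_minus_commute)
  then have "t * norm (f' z) \<le> t * (K + e' * norm z)" using t by (simp add: algebra_simps)
  then have "norm (f' z) \<le> K + e' * norm z" using t by simp
  then show "norm (f' z) \<le> K + e" using e' by linarith
qed

section \<open>The ball B and the case of vanishing linear bracket on V 0\<close>

context Linf_setting
begin

abbreviation "K \<equiv> {v \<in> V 0. l 1 [v] = 0}"

definition p :: real where "p = lin_norm h1 (V 1) * alpha_l l N V"

lemma B_set_eq: "B_set V l N h1 = K \<inter> {v. norm v * (12 * p) < 1}"
  unfolding B_set_def p_def by (auto simp: mult.assoc)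

lemma openin_B: "openin (top_of_set K) (B_set V l N h1)"
  unfolding B_set_eq by (intro openin_open_Int open_Collect_less continuous_intros)

lemma zero_in_B: "0 \<in> B_set V l N h1"
  using lin_on_zero[OF l1_lin subspace_0[OF subspace_V]] subspace_0[OF subspace_V]
  by (simp add: B_set_eq)

lemma MC_set_eq: "MC_set V l N = {x \<in> V 0. MC x = 0}"
  unfolding MC_set_def MC_def ..

lemma Psi_eq: "Psi l h1 v = (\<Sum>k. w v k)"
  by (simp add: Psi_def psi_def w_def)

text \<open>By induction the inner brackets of lower arity vanish, and the n-th Jacobi identity
  reduces to l_1 (l_n xs) = 0, the only (n, n)-unshuffle being the identity. By H^1 = 0 the value
  l_n xs lies in the image of l_1 on V 0, which is 0.\<close>

lemma l_V0_zero:
  assumes triv: "\<And>x. x \<in> V 0 \<Longrightarrow> l 1 [x] = 0"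
  shows "1 \<le> n \<Longrightarrow> length xs = n \<Longrightarrow> set xs \<subseteq> V 0 \<Longrightarrow> l n xs = 0"
proof (induction n arbitrary: xs rule: less_induct)
  case (less n)
  have \<sigma>_in: "set (map (\<lambda>a. xs ! \<sigma> a) [j..<k]) \<subseteq> V 0" if "\<sigma> \<in> unshuffles i n" "k \<le> n" for \<sigma> i j k
  proof -
    have "\<sigma> a < n" if "a < n" for a
      using \<open>\<sigma> \<in> unshuffles i n\<close> that permutes_in_image[of \<sigma> "{..<n}" a] unfolding unshuffles_def by auto
    then show ?thesis using less.prems \<open>k \<le> n\<close> by (auto simp: subset_iff)
  qed
  have un: "unshuffles n n = {id}"
  proof -
    have "id \<in> unshuffles n n" unfolding unshuffles_def by (auto simp: permutes_id)
    moreover have "card (unshuffles n n) = 1" using card_unshuffles[of n n] by simp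
    ultimately show ?thesis by (metis card_1_singletonE singletonD)
  qed
  have "0 = (\<Sum>i\<in>{1..n}. \<Sum>\<sigma>\<in>unshuffles i n. koszul (replicate n 0) \<sigma> *\<^sub>R l (n - i + 1)
      (l i (map (\<lambda>a. xs ! \<sigma> a) [0..<i]) # map (\<lambda>a. xs ! \<sigma> a) [i..<n]))"
    using l_jacobi[OF less.prems(1,2) homog_0[OF less.prems(2,3)]] by simp
  also have "\<dots> = (\<Sum>i\<in>{n}. \<Sum>\<sigma>\<in>unshuffles i n. koszul (replicate n 0) \<sigma> *\<^sub>R l (n - i + 1)
      (l i (map (\<lambda>a. xs ! \<sigma> a) [0..<i]) # map (\<lambda>a. xs ! \<sigma> a) [i..<n]))"
  proof (intro sum.mono_neutral_right ballI sum.neutral)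
    fix i \<sigma> assume i: "i \<in> {1..n} - {n}" and \<sigma>: "\<sigma> \<in> unshuffles i n"
    have "l i (map (\<lambda>a. xs ! \<sigma> a) [0..<i]) = 0"
      using i \<sigma>_in[OF \<sigma>, of i 0] by (intro less.IH) auto
    moreover have "lin_on (V 1) (\<lambda>z. l (Suc (n - i)) (z # map (\<lambda>a. xs ! \<sigma> a) [i..<n]))"
      by (rule l_head_lin[OF _ \<sigma>_in[OF \<sigma> order_refl]]) simp
    then have "l (Suc (n - i)) (0 # map (\<lambda>a. xs ! \<sigma> a) [i..<n]) = 0"
      by (rule lin_on_zero) (rule subspace_0[OF subspace_V])
    ultimately show "koszul (replicate n 0) \<sigma> *\<^sub>R l (n - i + 1)
      (l i (map (\<lambda>a. xs ! \<sigma> a) [0..<i]) # map (\<lambda>a. xs ! \<sigma> a) [i..<n]) = 0" by simp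
  qed (use less.prems in auto)
  also have "\<dots> = l 1 [l n xs]"
    using koszul_even[of id n n] un less.prems map_nth[of xs] by simp
  finally have "l 1 [l n xs] = 0" by simp
  then show ?case using H1 triv l_V0[OF less.prems(2,3)] by metis
qed

lemma Psi_trivial:
  assumes triv: "\<And>x. x \<in> V 0 \<Longrightarrow> l 1 [x] = 0" and v: "v \<in> V 0"
  shows "w v sums v" "MC v = 0"
proof -
  have "w v k = (if k = 1 then v else 0)" for k
  proof -
    consider "k = 0" | "k = 1" | "2 \<le> k" by linarith
    then show ?thesis
    proof cases
      case 3
      have "F v k = 0"
        unfolding F_def
        using w_V0[OF v] by (intro sum.neutral ballI scaleR_eq_0_iff[THEN iffD2] disjI2 l_V0_zero[OF triv])
          (auto simp: compositions_def)
      then show ?thesis using 3 lin_on_zero[OF h1_lin subspace_0[OF subspace_V]] by (simp add: w_rec[OF v 3])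
    qed (use w_0[of v] w_1[of v] in auto)
  qed
  then have "w v = (\<lambda>k. if k = 1 then v else 0)" by blast
  then show "w v sums v" using sums_single[of 1 "\<lambda>_. v"] by simp
  show "MC v = 0" unfolding MC_def
    using v by (intro sum.neutral ballI scaleR_eq_0_iff[THEN iffD2] disjI2 l_V0_zero[OF triv]) auto
qed

text \<open>Here p may be below 1 and B too large for the convergence estimates. The terms of index
  at least 2 vanish, however, and identity and constants form a class closed under
  derivatives.\<close>

lemma trivial_case:
  assumes triv: "\<And>x. x \<in> V 0 \<Longrightarrow> l 1 [x] = 0"
  shows "(\<forall>v\<in>B_set V l N h1. summable (w v) \<and> Psi l h1 v \<in> MC_set V l N)
    \<and> embedding_on K (B_set V l N h1) (Psi l h1)"
proof -
  let ?B = "B_set V l N h1"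
  have BV: "v \<in> V 0" if "v \<in> ?B" for v using that by (simp add: B_set_eq)
  have id: "Psi l h1 v = v" if "v \<in> ?B" for v
    unfolding Psi_eq using Psi_trivial(1)[OF triv BV[OF that]] by (simp add: sums_iff)
  have "smooth_on K ?B (Psi l h1)"
  proof (rule smooth_on_of_closed_class[where F = "insert (\<lambda>x. x) (range (\<lambda>c _. c))" and g = "\<lambda>x. x"])
    fix f :: "'a \<Rightarrow> 'a" assume "f \<in> insert (\<lambda>x. x) (range (\<lambda>c _. c))"
    then consider "f = (\<lambda>x. x)" | c where "f = (\<lambda>_. c)" by blast
    then show "\<exists>f'. (\<forall>x\<in>?B. (f has_derivative f' x) (at x within ?B)) \<and>
        (\<forall>h\<in>K. (\<lambda>x. f' x h) \<in> insert (\<lambda>x. x) (range (\<lambda>c _. c)))"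
    proof cases
      case 1
      then show ?thesis by (intro exI[of _ "\<lambda>_ h. h"]) auto
    next
      case 2
      then show ?thesis by (intro exI[of _ "\<lambda>_ _. 0"]) auto
    qed
  qed (use id in auto)
  moreover have "(Psi l h1 has_derivative (\<lambda>h. h)) (at x within ?B)" if "x \<in> ?B" for x
    by (rule has_derivative_transform[OF that _ has_derivative_ident]) (simp add: id)
  moreover have "homeomorphism ?B (Psi l h1 ` ?B) (Psi l h1) (\<lambda>x. x)"
  proof -
    have "Psi l h1 ` ?B = ?B" using id by force
    moreover have "continuous_on ?B (Psi l h1)"
      by (rule continuous_on_eq[OF continuous_on_id]) (simp add: id)
    ultimately show ?thesis unfolding homeomorphism_def using id by auto
  qed
  ultimately have "embedding_on K ?B (Psi l h1)"
    unfolding embedding_on_def by (intro conjI ballI) (auto intro!: exI[of _ "\<lambda>h. h"])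
  moreover have "summable (w v)" "Psi l h1 v \<in> MC_set V l N" if "v \<in> ?B" for v
    using Psi_trivial[OF triv BV[OF that]] id[OF that] BV[OF that] by (auto simp: MC_set_eq sums_iff)
  ultimately show ?thesis by simp
qed

section \<open>Majorant series, the equation for Psi and contraction estimates\<close>

definition H :: "'a \<Rightarrow> 'a" where
  "H x = (\<Sum>i\<in>{2..N}. (1 / fact i) *\<^sub>R h1 (l i (replicate i x)))"

lemma h1l_mlin: "mlin (V 0) i (\<lambda>xs. h1 (l i xs))"
  by (rule mlin_compose[OF l_mlin h1_lin l_V0])

lemma H_V0: "x \<in> V 0 \<Longrightarrow> H x \<in> V 0"
proof -
  assume "x \<in> V 0"
  then have "l i (replicate i x) \<in> V 1" for i by (intro l_V0) auto
  then show ?thesis unfolding H_def using h1_map by (intro subspace_sum subspace_scale subspace_V) blast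
qed

lemma lin_norm_h1: "0 \<le> lin_norm h1 (V 1)" "y \<in> V 1 \<Longrightarrow> norm (h1 y) \<le> lin_norm h1 (V 1) * norm y"
proof -
  obtain E \<phi> where "fd_coords (V 1) E \<phi>" using fd_coords_exist[OF fin_dim_V] .
  then interpret fd_coords "V 1" E \<phi> .
  show "0 \<le> lin_norm h1 (V 1)" "y \<in> V 1 \<Longrightarrow> norm (h1 y) \<le> lin_norm h1 (V 1) * norm y"
    using lin_norm_bound[OF h1_lin] by blast+
qed

lemma ml_norm_l: "0 \<le> ml_norm l k (V 0)" "mbound (V 0) k (l k) (ml_norm l k (V 0))"
proof -
  obtain E \<phi> where "fd_coords (V 0) E \<phi>" using fd_coords_exist[OF fin_dim_V] .
  then interpret fd_coords "V 0" E \<phi> .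
  show "0 \<le> ml_norm l k (V 0)" "mbound (V 0) k (l k) (ml_norm l k (V 0))"
    using ml_norm_bound[of k l, OF l_mlin] by blast+
qed

text \<open>A bound for the i-linear term of H, used both as coefficient of the majorant and in the
  Lipschitz estimate.\<close>

definition b :: "nat \<Rightarrow> real" where "b i = lin_norm h1 (V 1) * ml_norm l i (V 0) / fact i"

lemma b_nonneg: "0 \<le> b i"
  unfolding b_def by (intro divide_nonneg_nonneg mult_nonneg_nonneg lin_norm_h1 ml_norm_l) simp

lemma sum_b_le: "(\<Sum>i\<in>{2..N}. b i) \<le> p"
proof -
  have "(\<Sum>i\<in>{2..N}. b i) \<le> (\<Sum>i\<in>{1..N}. b i)"
    using b_nonneg by (intro sum_mono2) auto
  also have "\<dots> = p" unfolding p_def alpha_l_def b_def by (simp add: sum_distrib_left)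
  finally show ?thesis .
qed

lemma h1l_mbound: "mbound (V 0) i (\<lambda>xs. h1 (l i xs)) (lin_norm h1 (V 1) * ml_norm l i (V 0))"
  by (rule mbound_compose[OF ml_norm_l(2) lin_norm_h1(2,1) l_V0])

text \<open>Since \<open>\<ell>\<^sub>1 h\<^sub>1 \<ell>\<^sub>1 = \<ell>\<^sub>1\<close> on \<open>V\<^sub>0\<close>, a nonzero \<open>\<ell>\<^sub>1\<close> forces \<open>\<parallel>h\<^sub>1\<parallel> \<parallel>\<ell>\<^sub>1\<parallel> \<ge> 1\<close>.\<close>

lemma p_ge_1:
  assumes x: "x \<in> V 0" and nz: "l 1 [x] \<noteq> 0"
  shows "1 \<le> p"
proof -
  define y where "y = l 1 [x]"
  have y: "y \<in> V 1" "l 1 [y] = 0" "y \<noteq> 0" using x nz l1_V0 l1_l1 by (auto simp: y_def)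
  have h1y: "h1 y \<in> V 0" using y h1_map by blast
  have "N > 1" using l_zero0[of 1 "[x]"] x nz by (cases "N \<le> 1") auto
  have "l 1 [h1 y] = y"
    using homotopy y lin_on_zero[OF h2_lin subspace_0[OF subspace_V]] by force
  then have "norm y \<le> ml_norm l 1 (V 0) * norm (h1 y)"
    using mboundD[OF ml_norm_l(2)[of 1], of "[h1 y]"] h1y by simp
  also have "\<dots> \<le> ml_norm l 1 (V 0) * (lin_norm h1 (V 1) * norm y)"
    by (intro mult_left_mono lin_norm_h1 ml_norm_l y)
  finally have "1 * norm y \<le> (ml_norm l 1 (V 0) * lin_norm h1 (V 1)) * norm y" by simp
  then have "1 \<le> ml_norm l 1 (V 0) * lin_norm h1 (V 1)"
    using y(3) by (simp only: mult_le_cancel_right) auto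
  also have "\<dots> \<le> alpha_l l N V * lin_norm h1 (V 1)"
  proof (intro mult_right_mono lin_norm_h1)
    have "ml_norm l 1 (V 0) = (\<Sum>i\<in>{1}. ml_norm l i (V 0) / fact i)" by simp
    also have "\<dots> \<le> alpha_l l N V"
      unfolding alpha_l_def using \<open>N > 1\<close> ml_norm_l(1) by (intro sum_mono2) auto
    finally show "ml_norm l 1 (V 0) \<le> alpha_l l N V" .
  qed
  finally show ?thesis by (simp add: p_def mult.commute)
qed

lemma h1_F: "v \<in> V 0 \<Longrightarrow> h1 (F v m) = (\<Sum>i\<in>{2..N}. (1 / fact i) *\<^sub>R (\<Sum>rs\<in>compositions i m. h1 (l i (map (w v) rs))))"
proof -
  assume v: "v \<in> V 0"
  have s: "(\<Sum>rs\<in>compositions i m. l i (map (w v) rs)) \<in> V 1" for i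
    by (intro subspace_sum subspace_V l_w_V1[OF v])
  have "h1 (F v m) = (\<Sum>i\<in>{2..N}. h1 ((1 / fact i) *\<^sub>R (\<Sum>rs\<in>compositions i m. l i (map (w v) rs))))"
    unfolding F_def by (intro lin_on_sum[OF h1_lin subspace_V] subspace_scale[OF subspace_V] s)
  also have "\<dots> = (\<Sum>i\<in>{2..N}. (1 / fact i) *\<^sub>R h1 (\<Sum>rs\<in>compositions i m. l i (map (w v) rs)))"
    by (intro sum.cong refl lin_on_scaleR[OF h1_lin subspace_0[OF subspace_V]] s)
  also have "\<dots> = (\<Sum>i\<in>{2..N}. (1 / fact i) *\<^sub>R (\<Sum>rs\<in>compositions i m. h1 (l i (map (w v) rs))))"
    by (intro sum.cong refl arg_cong2[of _ _ _ _ scaleR] lin_on_sum[OF h1_lin subspace_V] l_w_V1[OF v])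
  finally show ?thesis .
qed

lemma w_norm_rec:
  assumes v: "v \<in> V 0" and m: "2 \<le> m"
  shows "norm (w v m) \<le> (\<Sum>i\<in>{2..N}. b i * (\<Sum>rs\<in>compositions i m. \<Prod>r\<leftarrow>rs. norm (w v r)))"
proof -
  have "norm (w v m) = norm (\<Sum>i\<in>{2..N}. (1 / fact i) *\<^sub>R (\<Sum>rs\<in>compositions i m. h1 (l i (map (w v) rs))))"
    by (simp only: w_rec[OF v m] norm_minus_cancel h1_F[OF v])
  also have "\<dots> \<le> (\<Sum>i\<in>{2..N}. b i * (\<Sum>rs\<in>compositions i m. \<Prod>r\<leftarrow>rs. norm (w v r)))"
  proof (rule sum_norm_le)
    fix i
    let ?c = "lin_norm h1 (V 1) * ml_norm l i (V 0)"
    have "norm (\<Sum>rs\<in>compositions i m. h1 (l i (map (w v) rs))) \<le> (\<Sum>rs\<in>compositions i m. ?c * (\<Prod>r\<leftarrow>rs. norm (w v r)))"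
    proof (rule sum_norm_le)
      fix rs assume "rs \<in> compositions i m"
      then have "norm (h1 (l i (map (w v) rs))) \<le> ?c * (\<Prod>x\<leftarrow>map (w v) rs. norm x)"
        using w_V0[OF v] by (intro mboundD[OF h1l_mbound]) (auto simp: compositions_def)
      then show "norm (h1 (l i (map (w v) rs))) \<le> ?c * (\<Prod>r\<leftarrow>rs. norm (w v r))" by (simp add: o_def)
    qed
    then have "(1 / fact i) * norm (\<Sum>rs\<in>compositions i m. h1 (l i (map (w v) rs)))
        \<le> (1 / fact i) * (\<Sum>rs\<in>compositions i m. ?c * (\<Prod>r\<leftarrow>rs. norm (w v r)))"
      by (intro mult_left_mono) auto
    also have "\<dots> = b i * (\<Sum>rs\<in>compositions i m. \<Prod>r\<leftarrow>rs. norm (w v r))"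
      by (simp add: b_def sum_distrib_left[symmetric])
    finally show "norm ((1 / fact i) *\<^sub>R (\<Sum>rs\<in>compositions i m. h1 (l i (map (w v) rs))))
      \<le> b i * (\<Sum>rs\<in>compositions i m. \<Prod>r\<leftarrow>rs. norm (w v r))" by simp
  qed
  finally show ?thesis .
qed

text \<open>The majorant bounds the partial sums of norms by R. Coordinates turn this into
  convergence, and closedness of V 0 keeps the limit there.\<close>

lemma w_series:
  assumes p1: "1 \<le> p" and v: "v \<in> V 0" and small: "norm v * (12 * p) < 1"
  shows "summable (\<lambda>k. norm (w v k))" and "w v sums Psi l h1 v"
    and "Psi l h1 v \<in> V 0" and "norm (Psi l h1 v) \<le> 1 / (6 * p)"
proof -
  \<comment> \<open>Twice the radius of B. Since R \<le> 1, all powers in the majorant are at most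
    R^2, and its condition becomes 1/(12 p) + p R^2 = 1/(12 p) + 1/(36 p) = 1/(9 p) \<le> R.\<close>
  define R where "R = 1 / (6 * p)"
  have R: "0 \<le> R" "R \<le> 1" using p1 by (auto simp: R_def field_simps)
  have part: "(\<Sum>r\<in>{1..n}. norm (w v r)) \<le> R" for n
  proof (rule majorant_bound)
    have "(\<Sum>i\<in>{2..N}. b i * R ^ i) \<le> (\<Sum>i\<in>{2..N}. b i * R ^ 2)"
      using R b_nonneg by (intro sum_mono mult_left_mono power_decreasing) auto
    also have "\<dots> \<le> p * R ^ 2"
      unfolding sum_distrib_right[symmetric] by (intro mult_right_mono sum_b_le) simp
    also have "\<dots> = 1 / (36 * p)" using p1 by (simp add: R_def power2_eq_square field_simps)
    finally have "(\<Sum>i\<in>{2..N}. b i * R ^ i) \<le> 1 / (36 * p)" .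
    moreover have "norm (w v 1) \<le> 1 / (12 * p)" using small p1 unfolding w_1 by (simp add: field_simps)
    moreover have "1 / (12 * p) + 1 / (36 * p) \<le> R" using p1 by (simp add: R_def field_simps)
    ultimately show "norm (w v 1) + (\<Sum>i\<in>{2..N}. b i * R ^ i) \<le> R" by linarith
  qed (use b_nonneg w_norm_rec[OF v] R in auto)
  have part': "(\<Sum>r<n. norm (w v r)) \<le> R" for n
  proof -
    have "(\<Sum>r<n. norm (w v r)) \<le> (\<Sum>r\<in>insert 0 {1..n}. norm (w v r))" by (intro sum_mono2) auto
    then show ?thesis using part[of n] by (simp add: w_0)
  qed
  show sn: "summable (\<lambda>k. norm (w v k))" by (rule summableI_nonneg_bounded[of _ R]) (use part' in auto)
  obtain E \<phi> where "fd_coords (V 0) E \<phi>" using fd_coords_exist[OF fin_dim_V] .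
  then interpret fd_coords "V 0" E \<phi> .
  have "summable (w v)" by (rule summable_S[OF w_V0[OF v] sn])
  then show s: "w v sums Psi l h1 v" unfolding Psi_eq by (rule summable_sums)
  show "Psi l h1 v \<in> V 0"
    by (rule closed_sequentially[OF closed_S _ s[unfolded sums_def]])
      (intro subspace_sum subspace_V w_V0[OF v])
  have "norm (\<Sum>r<n. w v r) \<le> R" for n using norm_sum[of "w v" "{..<n}"] part'[of n] by linarith
  then show "norm (Psi l h1 v) \<le> 1 / (6 * p)"
    unfolding R_def[symmetric] by (intro LIMSEQ_le_const2[OF tendsto_norm[OF s[unfolded sums_def]]]) auto
qed

text \<open>The recursion says that w_m + h1 F_m is v for m = 1 and 0 otherwise; the Cauchy product
  theorem identifies the sum of the h1 F_m with H at the limit.\<close>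

lemma Psi_equation:
  assumes p1: "1 \<le> p" and v: "v \<in> V 0" and small: "norm v * (12 * p) < 1"
  shows "Psi l h1 v + H (Psi l h1 v) = v"
proof -
  note ws = w_series[OF p1 v small]
  have "(\<lambda>m. \<Sum>i\<in>{2..N}. (1 / fact i) *\<^sub>R (\<Sum>rs\<in>compositions i m. h1 (l i (map (w v) rs)))) sums H (Psi l h1 v)"
    unfolding H_def
  proof (intro sums_sum sums_scaleR_right)
    fix i assume "i \<in> {2..N}"
    then show "(\<lambda>m. \<Sum>rs\<in>compositions i m. h1 (l i (map (w v) rs))) sums h1 (l i (replicate i (Psi l h1 v)))"
      by (intro cauchy_product_sums[OF h1l_mlin h1l_mbound _ subspace_V w_V0[OF v] w_0 _ ws(1,2,3)]
          mult_nonneg_nonneg lin_norm_h1 ml_norm_l) auto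
  qed
  then have "(\<lambda>m. h1 (F v m)) sums H (Psi l h1 v)" by (simp only: h1_F[OF v])
  then have "(\<lambda>m. w v m + h1 (F v m)) sums (Psi l h1 v + H (Psi l h1 v))" by (rule sums_add[OF ws(2)])
  moreover have "w v m + h1 (F v m) = (if m = 1 then v else 0)" for m
  proof (cases "2 \<le> m")
    case False
    then have "m = 0 \<or> m = 1" by linarith
    moreover have "h1 0 = 0" by (rule lin_on_zero[OF h1_lin subspace_0[OF subspace_V]])
    ultimately show ?thesis using w_1[of v] False by (auto simp: F_below_2 w_0)
  qed (simp add: w_rec[OF v])
  ultimately have "(\<lambda>m. if m = 1 then v else 0) sums (Psi l h1 v + H (Psi l h1 v))" by simp
  then show ?thesis using sums_single[of 1 "\<lambda>_. v"] sums_unique2 by blast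
qed

text \<open>By absolute convergence MC of the limit is the sum of its formal coefficients, all of
  which are 0.\<close>

lemma Psi_MC:
  assumes p1: "1 \<le> p" and v: "v \<in> V 0" "l 1 [v] = 0" and small: "norm v * (12 * p) < 1"
  shows "MC (Psi l h1 v) = 0"
proof -
  note ws = w_series[OF p1 v(1) small]
  have "(\<lambda>m. Mc v m) sums MC (Psi l h1 v)"
    unfolding Mc_def MC_def
  proof (intro sums_sum sums_scaleR_right)
    fix i assume "i \<in> {1..N}"
    then show "(\<lambda>m. \<Sum>rs\<in>compositions i m. l i (map (w v) rs)) sums l i (replicate i (Psi l h1 v))"
      by (intro cauchy_product_sums[OF l_mlin ml_norm_l(2,1) subspace_V w_V0[OF v(1)] w_0 _ ws(1,2,3)]) auto
  qed
  then have "(\<lambda>m. 0) sums MC (Psi l h1 v)" by (simp add: Mc_zero[OF v])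
  then show ?thesis using sums_unique2[OF sums_zero] by metis
qed

lemma H_lipschitz:
  assumes p1: "1 \<le> p" and xy: "x \<in> V 0" "y \<in> V 0" "norm x \<le> 1 / (4 * p)" "norm y \<le> 1 / (4 * p)"
  shows "norm (H x - H y) \<le> norm (x - y) / 2"
proof -
  \<comment> \<open>Chosen so that the Lipschitz constant 2 p R obtained at the end is 1/2.\<close>
  define R where "R = 1 / (4 * p)"
  have R: "0 \<le> R" "R \<le> 1 / 4" using p1 by (auto simp: R_def field_simps)
  \<comment> \<open>Equality at i = 2; from i to i + 1 the left side is multiplied by at most 2 R,
    and 2 R \<le> 1.\<close>
  have pow: "real i * R ^ (i - 1) \<le> 2 * R" if "2 \<le> i" for i
    using that
  proof (induction i rule: nat_induct_at_least)
    case (Suc i)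
    have i: "R ^ i = R * R ^ (i - 1)" using Suc.hyps by (metis One_nat_def Suc_diff_le Suc_le_lessD diff_Suc_1 power_Suc Suc_1 Suc_leD)
    have "real (Suc i) * R ^ i \<le> (2 * real i) * R ^ i" using Suc.hyps R by (intro mult_right_mono) auto
    also have "\<dots> = 2 * R * (real i * R ^ (i - 1))" by (simp add: i)
    also have "\<dots> \<le> 1 * (real i * R ^ (i - 1))" using R by (intro mult_right_mono) auto
    finally show ?case using Suc.IH by simp
  qed simp
  have "H x - H y = (\<Sum>i\<in>{2..N}. (1 / fact i) *\<^sub>R (h1 (l i (replicate i x)) - h1 (l i (replicate i y))))"
    by (simp add: H_def sum_subtractf scaleR_diff_right)
  also have "norm \<dots> \<le> (\<Sum>i\<in>{2..N}. b i * (2 * R) * norm (x - y))"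
  proof (rule sum_norm_le)
    fix i assume i: "i \<in> {2..N}"
    let ?c = "lin_norm h1 (V 1) * ml_norm l i (V 0)"
    have c: "0 \<le> ?c" by (intro mult_nonneg_nonneg lin_norm_h1 ml_norm_l)
    have "norm (h1 (l i (replicate i x)) - h1 (l i (replicate i y))) \<le> ?c * (real i * R ^ (i - 1)) * norm (x - y)"
      using xy unfolding R_def by (intro mlin_replicate_diff[OF h1l_mlin h1l_mbound c subspace_V])
    also have "\<dots> \<le> ?c * (2 * R) * norm (x - y)"
      using i by (intro mult_right_mono mult_left_mono pow c) auto
    finally have "(1 / fact i) * norm (h1 (l i (replicate i x)) - h1 (l i (replicate i y))) \<le> (1 / fact i) * (?c * (2 * R) * norm (x - y))"
      by (intro mult_left_mono) auto
    then show "norm ((1 / fact i) *\<^sub>R (h1 (l i (replicate i x)) - h1 (l i (replicate i y)))) \<le> b i * (2 * R) * norm (x - y)"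
      by (simp add: b_def)
  qed
  also have "\<dots> \<le> p * (2 * R) * norm (x - y)"
    unfolding sum_distrib_right[symmetric] using R by (intro mult_right_mono sum_b_le) auto
  also have "\<dots> = norm (x - y) / 2" using p1 by (simp add: R_def)
  finally show ?thesis .
qed

text \<open>Subtracting the two equations x + H x = u and y + H y = v, the term H x - H y costs half
  of norm (x - y), which is absorbed on the left.\<close>

lemma Psi_lipschitz:
  assumes p1: "1 \<le> p" and u: "u \<in> V 0" "norm u * (12 * p) < 1" and v: "v \<in> V 0" "norm v * (12 * p) < 1"
  shows "norm (Psi l h1 u - Psi l h1 v) \<le> 2 * norm (u - v)"
proof -
  have q: "1 / (6 * p) \<le> 1 / (4 * p)" using p1 by (intro divide_left_mono) auto
  let ?x = "Psi l h1 u" and ?y = "Psi l h1 v"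
  have "norm (H ?x - H ?y) \<le> norm (?x - ?y) / 2"
    using w_series(3,4)[OF p1 u] w_series(3,4)[OF p1 v] q by (intro H_lipschitz[OF p1]) auto
  moreover have "?x - ?y = (u - v) - (H ?x - H ?y)"
    using Psi_equation[OF p1 u] Psi_equation[OF p1 v] by (simp add: algebra_simps)
  then have "norm (?x - ?y) \<le> norm (u - v) + norm (H ?x - H ?y)" by (metis norm_triangle_ineq4)
  ultimately show ?thesis by simp
qed

end

section \<open>Smoothness and embedding when the linear bracket on V 0 is nonzero\<close>

context Linf_setting
begin

lemma nontrivial_case:
  assumes p1: "1 \<le> p"
  shows "(\<forall>v\<in>B_set V l N h1. summable (w v) \<and> Psi l h1 v \<in> MC_set V l N)
    \<and> embedding_on K (B_set V l N h1) (Psi l h1)"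
proof -
  let ?B = "B_set V l N h1"
  have B: "v \<in> V 0" "l 1 [v] = 0" "norm v * (12 * p) < 1" if "v \<in> ?B" for v
    using that by (auto simp: B_set_eq)
  obtain E \<phi> where "fd_coords (V 0) E \<phi>" using fd_coords_exist[OF fin_dim_V] .
  then interpret fd_coords "V 0" E \<phi> .
  interpret P: bounded_linear P by (rule P_bl)
  \<comment> \<open>The coordinates of H o P: polynomials on the ambient space that agree on V 0
    with the coordinates of H.\<close>
  define q where "q c x = \<phi> c (H (P x))" for c x
  have HP: "H (P x) = (\<Sum>c\<in>E. q c x *\<^sub>R c)" for x
    unfolding q_def using \<phi>_expand[OF H_V0[OF P_in]] by simp
  have q_poly: "q c \<in> polyfun \<phi> E" if c: "c \<in> E" for c
  proof -
    interpret \<phi>: bounded_linear "\<phi> c" by (rule \<phi>_bl[OF c])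
    have "mlin (V 0) i (\<lambda>xs. \<phi> c (h1 (l i xs)))" for i
      by (rule mlin_compose[OF h1l_mlin, of UNIV]) (auto simp: lin_on_def \<phi>.add \<phi>.scaleR)
    then have "(\<lambda>x. \<Sum>i\<in>{2..N}. (1 / fact i) * \<phi> c (h1 (l i (replicate i (P x))))) \<in> polyfun \<phi> E"
      by (intro polyfun_sum polyfun.mult polyfun.const mlin_polyfun)
    moreover have "q c = (\<lambda>x. \<Sum>i\<in>{2..N}. (1 / fact i) * \<phi> c (h1 (l i (replicate i (P x)))))"
      unfolding q_def H_def by (simp add: \<phi>.sum \<phi>.scaleR)
    ultimately show ?thesis by simp
  qed
  have "\<forall>c\<in>E. \<exists>d. (\<forall>e\<in>E. d e \<in> polyfun \<phi> E) \<and> (\<forall>x. (q c has_derivative (\<lambda>h. \<Sum>e\<in>E. \<phi> e h * d e x)) (at x))"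
    using polyfun_derivative[OF q_poly] by blast
  from bchoice[OF this] obtain dq where dq: "\<And>c e. c \<in> E \<Longrightarrow> e \<in> E \<Longrightarrow> dq c e \<in> polyfun \<phi> E"
    "\<And>c x. c \<in> E \<Longrightarrow> (q c has_derivative (\<lambda>h. \<Sum>e\<in>E. \<phi> e h * dq c e x)) (at x)"
    by blast
  have HP_deriv: "((\<lambda>x. H (P x)) has_derivative (\<lambda>h. \<Sum>c\<in>E. (\<Sum>e\<in>E. \<phi> e h * dq c e x) *\<^sub>R c)) (at x)" for x
    unfolding HP by (intro has_derivative_sum has_derivative_scaleR_left dq(2))
  define T where "T = {v. norm (P v) * (12 * p) < 1}"
  \<comment> \<open>An extension of \<open>Psi\<close> to an open subset of the ambient space, still inverse to \<open>x \<mapsto> x + H (P x)\<close>.\<close>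
  define \<Psi> where "\<Psi> v = Psi l h1 (P v) + (v - P v)" for v
  have BT: "?B \<subseteq> T" using B P_id by (auto simp: T_def)
  have \<Psi>_B: "Psi l h1 v = \<Psi> v" if "v \<in> ?B" for v using B(1)[OF that] by (simp add: \<Psi>_def P_id)
  \<comment> \<open>P annihilates v - P v and fixes the values of Psi, so the correction is
    invisible to H o P.\<close>
  have P\<Psi>: "P (\<Psi> v) = Psi l h1 (P v)" if "v \<in> T" for v
    using w_series(3)[OF p1 P_in, of v] that by (simp add: \<Psi>_def T_def P.add P.diff P_id P_in)
  have P_cont: "continuous_on A P" for A by (rule linear_continuous_on[OF P_bl])
  interpret SI: smooth_inverse "V 0" E \<phi> q dq \<Psi> T
  proof (unfold_locales)
    show "open T" unfolding T_def
      by (intro open_Collect_less continuous_intros P_cont)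
    have "2-lipschitz_on {v \<in> V 0. norm v * (12 * p) < 1} (Psi l h1)"
      using Psi_lipschitz[OF p1] by (intro lipschitz_onI) (auto simp: dist_norm)
    then have "continuous_on T (\<lambda>v. Psi l h1 (P v))"
      by (rule continuous_on_compose2[OF lipschitz_on_continuous_on P_cont]) (auto simp: T_def P_in)
    then show "continuous_on T \<Psi>"
      unfolding \<Psi>_def [abs_def] by (intro continuous_on_add continuous_on_diff continuous_on_id P_cont)
    show "\<Psi> v + (\<Sum>c\<in>E. q c (\<Psi> v) *\<^sub>R c) = v" if v: "v \<in> T" for v
      using Psi_equation[OF p1 P_in, of v] v
      by (simp add: HP[symmetric] P\<Psi>[OF v]) (simp add: \<Psi>_def T_def algebra_simps)
    show "norm (\<Sum>c\<in>E. (\<Sum>e\<in>E. \<phi> e z * dq c e (\<Psi> v)) *\<^sub>R c) \<le> norm z / 2" if v: "v \<in> T" and z: "z \<in> V 0" for v z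
    proof (rule derivative_norm_le[OF HP_deriv])
      \<comment> \<open>For t < d the step t z has length at most the gap between 1/(6 p) and 1/(4
        p), so both points stay in the ball where H contracts.\<close>
      define d where "d = (1 / (4 * p) - 1 / (6 * p)) / (norm z + 1)"
      have z1: "0 < norm z + 1" by (simp add: add_nonneg_pos)
      show "0 < d" unfolding d_def using z1 p1 by (intro divide_pos_pos) (auto simp: field_simps)
      fix t :: real assume t: "0 < t" "t < d"
      let ?x = "Psi l h1 (P v)"
      have x: "?x \<in> V 0" "norm ?x \<le> 1 / (6 * p)"
        using w_series(3,4)[OF p1 P_in, of v] v by (auto simp: T_def)
      have "t * norm z \<le> d * (norm z + 1)" using t z1 by (intro mult_mono) auto
      also have "\<dots> = 1 / (4 * p) - 1 / (6 * p)" using z1 unfolding d_def by simp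
      finally have tz: "t * norm z \<le> 1 / (4 * p) - 1 / (6 * p)" .
      have t0: "0 \<le> t * norm z" using t by simp
      have "norm (?x + t *\<^sub>R z) \<le> norm ?x + t * norm z"
        using norm_triangle_ineq[of ?x "t *\<^sub>R z"] t by simp
      then have n: "norm (?x + t *\<^sub>R z) \<le> 1 / (4 * p)" "norm ?x \<le> 1 / (4 * p)"
        using t0 tz x(2) by linarith+
      have "norm (H (?x + t *\<^sub>R z) - H ?x) \<le> norm ((?x + t *\<^sub>R z) - ?x) / 2"
        using n x z subspace_V by (intro H_lipschitz[OF p1]) (auto simp: subspace_add subspace_scale)
      then show "norm (H (P (\<Psi> v + t *\<^sub>R z)) - H (P (\<Psi> v))) \<le> norm z / 2 * t"
        using t by (simp add: P.add P.scaleR P\<Psi>[OF v] P_id[OF z] mult.commute)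
    qed
  qed (use dq in auto)
  have "smooth_on K ?B (Psi l h1)"
  proof (rule SI.smooth_\<Psi>[OF BT])
    show "\<Psi> v \<in> V 0" if "v \<in> ?B" for v
      using w_series(3)[OF p1 B(1,3)[OF that]] \<Psi>_B[OF that] by simp
  qed (use \<Psi>_B in auto)
  moreover have "(Psi l h1 has_derivative SI.Q v) (at v within ?B)" "inj_on (SI.Q v) K" if v: "v \<in> ?B" for v
  proof -
    have vT: "v \<in> T" using v BT by blast
    show "(Psi l h1 has_derivative SI.Q v) (at v within ?B)"
      by (rule has_derivative_transform[OF v \<Psi>_B has_derivative_at_withinI[OF SI.\<Psi>_deriv[OF vT]]])
    show "inj_on (SI.Q v) K" using SI.inj_Q[OF vT] by (rule inj_on_subset) simp
  qed
  moreover have "homeomorphism ?B (Psi l h1 ` ?B) (Psi l h1) (\<lambda>x. x + H (P x))"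
  proof -
    have inv: "Psi l h1 v + H (P (Psi l h1 v)) = v" if v: "v \<in> ?B" for v
      using Psi_equation[OF p1 B(1,3)[OF v]] w_series(3)[OF p1 B(1,3)[OF v]] by (simp add: P_id)
    have "continuous_on ?B (Psi l h1)"
      using continuous_on_subset[OF SI.\<Psi>_cont BT] by (rule continuous_on_eq) (simp add: \<Psi>_B)
    \<comment> \<open>The inverse is the restriction of a differentiable map of the ambient space,
      so its continuity does not refer to the topology of the image.\<close>
    moreover have "continuous_on (Psi l h1 ` ?B) (\<lambda>x. x + H (P x))"
      by (intro continuous_intros has_derivative_continuous_on[of _ "\<lambda>x. H (P x)"])
        (rule has_derivative_at_withinI[OF HP_deriv])
    moreover have "(\<lambda>x. x + H (P x)) ` Psi l h1 ` ?B = ?B" using inv by (force simp: image_iff)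
    ultimately show ?thesis unfolding homeomorphism_def using inv by auto
  qed
  ultimately have "embedding_on K ?B (Psi l h1)"
    unfolding embedding_on_def by blast
  moreover have "summable (w v)" "Psi l h1 v \<in> MC_set V l N" if v: "v \<in> ?B" for v
    using w_series(2,3)[OF p1 B(1,3)[OF v]] Psi_MC[OF p1 B[OF v]] by (auto simp: MC_set_eq sums_iff)
  ultimately show ?thesis by simp
qed

end

text \<open>Summability is part of the conclusion because \<open>psi\<close> is a
  \<open>suminf\<close>, whose value is meaningful only for a convergent series.\<close>

theorem theorem5p18:
  fixes V :: "int \<Rightarrow> 'a::real_normed_vector set"
    and l :: "nat \<Rightarrow> 'a list \<Rightarrow> 'a"
    and N :: nat
    and h1 h2 :: "'a \<Rightarrow> 'a"
  assumes Linf: "strict_Linf V l N"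
    and H1: "\<forall>x\<in>V 1. l 1 [x] = 0 \<longrightarrow> (\<exists>y\<in>V 0. l 1 [y] = x)"
    and h1_lin: "lin_on (V 1) h1" and h1_map: "h1 ` V 1 \<subseteq> V 0"
    and h2_lin: "lin_on (V 2) h2" and h2_map: "h2 ` V 2 \<subseteq> V 1"
    and homotopy: "\<forall>x\<in>V 1. l 1 [h1 x] + h2 (l 1 [x]) = x"
  shows "(\<forall>v\<in>B_set V l N h1. summable (\<lambda>k. (1 / fact k) *\<^sub>R vseq l h1 v k)
              \<and> Psi l h1 v \<in> MC_set V l N)
       \<and> smooth_on {v \<in> V 0. l 1 [v] = 0} (B_set V l N h1) (Psi l h1)
       \<and> (\<exists>U. openin (top_of_set {v \<in> V 0. l 1 [v] = 0}) U \<and> 0 \<in> U \<and> U \<subseteq> B_set V l N h1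
              \<and> embedding_on {v \<in> V 0. l 1 [v] = 0} U (Psi l h1))"
proof -
  interpret Linf_setting V l N h1 h2
    by (rule Linf_setting.intro[OF assms])
  have "(\<forall>v\<in>B_set V l N h1. summable (w v) \<and> Psi l h1 v \<in> MC_set V l N)
    \<and> embedding_on K (B_set V l N h1) (Psi l h1)"
  proof (cases "\<forall>x\<in>V 0. l 1 [x] = 0")
    case True
    then show ?thesis by (intro trivial_case) simp
  next
    case False
    then show ?thesis using p_ge_1 by (intro nontrivial_case) auto
  qed
  moreover have "w v = (\<lambda>k. (1 / fact k) *\<^sub>R vseq l h1 v k)" for v
    by (simp add: w_def fun_eq_iff)
  ultimately show ?thesis
    using openin_B zero_in_B unfolding embedding_on_def by (intro conjI exI[of _ "B_set V l N h1"]) auto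
qed

end
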